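(* Let $(Z_i)_{i\in\mathbb{Z}}$ be i.i.d. zero-mean random vectors in $\mathbb{R}^d$ that are regularly varying with exponent $\alpha>1$ and tail measure $\nu$. Let $(A_i)_{i\in\mathbb{Z}}$ be deterministic $d\times d$ matrices with $\sum_{i\in\mathbb{Z}}\|A_i\|<\infty$ and such that $\mathcal{A}=\sum_{i\in\mathbb{Z}}A_i$ is invertible, and let $X_k=\sum_{i\in\mathbb{Z}}A_iZ_{k-i}$, $k\in\mathbb{Z}$. Let $S_j^n=\sum_{k=j}^{n+j-1}X_k$ for $j\in\mathbb{Z}$. Suppose $\Gamma$ and $\Psi$ are both admissible failure sets. For each $n$ define \[J_n^{\Psi,+}=\inf\{j\ge 0: S_j^n\in n\Psi^c\},\qquad J_n^{\Psi,-}=\sup\{j<0: S_j^n\in n\Psi^c\}.\] Then, as $n\to\infty$, the conditional distribution of $\big(J_n^{\Psi,+}/n,\,-J_n^{\Psi,-}/n\big)$ given $\{S_0^n\in n\Gamma\}$ converges weakly to the law of a random vector which equals $(U,1-U)$ with probability $\mu(\Psi)$ and equals $(0,0)$ with probability $1-\mu(\Psi)$, where $U$ is standard uniform and \[\mu(\Psi)=\frac{\nu\big(\mathcal{A}^{-1}(\Psi\cap\Gamma)\big)}{\nu(\mathcal{A}^{-1}\Gamma)}.\] In particular, the conditional distribution of $\big(J_n^{\Gamma,+}/n,\,-J_n^{\Gamma,-}/n\big)$ given $\{S_0^n\in n\Gamma\}$ converges weakly to the law of $(U,1-U)$.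
   Context: All vector norms are Euclidean and $\|A\|$ is the $\ell_2\to\ell_2$ operator norm. A random vector $Z_0$ in $\mathbb{R}^d$ is regularly varying with exponent $\alpha$ and tail measure $\nu$ if $\nu$ is a nonzero Radon measure on $[-\infty,\infty]^d\setminus\{0\}$ with $P(Z_0\in u\,\cdot)/P(\|Z_0\|>u)\to\nu(\cdot)$ vaguely as $u\to\infty$, and $\nu(c\Phi)=c^{-\alpha}\nu(\Phi)$ for all measurable $\Phi$, $c>0$. A set $\Gamma\subset\mathbb{R}^d$ is an admissible failure set if it is measurable, $\Gamma\subset\{y:\|y\|>\delta_0\}$ for some $\delta_0>0$, $\nu(\mathcal{A}^{-1}\Gamma)>0$ and $\nu(\partial(\mathcal{A}^{-1}\Gamma))=0$. *)

theory Defs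
  imports "HOL-Probability.Probability"
begin

definition embE :: "real^'d \<Rightarrow> ereal^'d" where
  "embE x = (\<chi> i. ereal (x $ i))"

definition scaleE :: "real \<Rightarrow> ereal^'d \<Rightarrow> ereal^'d" where
  "scaleE c y = (\<chi> i. ereal c * y $ i)"

text \<open>A tail measure of exponent alpha: a nonzero Radon measure on [-inf,inf]^d minus {0}
  (represented as a Borel measure on [-inf,inf]^d giving no mass to {0}; Radon = finite on
  compact subsets of the punctured space), homogeneous of order -alpha.\<close>

definition tail_measure :: "real \<Rightarrow> (ereal^'d) measure \<Rightarrow> bool" where
  "tail_measure \<alpha> \<nu> \<longleftrightarrow>
     sets \<nu> = sets borel \<and>
     emeasure \<nu> {0} = 0 \<and>
     emeasure \<nu> (space \<nu>) \<noteq> 0 \<and>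
     (\<forall>K. compact K \<and> 0 \<notin> K \<longrightarrow> emeasure \<nu> K < \<infinity>) \<and>
     (\<forall>\<Phi>\<in>sets \<nu>. \<forall>c>0. emeasure \<nu> (scaleE c ` \<Phi>) = ennreal (c powr (-\<alpha>)) * emeasure \<nu> \<Phi>)"

text \<open>Regular variation of the random vector Z0 on the probability space M: the measures
  P(Z0 \<in> u \<cdot>)/P(|Z0| > u) converge vaguely (on the punctured compactified space) to nu,
  i.e. against every continuous function with compact support not containing 0.\<close>

definition regularly_varying ::
  "'a measure \<Rightarrow> ('a \<Rightarrow> real^'d) \<Rightarrow> real \<Rightarrow> (ereal^'d) measure \<Rightarrow> bool" where
  "regularly_varying M Z0 \<alpha> \<nu> \<longleftrightarrow>
     tail_measure \<alpha> \<nu> \<and>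
     (\<forall>\<^sub>F u in at_top. 0 < measure M {\<omega>\<in>space M. u < norm (Z0 \<omega>)}) \<and>
     (\<forall>f :: ereal^'d \<Rightarrow> real.
        continuous_on UNIV f \<and> (\<exists>K. compact K \<and> 0 \<notin> K \<and> (\<forall>y. y \<notin> K \<longrightarrow> f y = 0)) \<longrightarrow>
        ((\<lambda>u. (\<integral>\<omega>. f (embE ((1 / u) *\<^sub>R Z0 \<omega>)) \<partial>M)
                / measure M {\<omega>\<in>space M. u < norm (Z0 \<omega>)})
           \<longlongrightarrow> (\<integral>y. f y \<partial>\<nu>)) at_top)"

definition mat_preimage :: "real^'d^'d \<Rightarrow> (real^'d) set \<Rightarrow> (real^'d) set" where
  "mat_preimage B G = {x. B *v x \<in> G}"

definition admissible_failure_set ::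
  "(ereal^'d) measure \<Rightarrow> real^'d^'d \<Rightarrow> (real^'d) set \<Rightarrow> bool" where
  "admissible_failure_set \<nu> B G \<longleftrightarrow>
     G \<in> sets borel \<and>
     (\<exists>\<delta>>0. G \<subseteq> {y. \<delta> < norm y}) \<and>
     0 < emeasure \<nu> (embE ` mat_preimage B G) \<and>
     emeasure \<nu> (frontier (embE ` mat_preimage B G)) = 0"

definition lin_proc :: "(int \<Rightarrow> real^'d^'d) \<Rightarrow> (int \<Rightarrow> 'a \<Rightarrow> real^'d) \<Rightarrow> int \<Rightarrow> 'a \<Rightarrow> real^'d" where
  "lin_proc A Z k \<omega> = (\<Sum>\<^sub>\<infinity>i. A i *v Z (k - i) \<omega>)"

definition block_sum ::
  "(int \<Rightarrow> real^'d^'d) \<Rightarrow> (int \<Rightarrow> 'a \<Rightarrow> real^'d) \<Rightarrow> nat \<Rightarrow> int \<Rightarrow> 'a \<Rightarrow> real^'d" where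
  "block_sum A Z n j \<omega> = (\<Sum>k\<in>{j..j + int n - 1}. lin_proc A Z k \<omega>)"

text \<open>J^{Psi,+}_n = inf{j \<ge> 0 : S_j^n \<in> n Psi^c}, J^{Psi,-}_n = sup{j < 0 : S_j^n \<in> n Psi^c},
  as extended reals (inf of the empty set is +inf, sup of the empty set is -inf).\<close>

definition J_plus ::
  "(int \<Rightarrow> real^'d^'d) \<Rightarrow> (int \<Rightarrow> 'a \<Rightarrow> real^'d) \<Rightarrow> (real^'d) set \<Rightarrow> nat \<Rightarrow> 'a \<Rightarrow> ereal" where
  "J_plus A Z P n \<omega> =
     Inf {ereal (real_of_int j) | j. 0 \<le> j \<and> block_sum A Z n j \<omega> \<in> (\<lambda>y. real n *\<^sub>R y) ` (- P)}"

definition J_minus ::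
  "(int \<Rightarrow> real^'d^'d) \<Rightarrow> (int \<Rightarrow> 'a \<Rightarrow> real^'d) \<Rightarrow> (real^'d) set \<Rightarrow> nat \<Rightarrow> 'a \<Rightarrow> ereal" where
  "J_minus A Z P n \<omega> =
     Sup {ereal (real_of_int j) | j. j < 0 \<and> block_sum A Z n j \<omega> \<in> (\<lambda>y. real n *\<^sub>R y) ` (- P)}"

text \<open>Weak convergence of the conditional laws of V n given the events B n, to the law
  whose expectation functional is E: convergence for every bounded continuous test function.\<close>

definition cond_weak_conv ::
  "'a measure \<Rightarrow> (nat \<Rightarrow> 'a \<Rightarrow> 'b::topological_space) \<Rightarrow> (nat \<Rightarrow> 'a set) \<Rightarrow> (('b \<Rightarrow> real) \<Rightarrow> real) \<Rightarrow> bool" where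
  "cond_weak_conv M V B E \<longleftrightarrow>
     (\<forall>f :: 'b \<Rightarrow> real. continuous_on UNIV f \<and> bounded (range f) \<longrightarrow>
        ((\<lambda>n. (\<integral>\<omega>. f (V n \<omega>) * indicator (B n) \<omega> \<partial>M) / measure M (B n)) \<longlonglongrightarrow> E f))"

definition mixture_law_expect :: "real \<Rightarrow> (ereal \<times> ereal \<Rightarrow> real) \<Rightarrow> real" where
  "mixture_law_expect p f =
     p * (\<integral>u. f (ereal u, ereal (1 - u)) \<partial>(uniform_measure lborel {0..1})) + (1 - p) * f (0, 0)"

end

theory Submission
  imports Defs "HOL-Real_Asymp.Real_Asymp"
begin

text \<open>
  The proof is the single big jump principle. Write \<open>S\<^sub>j\<close> for the block sum with start \<open>j\<close>; it is a
  weighted sum of the \<open>Z\<^sub>m\<close>, whose weights are close to \<open>\<A> = \<Sum>A\<^sub>i\<close> for \<open>j \<le> m < j + n\<close> and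
  close to \<open>0\<close> otherwise, except near the two ends of the block. A Chernoff bound shows that, after
  removing the terms larger than \<open>\<epsilon>n\<close>, all \<open>S\<^sub>j\<close> with \<open>\<bar>j\<bar> \<le> n\<close> are below \<open>\<delta>n\<close> up to an event of
  probability \<open>o(n P(\<bar>Z\<^sub>0\<bar> > n))\<close>, and the same bound holds for the occurrence of two large terms.
  So on \<open>{S\<^sub>0 \<in> n\<Gamma>}\<close> there is essentially one large \<open>Z\<^sub>m\<close>, with \<open>m\<close> uniform in \<open>{0,\<dots>,n-1}\<close>, and
  \<open>S\<^sub>j\<close> is close to \<open>\<A>Z\<^sub>m\<close> exactly while \<open>m - n < j \<le> m\<close>. If \<open>\<A>Z\<^sub>m/n \<in> \<Psi>\<close>, the exits occur
  near \<open>m\<close> and \<open>m - n\<close>, otherwise at \<open>0\<close> and \<open>-1\<close>. Vague convergence, together with the null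
  boundaries of the two sets, turns the probabilities of \<open>\<A>Z\<^sub>m/n \<in> \<Gamma>\<close> and \<open>\<A>Z\<^sub>m/n \<in> \<Gamma> \<inter> \<Psi>\<close> into
  values of \<open>\<nu>\<close>, and summing over \<open>m\<close> gives a Riemann sum.
\<close>

section \<open>The compactified space\<close>

text \<open>All quantities are compared with \<open>n * tail n\<close>, which tends to 0, so an
  error that is merely small is useless. Exceptional events need probability
  o(\<open>n * tail n\<close>), up to a fraction fixed in advance, and off them the error must
  vanish when no jump is big; it is therefore measured in multiples of the number of big jumps. The
  maximum over the starts is treated by a plain union bound. This is affordable because regular
  variation bounds \<open>tail\<close> below by a power of n, whereas the Chernoff bound beats every
  power. The variance may be infinite, so that bound rests on a moment of order 1 + \<kappa> <
  \<alpha>. For the remote part of the infinite series only a first moment bound is available; its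
  cut-off is chosen for each n separately, as far out as necessary. Between this cut-off and the
  indices of order n the weights are small but numerous, so tail bounds linear in the weight are
  needed. Near the ends of a block, where a weight is close to neither limit, a small fraction of
  the indices is given up. Finally, \<nu> lives on a compactification in which closures acquire
  points at infinity; homogeneity makes these null.\<close>

lemma compact_UNIV_vec:
  assumes "compact (UNIV :: 'a::topological_space set)"
  shows "compact (UNIV :: ('a^'d) set)"
proof -
  have "compact_space (euclidean :: ('d \<Rightarrow> 'a) topology)"
    unfolding euclidean_product_topology[symmetric] compact_space_product_topology
    using assms by (simp add: compact_space_def)
  hence "compact (UNIV :: ('d \<Rightarrow> 'a) set)" by (simp add: compact_space_def)
  moreover have "continuous_on UNIV (\<lambda>f::'d \<Rightarrow> 'a. \<chi> i. f i)"
    by (intro continuous_on_vec_lambda continuous_on_product_coordinates)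
  ultimately have "compact (range (\<lambda>f::'d \<Rightarrow> 'a. \<chi> i. f i))" by (rule compact_continuous_image[rotated])
  moreover have "range (\<lambda>f::'d \<Rightarrow> 'a. \<chi> i. f i) = UNIV" by (metis surjI vec_nth_inverse)
  ultimately show ?thesis by simp
qed

text \<open>The whole space is compact. Hence the compact sets avoiding 0, in the definitions of the
  tail measure and of vague convergence, are just the closed sets avoiding 0.\<close>

lemma closed_imp_compact_ereal_vec:
  fixes K :: "(ereal^'d) set"
  assumes "closed K" shows "compact K"
  using compact_Int_closed[OF compact_UNIV_vec[OF Extended_Real_Limits.compact_UNIV] assms] by simp

text \<open>Pulling back the metric of \<open>\<real>\<^sup>d\<close> along this embedding supplies the distance functions from which
  continuous approximations of indicators are built.\<close>

definition squash :: "ereal \<Rightarrow> real" where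
  "squash x = real_of_ereal (inverse (1 + max 0 (- x))) - real_of_ereal (inverse (1 + max 0 x))"

definition squash_vec :: "ereal^'d \<Rightarrow> real^'d" where
  "squash_vec y = (\<chi> i. squash (y $ i))"

text \<open>Each half is the inverse of a quantity that is at least 1, hence finite even at an
  infinite argument. This is why positive and negative parts are separated in \<open>squash\<close>:
  a single quotient would become infinity over infinity.\<close>

lemma continuous_on_squash: "continuous_on UNIV squash"
proof -
  have *: "((\<lambda>x. real_of_ereal (inverse (1 + max 0 (g x)))) \<longlongrightarrow> real_of_ereal (inverse (1 + max 0 (g a)))) (at a)"
    if g: "(g \<longlongrightarrow> g a) (at a)" for g :: "ereal \<Rightarrow> ereal" and a
  proof -
    have "0 < 1 + max 0 (g a)"
      by (cases "g a") (auto simp: max_def one_ereal_def zero_ereal_def)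
    hence "1 + max 0 (g a) \<noteq> 0" by simp
    moreover have "\<bar>inverse (1 + max 0 (g a))\<bar> \<noteq> \<infinity>"
      using \<open>0 < 1 + max 0 (g a)\<close> by (cases "1 + max 0 (g a)") auto
    moreover have "((\<lambda>x. 1 + max 0 (g x)) \<longlongrightarrow> 1 + max 0 (g a)) (at a)"
      by (intro tendsto_add_ereal_general tendsto_max g tendsto_const) auto
    ultimately have "((\<lambda>x. inverse (1 + max 0 (g x))) \<longlongrightarrow> inverse (1 + max 0 (g a))) (at a)"
      by (intro Extended_Real.tendsto_inverse_ereal) (simp_all add: max.coboundedI1)
    hence "((\<lambda>x. inverse (1 + max 0 (g x))) \<longlongrightarrow> ereal (real_of_ereal (inverse (1 + max 0 (g a))))) (at a)"
      using \<open>\<bar>inverse (1 + max 0 (g a))\<bar> \<noteq> \<infinity>\<close> by (simp add: ereal_real' del: real_of_ereal_inverse)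
    thus ?thesis by (rule lim_real_of_ereal)
  qed
  show ?thesis
    unfolding squash_def continuous_on_def
    by (intro ballI tendsto_diff *) (auto intro!: tendsto_uminus_ereal tendsto_intros)
qed

lemma squash_ereal: "squash (ereal r) = r / (1 + \<bar>r\<bar>)"
proof -
  have pos: "real_of_ereal (inverse (1 + max 0 (ereal s))) = inverse (1 + s)" if "0 \<le> s" for s
    using that by (simp add: max_def one_ereal_def)
  have neg: "real_of_ereal (inverse (1 + max 0 (ereal s))) = 1" if "s \<le> 0" for s
    using that by (simp add: max_def one_ereal_def zero_ereal_def)
  show ?thesis
  proof (cases "0 \<le> r")
    case True
    thus ?thesis using pos[of r] neg[of "-r"] unfolding squash_def uminus_ereal.simps
      by (simp add: divide_simps)
  next
    case False
    thus ?thesis using pos[of "-r"] neg[of r] unfolding squash_def uminus_ereal.simps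
      by (simp add: divide_simps)
  qed
qed

lemma squash_infinity: "squash \<infinity> = 1" "squash (-\<infinity>) = -1"
  by (simp_all add: squash_def)

lemma inj_squash: "inj squash"
proof (rule injI)
  fix x y assume eq: "squash x = squash y"
  have lt: "\<bar>squash (ereal r)\<bar> < 1" for r
    by (simp add: squash_ereal abs_divide)
  have fin: "r = t" if eq: "squash (ereal r) = squash (ereal t)" for r t :: real
  proof -
    have *: "r / (1 + \<bar>r\<bar>) = t / (1 + \<bar>t\<bar>)" using eq by (simp add: squash_ereal)
    have "\<bar>r\<bar> / (1 + \<bar>r\<bar>) = \<bar>t\<bar> / (1 + \<bar>t\<bar>)" using arg_cong[OF *, of abs] by (simp add: abs_divide)
    moreover have "1 + \<bar>r\<bar> \<noteq> 0" "1 + \<bar>t\<bar> \<noteq> 0" by linarith+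
    ultimately have "\<bar>r\<bar> * (1 + \<bar>t\<bar>) = \<bar>t\<bar> * (1 + \<bar>r\<bar>)" using frac_eq_eq[of "1 + \<bar>r\<bar>" "1 + \<bar>t\<bar>" "\<bar>r\<bar>" "\<bar>t\<bar>"] by blast
    hence abs_eq: "\<bar>r\<bar> = \<bar>t\<bar>" by (simp only: distrib_left mult.commute mult_1_right add_right_cancel)
    show ?thesis using *[unfolded abs_eq] \<open>1 + \<bar>t\<bar> \<noteq> 0\<close> by (metis divide_cancel_right)
  qed
  have inf: "squash (ereal r) \<noteq> 1" "squash (ereal r) \<noteq> -1" for r
    using lt[of r] by auto
  show "x = y"
    by (cases x; cases y) (use eq inf fin in \<open>metis squash_infinity one_neq_neg_one\<close>)+
qed

lemma continuous_on_squash_vec: "continuous_on UNIV squash_vec"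
  unfolding squash_vec_def
  by (intro continuous_on_vec_lambda continuous_on_compose2[OF continuous_on_squash] continuous_on_component)
     auto

lemma inj_squash_vec: "inj squash_vec"
  by (rule injI) (metis (mono_tags, lifting) inj_squash injD squash_vec_def vec_eq_iff vec_lambda_beta)

lemma closed_squash_vec_image: "closed (squash_vec ` K)" if "closed K"
  by (intro compact_imp_closed compact_continuous_image closed_imp_compact_ereal_vec that
      continuous_on_subset[OF continuous_on_squash_vec]) auto

lemma infdist_squash_vec_pos:
  assumes "closed K" "y \<notin> K" "K \<noteq> {}"
  shows "0 < infdist (squash_vec y) (squash_vec ` K)"
proof -
  have "squash_vec y \<notin> squash_vec ` K" using assms inj_squash_vec by (auto dest: injD)
  thus ?thesis using closed_squash_vec_image[OF assms(1)] assms(3)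
    by (simp add: infdist_pos_not_in_closed)
qed

lemma continuous_on_infdist_squash_vec:
  "continuous_on UNIV (\<lambda>y. infdist (squash_vec y) S)"
  by (intro continuous_on_infdist continuous_on_squash_vec)

text \<open>The functions decrease linearly in the squashed distance \<open>h\<close> to
  \<open>K\<close>, with slope \<open>2 / r + k\<close> where \<open>r\<close> is that distance at
  0. The slope \<open>2 / r\<close> alone already forces them to vanish where \<open>h\<close>
  exceeds \<open>r / 2\<close>, so all share one closed support \<open>C\<close> away from 0. This
  makes them admissible in vague convergence and gives a common integrable majorant.\<close>

lemma approx_closed_above:
  fixes K :: "(ereal^'d) set"
  assumes K: "closed K" "0 \<notin> K"
  obtains f :: "nat \<Rightarrow> ereal^'d \<Rightarrow> real" and C where
    "closed C" "0 \<notin> C" "\<And>k. continuous_on UNIV (f k)" "\<And>k y. indicator K y \<le> f k y"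
    "\<And>k y. f k y \<le> indicator C y" "\<And>y. (\<lambda>k. f k y) \<longlonglongrightarrow> indicator K y"
proof (cases "K = {}")
  case True
  thus ?thesis using that[of "{}" "\<lambda>_ _. 0"] by auto
next
  case False
  define h where "h y = infdist (squash_vec y) (squash_vec ` K)" for y
  have h0: "h y = 0" if "y \<in> K" for y using that by (simp add: h_def)
  have hpos: "0 < h y" if "y \<notin> K" for y unfolding h_def by (rule infdist_squash_vec_pos[OF K(1) that False])
  have hnn: "0 \<le> h y" for y by (simp add: h_def infdist_nonneg)
  have hc: "continuous_on UNIV h" unfolding h_def by (rule continuous_on_infdist_squash_vec)
  define r where "r = h 0"
  have r: "0 < r" using hpos[OF K(2)] by (simp add: r_def)
  define f where "f k y = max 0 (1 - (2 / r + real k) * h y)" for k y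
  define C where "C = {y. h y \<le> r / 2}"
  show ?thesis
  proof (rule that[of C f])
    show "closed C" unfolding C_def
      by (intro closed_Collect_le hc continuous_on_const)
    show "0 \<notin> C" using r by (simp add: C_def r_def)
    show "continuous_on UNIV (f k)" for k unfolding f_def by (intro continuous_intros hc)
    show "indicator K y \<le> f k y" for k y by (auto simp: f_def h0 indicator_def)
    show "f k y \<le> indicator C y" for k y
    proof (cases "y \<in> C")
      case True
      have "0 \<le> (2 / r + real k) * h y" using r hnn by simp
      thus ?thesis using True by (simp add: f_def)
    next
      case False
      hence "1 \<le> 2 / r * h y" using r by (simp add: C_def field_simps)
      also have "\<dots> \<le> (2 / r + real k) * h y" using hnn by (simp add: distrib_right)
      finally show ?thesis using False by (simp add: f_def)
    qed
    show "(\<lambda>k. f k y) \<longlonglongrightarrow> indicator K y" for y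
    proof (cases "y \<in> K")
      case True thus ?thesis by (simp add: f_def h0)
    next
      case False
      have "\<forall>\<^sub>F k in sequentially. f k y = 0"
      proof -
        obtain k0 :: nat where k0: "1 / h y < real k0" using reals_Archimedean2 by blast
        have "f k y = 0" if "k0 \<le> k" for k
        proof -
          have "1 \<le> real k * h y" using k0 that hpos[OF False]
            by (smt (verit, best) divide_less_eq mult_right_mono of_nat_le_iff)
          also have "\<dots> \<le> (2 / r + real k) * h y" using hnn r by (simp add: distrib_right)
          finally show ?thesis by (simp add: f_def)
        qed
        thus ?thesis using eventually_sequentially by auto
      qed
      thus ?thesis using False by (simp add: tendsto_eventually)
    qed
  qed
qed

text \<open>The distance to the complement is positive on \<open>U\<close>, so its multiples capped
  at 1 increase to the indicator. Since 0 is not in the closure of \<open>U\<close>, the complement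
  is nonempty and the closure can later serve as compact support.\<close>

lemma approx_open_below:
  fixes U :: "(ereal^'d) set"
  assumes U: "open U" "0 \<notin> closure U"
  obtains f :: "nat \<Rightarrow> ereal^'d \<Rightarrow> real" where
    "\<And>k. continuous_on UNIV (f k)" "\<And>k y. 0 \<le> f k y"
    "\<And>k y. f k y \<le> indicator U y" "\<And>y. (\<lambda>k. f k y) \<longlonglongrightarrow> indicator U y"
proof -
  have ne: "- U \<noteq> {}" using U(2) closure_subset[of U] by auto
  define h where "h y = infdist (squash_vec y) (squash_vec ` (- U))" for y
  have h0: "h y = 0" if "y \<notin> U" for y using that by (simp add: h_def)
  have hpos: "0 < h y" if "y \<in> U" for y
    unfolding h_def using that U by (intro infdist_squash_vec_pos ne) auto
  have hnn: "0 \<le> h y" for y by (simp add: h_def infdist_nonneg)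
  have hc: "continuous_on UNIV h" unfolding h_def by (rule continuous_on_infdist_squash_vec)
  define f where "f k y = min 1 (real k * h y)" for k y
  show ?thesis
  proof (rule that[of f])
    show "continuous_on UNIV (f k)" for k unfolding f_def by (intro continuous_intros hc)
    show "0 \<le> f k y" for k y using hnn by (simp add: f_def)
    show "f k y \<le> indicator U y" for k y by (cases "y \<in> U") (simp_all add: f_def h0)
    show "(\<lambda>k. f k y) \<longlonglongrightarrow> indicator U y" for y
    proof (cases "y \<in> U")
      case False thus ?thesis by (simp add: f_def h0)
    next
      case True
      obtain k0 :: nat where k0: "1 / h y < real k0" using reals_Archimedean2 by blast
      have "f k y = 1" if "k0 \<le> k" for k
      proof -
        have "1 \<le> real k * h y" using k0 that hpos[OF True]
          by (smt (verit, best) divide_less_eq mult_right_mono of_nat_le_iff)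
        thus ?thesis by (simp add: f_def)
      qed
      hence "\<forall>\<^sub>F k in sequentially. f k y = 1" using eventually_sequentially by auto
      thus ?thesis using True by (simp add: tendsto_eventually)
    qed
  qed
qed

section \<open>The copy of Euclidean space inside its compactification\<close>

definition unembE :: "ereal^'d \<Rightarrow> real^'d" where
  "unembE y = (\<chi> i. real_of_ereal (y $ i))"

definition finite_part :: "(ereal^'d) set" where
  "finite_part = {y. \<forall>i. \<bar>y $ i\<bar> \<noteq> \<infinity>}"

lemma unembE_embE [simp]: "unembE (embE x) = x"
  by (simp add: unembE_def embE_def vec_eq_iff)

lemma embE_unembE: "y \<in> finite_part \<Longrightarrow> embE (unembE y) = y"
  by (simp add: unembE_def embE_def finite_part_def vec_eq_iff ereal_real)

lemma embE_in_finite_part: "embE x \<in> finite_part"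
  by (simp add: embE_def finite_part_def)

lemma inj_embE: "inj embE"
  by (metis injI unembE_embE)

lemma embE_eq_iff [simp]: "embE x = embE y \<longleftrightarrow> x = y"
  by (metis unembE_embE)

lemma embE_in_image_iff [simp]: "embE x \<in> embE ` G \<longleftrightarrow> x \<in> G"
  using inj_embE by (auto dest: injD)

lemma embE_0: "embE 0 = 0"
  by (simp add: embE_def vec_eq_iff zero_ereal_def)

text \<open>Turns images under \<open>embE\<close> into preimages under \<open>unembE\<close>, for
  which openness and Borel measurability are inherited from the target set. The intersection is
  needed because \<open>unembE\<close> sends infinite coordinates to 0.\<close>

lemma embE_image_eq: "embE ` G = finite_part \<inter> unembE -` G"
  by (auto simp: embE_in_finite_part) (metis embE_unembE image_eqI)

lemma continuous_on_embE: "continuous_on UNIV embE"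
  unfolding embE_def
  by (intro continuous_on_vec_lambda continuous_on_ereal continuous_on_component continuous_on_id)

lemma open_finite_part: "open (finite_part :: (ereal^'d) set)"
proof -
  have eq: "(finite_part :: (ereal^'d) set) = (\<Inter>i\<in>UNIV. (\<lambda>y::ereal^'d. y $ i) -` {-\<infinity><..<\<infinity>})"
    by (auto simp: finite_part_def) (metis abs_ereal.simps(2,3) uminus_ereal.simps(3))+
  show ?thesis unfolding eq
    by (intro open_INT ballI open_vimage continuous_on_component continuous_on_id) auto
qed

lemma continuous_on_unembE: "continuous_on finite_part unembE"
  unfolding continuous_on_def
proof (intro ballI vec_tendstoI)
  fix y :: "ereal^'d" and i assume y: "y \<in> finite_part"
  have "((\<lambda>z. z $ i) \<longlongrightarrow> y $ i) (at y within finite_part)"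
    by (intro tendsto_vec_nth tendsto_ident_at)
  moreover have "y $ i = ereal (unembE y $ i)"
    using y by (simp add: finite_part_def unembE_def ereal_real)
  ultimately have "((\<lambda>z. z $ i) \<longlongrightarrow> ereal (unembE y $ i)) (at y within finite_part)" by simp
  from lim_real_of_ereal[OF this]
  show "((\<lambda>z. unembE z $ i) \<longlongrightarrow> unembE y $ i) (at y within finite_part)"
    by (simp add: unembE_def)
qed

lemma open_embE_image: "open U \<Longrightarrow> open (embE ` U)"
  unfolding embE_image_eq
  by (intro continuous_open_preimage continuous_on_unembE open_finite_part)

lemma embE_borel_measurable [measurable]: "embE \<in> borel_measurable borel"
  by (intro borel_measurable_continuous_onI continuous_on_embE)

lemma sets_finite_part [measurable]: "finite_part \<in> sets borel"
  by (intro borel_open open_finite_part)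

lemma vec_nth_measurable_ereal: "(\<lambda>y::ereal^'d. y $ i) \<in> borel_measurable borel"
  by (intro borel_measurable_continuous_onI continuous_on_component continuous_on_id)

lemma borel_measurable_vec_real:
  fixes f :: "'a \<Rightarrow> real^'d"
  assumes "\<And>i. (\<lambda>x. f x $ i) \<in> borel_measurable M"
  shows "f \<in> borel_measurable M"
  unfolding borel_measurable_euclidean_space[of f] 
  using assms by (auto simp: Basis_vec_def inner_axis)

lemma unembE_measurable [measurable]: "unembE \<in> borel_measurable borel"
  by (rule borel_measurable_vec_real)
     (simp add: unembE_def borel_measurable_real_of_ereal[OF vec_nth_measurable_ereal])

lemma sets_embE_image [measurable]: "G \<in> sets borel \<Longrightarrow> embE ` G \<in> sets borel"
proof -
  assume "G \<in> sets borel"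
  hence "unembE -` G \<inter> space borel \<in> sets borel" by (intro measurable_sets[OF unembE_measurable])
  thus ?thesis unfolding embE_image_eq by auto
qed

text \<open>The image of the complement of \<open>F\<close> is open, so the closure can add only
  points with an infinite coordinate.\<close>

lemma closure_embE_image:
  assumes "closed F"
  shows "closure (embE ` F) \<inter> finite_part = embE ` F"
proof -
  have "open (embE ` (- F))" using assms by (intro open_embE_image) auto
  moreover have "embE ` (- F) \<inter> embE ` F = {}" by auto
  ultimately have "embE ` (- F) \<inter> closure (embE ` F) = {}" by (simp add: open_Int_closure_eq_empty)
  moreover have "finite_part = embE ` F \<union> embE ` (- F)" unfolding embE_image_eq by auto
  moreover have "embE ` F \<subseteq> closure (embE ` F)" by (rule closure_subset)
  ultimately show ?thesis by blast
qed

lemma zero_notin_closure_embE_image: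
  assumes "0 \<notin> closure G"
  shows "0 \<notin> closure (embE ` G)"
proof -
  have "0 \<notin> closure (embE ` G) \<inter> finite_part"
  proof -
    have "closure (embE ` G) \<subseteq> closure (embE ` closure G)"
      by (intro closure_mono image_mono closure_subset)
    moreover have "0 \<notin> embE ` closure G" using assms by (metis embE_0 embE_in_image_iff)
    ultimately show ?thesis using closure_embE_image[of "closure G"] by auto
  qed
  moreover have "(0::ereal^'b) \<in> finite_part" by (metis embE_0 embE_in_finite_part)
  ultimately show ?thesis by auto
qed

text \<open>Continuity of \<open>embE\<close> carries closure points to closure points and pulls
  open neighbourhoods back. Only an inclusion is possible, as the right-hand side may contain points
  at infinity, but it is the direction that transfers null boundaries.\<close>

lemma embE_frontier_subset: "embE ` frontier G \<subseteq> frontier (embE ` G)"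
proof
  fix y assume "y \<in> embE ` frontier G"
  then obtain x where x: "y = embE x" "x \<in> closure G" "x \<notin> interior G" by (auto simp: frontier_def)
  have "y \<in> closure (embE ` G)"
  proof -
    have "embE ` closure G \<subseteq> closure (embE ` G)"
      by (rule image_closure_subset[OF continuous_on_subset[OF continuous_on_embE]]) (auto simp: closure_subset)
    thus ?thesis using x by auto
  qed
  moreover have "y \<notin> interior (embE ` G)"
  proof
    assume "y \<in> interior (embE ` G)"
    then obtain V where V: "open V" "y \<in> V" "V \<subseteq> embE ` G" by (auto simp: interior_def)
    have "open (embE -` V)" by (rule open_vimage[OF V(1) continuous_on_embE])
    moreover have "embE -` V \<subseteq> G" using V(3) by auto
    moreover have "x \<in> embE -` V" using V x by auto
    ultimately show False using x(3) by (meson interior_maximal subsetD)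
  qed
  ultimately show "y \<in> frontier (embE ` G)" by (simp add: frontier_def)
qed

lemma scaleE_embE: "scaleE c (embE x) = embE (c *\<^sub>R x)"
  by (simp add: scaleE_def embE_def vec_eq_iff)

section \<open>Real analysis\<close>

lemma obtain_dyadic:
  fixes t :: real
  assumes "1 \<le> t"
  obtains k :: nat where "2 ^ k \<le> t" "t < 2 ^ Suc k"
proof -
  define k where "k = nat \<lfloor>log 2 t\<rfloor>"
  have l: "0 \<le> log 2 t" using assms by simp
  have k: "real k \<le> log 2 t" "log 2 t < real (Suc k)"
    using l by (auto simp: k_def) linarith+
  have "2 ^ k \<le> t"
    using k(1) assms by (simp add: le_log_iff powr_realpow)
  moreover have "t < 2 ^ Suc k"
    using k(2) assms by (simp add: log_less_iff powr_realpow flip: power_Suc of_nat_Suc)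
  ultimately show ?thesis by (rule that)
qed

text \<open>No sign condition is imposed on \<open>g\<close>, so that the lower bound below can be
  obtained by applying this to the negative of a function.\<close>

lemma doubling_iterate:
  fixes g :: "real \<Rightarrow> real"
  assumes "\<And>u. u0 \<le> u \<Longrightarrow> g (2 * u) \<le> 2 powr (- b) * g u" "0 < u0" "u0 \<le> u"
  shows "g (2 ^ k * u) \<le> (2 ^ k) powr (- b) * g u"
proof (induction k)
  case (Suc k)
  have "u0 \<le> 2 ^ k * u"
    by (smt (verit, best) assms(2,3) mult_le_cancel_right1 one_le_power)
  hence "g (2 * (2 ^ k * u)) \<le> 2 powr (- b) * g (2 ^ k * u)" by (rule assms(1))
  also have "\<dots> \<le> 2 powr (- b) * ((2 ^ k) powr (- b) * g u)" using Suc by (intro mult_left_mono) auto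
  finally show ?case by (simp add: powr_mult mult.assoc)
qed simp

text \<open>Potter's bound from its dyadic instances: t is rounded down to a power of 2 and
  monotonicity covers the gap, which costs the factor \<open>2 powr b\<close>.\<close>

lemma doubling_upper:
  fixes g :: "real \<Rightarrow> real"
  assumes "\<And>u v. u \<le> v \<Longrightarrow> g v \<le> g u" "\<And>u. 0 \<le> g u"
    and "\<And>u. u0 \<le> u \<Longrightarrow> g (2 * u) \<le> 2 powr (- b) * g u" "0 < u0" "u0 \<le> u" "1 \<le> t" "0 \<le> b"
  shows "g (t * u) \<le> 2 powr b * t powr (- b) * g u"
proof -
  obtain k :: nat where k: "2 ^ k \<le> t" "t < 2 ^ Suc k" using obtain_dyadic[OF assms(6)] .
  have "g (t * u) \<le> g (2 ^ k * u)" using k assms by (intro assms(1) mult_right_mono) auto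
  also have "\<dots> \<le> (2 ^ k) powr (- b) * g u" by (rule doubling_iterate[where g=g]) (use assms in auto)
  also have "\<dots> \<le> (2 powr b * t powr (- b)) * g u"
  proof (rule mult_right_mono)
    have "t powr b \<le> (2 * 2 ^ k) powr b" using k assms by (intro powr_mono2) auto
    also have "\<dots> = 2 powr b * (2 ^ k) powr b" by (simp add: powr_mult)
    finally show "(2 ^ k) powr (- b) \<le> 2 powr b * t powr (- b)"
      using assms(6) by (simp add: powr_minus field_simps)
  qed (rule assms(2))
  finally show ?thesis .
qed

lemma doubling_lower:
  fixes g :: "real \<Rightarrow> real"
  assumes "\<And>u v. u \<le> v \<Longrightarrow> g v \<le> g u" "\<And>u. 0 \<le> g u"
    and "\<And>u. u0 \<le> u \<Longrightarrow> 2 powr (- c) * g u \<le> g (2 * u)" "0 < u0" "1 \<le> t" "0 \<le> c"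
  shows "2 powr (- c) * t powr (- c) * g u0 \<le> g (t * u0)"
proof -
  obtain k :: nat where k: "2 ^ k \<le> t" "t < 2 ^ Suc k" using obtain_dyadic[OF assms(5)] .
  have "- g (2 ^ Suc k * u0) \<le> (2 ^ Suc k) powr (- c) * - g u0"
    by (rule doubling_iterate[where g="\<lambda>u. - g u"]) (use assms(3,4) in auto)
  hence "(2 ^ Suc k) powr (- c) * g u0 \<le> g (2 ^ Suc k * u0)" by simp
  also have "\<dots> \<le> g (t * u0)" using k assms by (intro assms(1) mult_right_mono) auto
  finally have *: "(2 ^ Suc k) powr (- c) * g u0 \<le> g (t * u0)" .
  have "2 powr (- c) * t powr (- c) * g u0 \<le> (2 ^ Suc k) powr (- c) * g u0"
  proof (rule mult_right_mono)
    have "(2 * t) powr (- c) \<le> (2 ^ Suc k) powr (- c)" using k assms by (intro powr_mono2') auto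
    thus "2 powr (- c) * t powr (- c) \<le> (2 ^ Suc k) powr (- c)" using assms(5) by (simp add: powr_mult)
  qed (rule assms(2))
  thus ?thesis using * by linarith
qed

section \<open>Series indexed by the integers\<close>

lemma inj_on_int_shift:
  fixes k m :: int
  shows "inj_on (\<lambda>k. k - m) S" "inj_on (\<lambda>m. k - m) S"
  by (auto simp: inj_on_def)

text \<open>In finite dimension unconditional and absolute summability agree, as seen coordinate by
  coordinate. It serves to describe the points where the series of the process converges by real
  partial sums.\<close>

lemma summable_on_vec_iff_norm:
  fixes f :: "'i \<Rightarrow> real^'d"
  shows "f summable_on S \<longleftrightarrow> (\<lambda>i. norm (f i)) summable_on S"
proof
  assume f: "f summable_on S"
  have "(\<lambda>i. norm (f i $ r)) summable_on S" for r
  proof -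
    have "(\<lambda>i. f i $ r) summable_on S"
      by (rule summable_on_bounded_linear[OF bounded_linear_vec_nth f, unfolded o_def])
    thus ?thesis by (rule summable_on_iff_abs_summable_on_real[THEN iffD1])
  qed
  hence "(\<lambda>i. \<Sum>r\<in>R. norm (f i $ r)) summable_on S" for R
    by (induction R rule: infinite_finite_induct) (auto intro: summable_on_add)
  thus "(\<lambda>i. norm (f i)) summable_on S"
  proof (rule summable_on_comparison_test)
    show "norm (f i) \<le> (\<Sum>r\<in>UNIV. norm (f i $ r))" for i
      using norm_le_l1_cart[of "f i"] by simp
  qed simp
qed (rule abs_summable_summable)

lemma filterlim_int_window: "filterlim (\<lambda>N. {- int N..int N}) (finite_subsets_at_top UNIV) sequentially"
  unfolding filterlim_finite_subsets_at_top
proof (intro allI impI)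
  fix X :: "int set" assume X: "finite X \<and> X \<subseteq> UNIV"
  define N0 where "N0 = nat (Max (insert 0 (abs ` X)))"
  have N0: "\<bar>i\<bar> \<le> int N0" if "i \<in> X" for i
    using X that by (auto simp: N0_def nat_le_eq_zle intro!: Max_ge)
  show "\<forall>\<^sub>F N in sequentially. finite {- int N..int N} \<and> X \<subseteq> {- int N..int N} \<and> {- int N..int N} \<subseteq> UNIV"
    using eventually_ge_at_top[of N0]
  proof eventually_elim
    case (elim N)
    have "i \<in> {- int N..int N}" if "i \<in> X" for i using N0[OF that] elim by auto
    thus ?case by auto
  qed
qed

text \<open>Both quantifiers range over natural numbers, so the condition is a countable combination
  of inequalities and hence measurable when the terms depend measurably on a parameter.\<close>

lemma summable_on_int_iff_bounded:
  fixes f :: "int \<Rightarrow> real"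
  assumes "\<And>i. 0 \<le> f i"
  shows "f summable_on UNIV \<longleftrightarrow> (\<exists>B::nat. \<forall>N::nat. (\<Sum>i\<in>{- int N..int N}. f i) \<le> real B)"
proof
  assume f: "f summable_on UNIV"
  obtain B :: nat where "infsum f UNIV \<le> real B" using real_arch_simple by blast
  moreover have "(\<Sum>i\<in>{- int N..int N}. f i) \<le> infsum f UNIV" for N
    using f assms by (intro finite_sum_le_infsum) auto
  ultimately show "\<exists>B::nat. \<forall>N::nat. (\<Sum>i\<in>{- int N..int N}. f i) \<le> real B" by (meson order_trans)
next
  assume "\<exists>B::nat. \<forall>N::nat. (\<Sum>i\<in>{- int N..int N}. f i) \<le> real B"
  then obtain B :: nat where B: "\<And>N. (\<Sum>i\<in>{- int N..int N}. f i) \<le> real B" by blast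
  show "f summable_on UNIV"
  proof (rule nonneg_bdd_above_summable_on)
    show "bdd_above (sum f ` {F. F \<subseteq> UNIV \<and> finite F})"
    proof (rule bdd_aboveI2)
      fix F :: "int set" assume "F \<in> {F. F \<subseteq> UNIV \<and> finite F}"
      hence F: "finite F" by simp
      have "\<forall>\<^sub>F N in sequentially. finite {- int N..int N} \<and> F \<subseteq> {- int N..int N} \<and> {- int N..int N} \<subseteq> UNIV"
        using filterlim_int_window F unfolding filterlim_finite_subsets_at_top by (elim allE impE) auto
      then obtain N where "F \<subseteq> {- int N..int N}"
        using eventually_happens'[OF sequentially_bot] by blast
      hence "sum f F \<le> sum f {- int N..int N}" using assms by (intro sum_mono2) simp_all
      thus "sum f F \<le> real B" using B[of N] by linarith
    qed
  qed (rule assms)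
qed

text \<open>A closed ball is connected, so if it meets both \<open>G\<close> and its complement it
  meets the frontier.\<close>

lemma mem_iff_of_far_from_frontier:
  fixes x y :: "'b::real_normed_vector"
  assumes "\<And>z. z \<in> frontier G \<Longrightarrow> r < dist x z" "dist x y \<le> r"
  shows "x \<in> G \<longleftrightarrow> y \<in> G"
proof (rule ccontr)
  assume ne: "\<not> ?thesis"
  have in_ball: "x \<in> cball x r" "y \<in> cball x r"
    using assms(2) zero_le_dist[of x y] by (auto simp del: zero_le_dist)
  have "cball x r \<inter> G \<noteq> {}" "cball x r - G \<noteq> {}" using ne in_ball by blast+
  hence "cball x r \<inter> frontier G \<noteq> {}"
    by (intro connected_Int_frontier convex_connected convex_cball)
  then obtain z where "z \<in> frontier G" "dist x z \<le> r" by auto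
  thus False using assms(1)[of z] by simp
qed

text \<open>One known member bounds the infimum above and the absence of members below
  \<open>p\<close> bounds it below; it is therefore a real number, and the later rescaling by n can
  be computed in the reals.\<close>

lemma Inf_ereal_int_bounds:
  assumes "\<And>j. 0 \<le> j \<Longrightarrow> j < p \<Longrightarrow> \<not> Q j" "Q q" "0 \<le> q"
  obtains x where "Inf {ereal (real_of_int j) | j. 0 \<le> j \<and> Q j} = ereal x" "real_of_int p \<le> x" "x \<le> real_of_int q"
proof -
  let ?X = "{ereal (real_of_int j) | j. 0 \<le> j \<and> Q j}"
  have 1: "ereal (real_of_int p) \<le> Inf ?X"
    by (rule Inf_greatest) (use assms(1) in \<open>auto simp: not_less[symmetric]\<close>)
  have 2: "Inf ?X \<le> ereal (real_of_int q)" by (rule Inf_lower) (use assms in auto)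
  obtain x where "Inf ?X = ereal x" using 1 2 by (cases "Inf ?X") auto
  thus ?thesis using that 1 2 by simp
qed

lemma Sup_ereal_int_bounds:
  assumes "\<And>j. j < 0 \<Longrightarrow> p < j \<Longrightarrow> \<not> Q j" "Q q" "q < 0"
  obtains x where "Sup {ereal (real_of_int j) | j. j < 0 \<and> Q j} = ereal x" "real_of_int q \<le> x" "x \<le> real_of_int p"
proof -
  let ?X = "{ereal (real_of_int j) | j. j < 0 \<and> Q j}"
  have 1: "Sup ?X \<le> ereal (real_of_int p)"
    by (rule Sup_least) (use assms(1) in \<open>auto simp: not_less[symmetric]\<close>)
  have 2: "ereal (real_of_int q) \<le> Sup ?X" by (rule Sup_upper) (use assms in auto)
  obtain x where "Sup ?X = ereal x" using 1 2 by (cases "Sup ?X") auto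
  thus ?thesis using that 1 2 by simp
qed

lemma mem_scaleR_image_iff:
  fixes y :: "'b::real_vector"
  assumes "c \<noteq> 0"
  shows "y \<in> (\<lambda>x. c *\<^sub>R x) ` G \<longleftrightarrow> (1 / c) *\<^sub>R y \<in> G"
proof
  assume "(1 / c) *\<^sub>R y \<in> G"
  moreover have "y = c *\<^sub>R ((1 / c) *\<^sub>R y)" using assms by simp
  ultimately show "y \<in> (\<lambda>x. c *\<^sub>R x) ` G" by blast
qed (use assms in auto)

text \<open>On each cell the mean value theorem writes the increment of the primitive
  \<open>G\<close> as the cell length times a value of \<open>g\<close> in that cell. Uniform
  continuity compares this value with the one at the left endpoint, and the increments telescope to
  the integral.\<close>

lemma riemann_sum_tendsto:
  fixes g :: "real \<Rightarrow> real"
  assumes g: "continuous_on {0..1} g"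
  shows "(\<lambda>n. (\<Sum>k<n. g (real k / real n)) / real n) \<longlonglongrightarrow> integral {0..1} g"
proof (rule LIMSEQ_I)
  fix e :: real assume e: "0 < e"
  have "uniformly_continuous_on {0..1} g" using g by (intro compact_uniformly_continuous) auto
  then obtain d where d: "0 < d" "\<And>x y. x \<in> {0..1} \<Longrightarrow> y \<in> {0..1} \<Longrightarrow> dist y x < d \<Longrightarrow> dist (g y) (g x) < e / 2"
    unfolding uniformly_continuous_on_def using e by (meson half_gt_zero)
  obtain N :: nat where N: "1 / d < real N" using reals_Archimedean2 by blast
  define G where "G x = integral {0..x} g" for x
  have G': "(G has_real_derivative g x) (at x within {0..1})" if "x \<in> {0..1}" for x
    unfolding G_def using integral_has_real_derivative[OF g that] .
  show "\<exists>no. \<forall>n\<ge>no. norm ((\<Sum>k<n. g (real k / real n)) / real n - integral {0..1} g) < e"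
  proof (intro exI allI impI)
    fix n assume n: "max 1 N \<le> n"
    have npos: "0 < real n" using n by simp
    have nd: "1 / real n < d"
    proof -
      have "1 / d < real n" using N n by linarith
      thus ?thesis using d(1) npos by (simp add: field_simps)
    qed
    have step: "\<bar>g (real k / real n) / real n - (G (real (Suc k) / real n) - G (real k / real n))\<bar> \<le> e / 2 / real n"
      if k: "k < n" for k
    proof -
      let ?a = "real k / real n" and ?b = "real (Suc k) / real n"
      have ab: "?a < ?b" "0 \<le> ?a" "?b \<le> 1" using npos k by (auto simp: field_simps)
      obtain x where x: "?a < x" "x < ?b" "G ?b - G ?a = (?b - ?a) * g x"
      proof -
        have "\<exists>x. x \<in> {?a<..<?b} \<and> G ?b - G ?a = g x * (?b - ?a)"
        proof -
          have "(G has_derivative (\<lambda>h. g x * h)) (at x within {?a..?b})" if "?a \<le> x" "x \<le> ?b" for x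
          proof -
            have "(G has_real_derivative g x) (at x within {?a..?b})"
              by (rule DERIV_subset[OF G']) (use that ab order_trans[OF ab(2) that(1)] in auto)
            thus ?thesis by (simp add: has_field_derivative_def)
          qed
          thus ?thesis using mvt_simple[OF ab(1), of G "\<lambda>x h. g x * h"] by blast
        qed
        thus ?thesis using that by (auto simp: mult.commute)
      qed
      have ba: "?b - ?a = 1 / real n" using npos by (simp add: field_simps)
      have eq: "g ?a / real n - (G ?b - G ?a) = (g ?a - g x) / real n"
        unfolding x(3) ba by (simp add: diff_divide_distrib)
      have osc: "\<bar>g ?a - g x\<bar> \<le> e / 2"
      proof -
        have "dist ?a x < d" using x(1,2) ba nd by (simp add: dist_real_def)
        thus ?thesis using d(2)[of x ?a] x ab by (simp add: dist_real_def)
      qed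
      have "\<bar>(g ?a - g x) / real n\<bar> \<le> e / 2 / real n"
        using divide_right_mono[OF osc, of "real n"] by (simp add: abs_divide)
      thus ?thesis unfolding eq .
    qed
    have tel: "(\<Sum>k<n. G (real (Suc k) / real n) - G (real k / real n)) = integral {0..1} g"
      using sum_lessThan_telescope[of "\<lambda>k. G (real k / real n)" n] npos by (simp add: G_def)
    have "(\<Sum>k<n. g (real k / real n)) / real n - integral {0..1} g
        = (\<Sum>k<n. g (real k / real n) / real n - (G (real (Suc k) / real n) - G (real k / real n)))"
      by (simp add: tel[symmetric] sum_subtractf sum_divide_distrib)
    also have "\<bar>\<dots>\<bar> \<le> (\<Sum>k<n. e / 2 / real n)"
      by (intro order_trans[OF sum_abs] sum_mono step) auto
    also have "\<dots> < e" using npos e by simp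
    finally show "norm ((\<Sum>k<n. g (real k / real n)) / real n - integral {0..1} g) < e" by simp
  qed
qed

text \<open>For nonempty closed \<open>F\<close> the distance is attained, so the set is a sublevel
  set of \<open>infdist\<close>. The empty set is separate because \<open>infdist\<close> to it has
  the default value 0.\<close>

lemma closed_near_closed_set:
  fixes F :: "(real^'d) set"
  assumes "closed F"
  shows "closed {x. \<exists>z\<in>F. dist x z \<le> r}"
proof (cases "F = {}")
  case False
  have eq: "{x. \<exists>z\<in>F. dist x z \<le> r} = {x. infdist x F \<le> r}"
  proof (intro equalityI subsetI)
    fix x assume "x \<in> {x. \<exists>z\<in>F. dist x z \<le> r}"
    thus "x \<in> {x. infdist x F \<le> r}" by (auto intro: infdist_le2)
  next
    fix x assume "x \<in> {x. infdist x F \<le> r}"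
    moreover obtain z where "z \<in> F" "infdist x F = dist x z"
      using infdist_attains_inf[OF assms False, of x] by blast
    ultimately show "x \<in> {x. \<exists>z\<in>F. dist x z \<le> r}" by auto
  qed
  show ?thesis unfolding eq
    by (intro closed_Collect_le continuous_on_infdist continuous_on_id continuous_on_const)
qed simp

section \<open>Linear preimages, the uniform law and test functions on pairs\<close>

lemma mat_preimage_eq_vimage: "mat_preimage B G = (*v) B -` G"
  by (auto simp: mat_preimage_def)

lemma continuous_on_matrix_vector_mult: "continuous_on S ((*v) (B :: real^'n^'m))"
  by (rule linear_continuous_on[OF matrix_vector_mul_bounded_linear])

text \<open>Taking preimages under \<open>B\<close> is taking images under its inverse, and
  injective linear images commute with closure and interior.\<close>

lemma frontier_mat_preimage:
  fixes B :: "real^'d^'d"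
  assumes "invertible B"
  shows "frontier (mat_preimage B G) = mat_preimage B (frontier G)"
proof -
  obtain C where C: "B ** C = mat 1" "C ** B = mat 1" using assms by (auto simp: invertible_def)
  have pre: "mat_preimage B H = (*v) C ` H" for H
  proof (intro equalityI subsetI)
    fix x assume "x \<in> mat_preimage B H"
    moreover have "x = C *v (B *v x)" by (simp add: matrix_vector_mul_assoc C)
    ultimately show "x \<in> (*v) C ` H" by (auto simp: mat_preimage_def)
  next
    fix x assume "x \<in> (*v) C ` H"
    thus "x \<in> mat_preimage B H" by (auto simp: mat_preimage_def matrix_vector_mul_assoc C)
  qed
  have "B *v (C *v x) = x" for x by (simp add: matrix_vector_mul_assoc C)
  hence "inj ((*v) C)" by (rule inj_on_inverseI)
  thus ?thesis unfolding pre frontier_def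
    by (simp add: closure_injective_linear_image interior_injective_linear_image image_set_diff)
qed

lemma borel_measurable_matrix_mult [measurable (raw)]:
  fixes B :: "real^'n^'m" and f :: "'b \<Rightarrow> real^'n"
  assumes "f \<in> borel_measurable N"
  shows "(\<lambda>x. B *v f x) \<in> borel_measurable N"
  using assms by (intro borel_measurable_continuous_on[OF linear_continuous_on[OF matrix_vector_mul_bounded_linear]])

lemma bounded_linear_matrix_apply: "bounded_linear (\<lambda>B::real^'n^'m. B *v x)"
proof -
  have "linear (\<lambda>B::real^'n^'m. B *v x)"
    by (rule linearI) (simp_all add: matrix_vector_mult_add_rdistrib scaleR_matrix_vector_assoc)
  thus ?thesis by (rule linear_conv_bounded_linear[THEN iffD1])
qed

lemma integral_uniform_unit_interval:
  fixes g :: "real \<Rightarrow> real"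
  assumes g: "continuous_on UNIV g"
  shows "(\<integral>u. g u \<partial>(uniform_measure lborel {0..1})) = integral {0..1} g"
proof -
  have [measurable]: "g \<in> borel_measurable borel" by (rule borel_measurable_continuous_onI[OF g])
  have "uniform_measure lborel {0..1::real} = density lborel (\<lambda>x. ennreal (indicator {0..1} x))"
    by (auto simp: uniform_measure_def indicator_def intro!: arg_cong[where f="density lborel"])
  hence "(\<integral>u. g u \<partial>(uniform_measure lborel {0..1})) = (\<integral>u. indicator {0..1} u *\<^sub>R g u \<partial>lborel)"
    by (simp add: integral_density)
  also have "\<dots> = integral {0..1} g"
  proof -
    have "set_integrable lborel {0..1} g"
      by (intro borel_integrable_atLeastAtMost' continuous_on_subset[OF g]) auto
    from set_borel_integral_eq_integral(2)[OF this] show ?thesis by (simp add: set_lebesgue_integral_def)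
  qed
  finally show ?thesis .
qed

lemma ereal_pair_oscillation:
  fixes f :: "ereal \<times> ereal \<Rightarrow> real"
  assumes f: "continuous_on UNIV f" and "0 < \<theta>"
  obtains \<rho> where "0 < \<rho>" "\<And>x y u v. u \<in> {0..1} \<Longrightarrow> v \<in> {0..1} \<Longrightarrow> \<bar>x - u\<bar> \<le> \<rho> \<Longrightarrow> \<bar>y - v\<bar> \<le> \<rho> \<Longrightarrow>
    \<bar>f (ereal x, ereal y) - f (ereal u, ereal v)\<bar> \<le> \<theta>"
proof -
  define g where "g p = f (ereal (fst p), ereal (snd p))" for p :: "real \<times> real"
  have "continuous_on UNIV g" unfolding g_def
    by (rule continuous_on_compose2[OF f]) (auto intro!: continuous_on_Pair continuous_on_ereal continuous_intros)
  \<comment> \<open>The box exceeds the unit square by 1 on each side. The radius chosen below is at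
    most 1, so perturbed points stay in this compact set, and at most \<open>d / 3\<close> in each
    coordinate, so the two deviations together stay below \<open>d\<close>.\<close>
  define S where "S = ({-1..2} \<times> {-1..2} :: (real \<times> real) set)"
  have "compact S" unfolding S_def by (intro compact_Times compact_Icc)
  hence "uniformly_continuous_on S g"
    by (rule compact_uniformly_continuous[OF continuous_on_subset[OF \<open>continuous_on UNIV g\<close> subset_UNIV]])
  hence "\<exists>d>0. \<forall>p\<in>S. \<forall>p'\<in>S. dist p' p < d \<longrightarrow> dist (g p') (g p) < \<theta>"
    using assms(2) unfolding uniformly_continuous_on_def by simp
  then obtain d where d: "0 < d" "\<And>p p'. p \<in> S \<Longrightarrow> p' \<in> S \<Longrightarrow> dist p' p < d \<Longrightarrow> dist (g p') (g p) < \<theta>"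
    by metis
  show ?thesis
  proof (rule that[of "min 1 (d / 3)"])
    fix x y u v :: real
    assume uv: "u \<in> {0..1}" "v \<in> {0..1}" and xy: "\<bar>x - u\<bar> \<le> min 1 (d / 3)" "\<bar>y - v\<bar> \<le> min 1 (d / 3)"
    have "dist (x, y) (u, v) \<le> \<bar>x - u\<bar> + \<bar>y - v\<bar>"
      unfolding dist_Pair_Pair dist_real_def using sqrt_sum_squares_le_sum_abs by simp
    also have "\<dots> < d" using xy d(1) by auto
    finally have "dist (g (x, y)) (g (u, v)) < \<theta>"
      by (intro d(2)) (use uv xy in \<open>auto simp: abs_le_iff S_def\<close>)
    thus "\<bar>f (ereal x, ereal y) - f (ereal u, ereal v)\<bar> \<le> \<theta>" by (simp add: g_def dist_real_def)
  qed (use d in auto)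
qed

section \<open>A Chernoff bound for sums of bounded random vectors\<close>

text \<open>Second order Taylor expansion with Lagrange remainder, whose exponential factor is at
  most \<open>exp b\<close>.\<close>

lemma exp_le_quadratic:
  fixes y b :: real
  assumes "\<bar>y\<bar> \<le> b"
  shows "exp y \<le> 1 + y + y\<^sup>2 * exp b"
proof -
  obtain t where t: "\<bar>t\<bar> \<le> \<bar>y\<bar>" "exp y = (\<Sum>m<2. y ^ m / fact m) + exp t / fact 2 * y ^ 2"
    using Maclaurin_exp_le[of y 2] by blast
  have "exp t / 2 \<le> exp b"
  proof -
    have "exp t \<le> exp b" using t(1) assms by simp
    thus ?thesis using exp_gt_zero[of b] by linarith
  qed
  hence "exp t / 2 * y\<^sup>2 \<le> exp b * y\<^sup>2" by (intro mult_right_mono) auto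
  thus ?thesis using t(2) by (simp add: lessThan_Suc numeral_2_eq_2 mult.commute)
qed

context prob_space
begin

lemma integrable_of_bool:
  assumes [measurable]: "Measurable.pred M Q"
  shows "integrable M (\<lambda>\<omega>. of_bool (Q \<omega>) :: real)"
  by (rule integrable_const_bound[of _ 1]) auto

lemma expectation_of_bool:
  assumes [measurable]: "Measurable.pred M Q"
  shows "expectation (\<lambda>\<omega>. of_bool (Q \<omega>)) = \<P>(\<omega> in M. Q \<omega>)"
proof -
  have "expectation (\<lambda>\<omega>. of_bool (Q \<omega>)) = expectation (indicat_real {\<omega>\<in>space M. Q \<omega>})"
    by (intro Bochner_Integration.integral_cong) (auto simp: indicator_def)
  also have "\<dots> = \<P>(\<omega> in M. Q \<omega>)"
    by (subst Bochner_Integration.integral_indicator) (auto intro!: arg_cong[where f=prob])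
  finally show ?thesis .
qed

text \<open>Integrate the quadratic bound for the exponential and return to an exponential through 1
  + x \<le> exp x. A mean of size \<open>e\<close> is allowed, since truncation destroys the
  centring of the variables.\<close>

lemma expectation_exp_bounded:
  fixes W :: "'a \<Rightarrow> real"
  assumes [measurable]: "W \<in> borel_measurable M"
    and b: "\<And>\<omega>. \<bar>W \<omega>\<bar> \<le> b" and e: "\<bar>expectation W\<bar> \<le> e" and v: "expectation (\<lambda>\<omega>. (W \<omega>)\<^sup>2) \<le> v"
    and s: "0 \<le> s"
  shows "integrable M (\<lambda>\<omega>. exp (s * W \<omega>))"
    and "expectation (\<lambda>\<omega>. exp (s * W \<omega>)) \<le> exp (s * e + s\<^sup>2 * exp (s * b) * v)"
proof -
  have sb: "\<bar>s * W \<omega>\<bar> \<le> s * b" for \<omega> using b[of \<omega>] s by (simp add: abs_mult mult_left_mono)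
  show int: "integrable M (\<lambda>\<omega>. exp (s * W \<omega>))"
    by (rule integrable_const_bound[of _ "exp (s * b)"]) (use sb in \<open>auto intro: order_trans[OF abs_ge_self]\<close>)
  have intW: "integrable M W" by (rule integrable_const_bound[of _ b]) (use b in auto)
  have "\<bar>W \<omega>\<bar>\<^sup>2 \<le> b\<^sup>2" for \<omega> by (rule power_mono[OF b]) simp
  hence intW2: "integrable M (\<lambda>\<omega>. (W \<omega>)\<^sup>2)"
    by (intro integrable_const_bound[of _ "b\<^sup>2"]) auto
  have "expectation (\<lambda>\<omega>. exp (s * W \<omega>)) \<le> expectation (\<lambda>\<omega>. 1 + s * W \<omega> + s\<^sup>2 * exp (s * b) * (W \<omega>)\<^sup>2)"
  proof (rule integral_mono[OF int])
    show "integrable M (\<lambda>\<omega>. 1 + s * W \<omega> + s\<^sup>2 * exp (s * b) * (W \<omega>)\<^sup>2)" using intW intW2 by simp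
    show "exp (s * W \<omega>) \<le> 1 + s * W \<omega> + s\<^sup>2 * exp (s * b) * (W \<omega>)\<^sup>2" for \<omega>
      using exp_le_quadratic[OF sb[of \<omega>]] by (simp add: power_mult_distrib mult_ac)
  qed
  also have "\<dots> = 1 + s * expectation W + s\<^sup>2 * exp (s * b) * expectation (\<lambda>\<omega>. (W \<omega>)\<^sup>2)"
    using intW intW2 by (simp add: prob_space)
  also have "\<dots> \<le> 1 + (s * e + s\<^sup>2 * exp (s * b) * v)"
  proof -
    have "s * expectation W \<le> s * e" using e s by (intro mult_left_mono) auto
    moreover have "s\<^sup>2 * exp (s * b) * expectation (\<lambda>\<omega>. (W \<omega>)\<^sup>2) \<le> s\<^sup>2 * exp (s * b) * v"
      using v by (intro mult_left_mono) auto
    ultimately show ?thesis by linarith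
  qed
  also have "\<dots> \<le> exp (s * e + s\<^sup>2 * exp (s * b) * v)" by (rule exp_ge_add_one_self)
  finally show "expectation (\<lambda>\<omega>. exp (s * W \<omega>)) \<le> exp (s * e + s\<^sup>2 * exp (s * b) * v)" .
qed

text \<open>Exponential Markov inequality at a free parameter \<open>s\<close>. The bounds
  \<open>e i\<close> and \<open>v i\<close> depend on the index because the weights in a block sum
  do; only their sums enter.\<close>

lemma chernoff_bounded_sum:
  fixes W :: "'i \<Rightarrow> 'a \<Rightarrow> real"
  assumes fin: "finite I" and ind: "indep_vars (\<lambda>_. borel) W I"
    and b: "\<And>i \<omega>. i \<in> I \<Longrightarrow> \<bar>W i \<omega>\<bar> \<le> b"
    and e: "\<And>i. i \<in> I \<Longrightarrow> \<bar>expectation (W i)\<bar> \<le> e i"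
    and v: "\<And>i. i \<in> I \<Longrightarrow> expectation (\<lambda>\<omega>. (W i \<omega>)\<^sup>2) \<le> v i"
    and s: "0 < s"
  shows "\<P>(\<omega> in M. x < (\<Sum>i\<in>I. W i \<omega>))
    \<le> exp (- s * x + s * (\<Sum>i\<in>I. e i) + s\<^sup>2 * exp (s * b) * (\<Sum>i\<in>I. v i))"
proof -
  have Wm [measurable]: "W i \<in> borel_measurable M" if "i \<in> I" for i
    using ind that by (auto simp: indep_vars_def2)
  note * = expectation_exp_bounded[OF Wm b e v order.strict_implies_order[OF s]]
  have ind': "indep_vars (\<lambda>_. borel) (\<lambda>i \<omega>. exp (s * W i \<omega>)) I"
    by (rule indep_vars_compose2[OF ind]) auto
  have int: "integrable M (\<lambda>\<omega>. \<Prod>i\<in>I. exp (s * W i \<omega>))"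
    by (rule indep_vars_integrable[OF fin ind' *(1)])
  have Sm [measurable]: "(\<lambda>\<omega>. \<Sum>i\<in>I. W i \<omega>) \<in> borel_measurable M"
    by (intro borel_measurable_sum Wm)
  have "\<P>(\<omega> in M. x < (\<Sum>i\<in>I. W i \<omega>))
    = expectation (indicat_real {\<omega>\<in>space M. x < (\<Sum>i\<in>I. W i \<omega>)})"
    by (subst Bochner_Integration.integral_indicator) (auto intro!: arg_cong[where f=prob])
  also have "\<dots> \<le> expectation (\<lambda>\<omega>. exp (- s * x) * (\<Prod>i\<in>I. exp (s * W i \<omega>)))"
  proof (rule integral_mono)
    show "integrable M (indicat_real {\<omega>\<in>space M. x < (\<Sum>i\<in>I. W i \<omega>)})"
      by (rule integrable_const_bound[of _ 1]) (auto simp: indicator_def)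
    show "integrable M (\<lambda>\<omega>. exp (- s * x) * (\<Prod>i\<in>I. exp (s * W i \<omega>)))"
      using int by simp
    fix \<omega>
    have "exp (- s * x) * (\<Prod>i\<in>I. exp (s * W i \<omega>)) = exp (s * ((\<Sum>i\<in>I. W i \<omega>) - x))"
      by (simp add: exp_sum[OF fin, symmetric] exp_add[symmetric] sum_distrib_left algebra_simps)
    moreover have "1 \<le> exp (s * ((\<Sum>i\<in>I. W i \<omega>) - x))" if "x < (\<Sum>i\<in>I. W i \<omega>)" using that s by simp
    ultimately show "indicat_real {\<omega>\<in>space M. x < (\<Sum>i\<in>I. W i \<omega>)} \<omega> \<le> exp (- s * x) * (\<Prod>i\<in>I. exp (s * W i \<omega>))"
      by (simp add: indicator_def)
  qed
  also have "\<dots> = exp (- s * x) * (\<Prod>i\<in>I. expectation (\<lambda>\<omega>. exp (s * W i \<omega>)))"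
    using indep_vars_lebesgue_integral[OF fin ind' *(1)] by simp
  also have "\<dots> \<le> exp (- s * x) * (\<Prod>i\<in>I. exp (s * e i + s\<^sup>2 * exp (s * b) * v i))"
    by (intro mult_left_mono prod_mono conjI *(2) integral_nonneg_AE) auto
  also have "\<dots> = exp (- s * x + s * (\<Sum>i\<in>I. e i) + s\<^sup>2 * exp (s * b) * (\<Sum>i\<in>I. v i))"
    by (simp add: exp_sum[OF fin, symmetric] exp_add[symmetric] sum.distrib sum_distrib_left sum_distrib_right algebra_simps)
  finally show ?thesis .
qed

text \<open>If the norm of a vector exceeds x, some coordinate exceeds x divided by the dimension in
  absolute value. Two signs and all coordinates give the prefactor.\<close>

lemma chernoff_bounded_sum_vec:
  fixes W :: "'i \<Rightarrow> 'a \<Rightarrow> real^'d"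
  assumes fin: "finite I" and ind: "indep_vars (\<lambda>_. borel) W I"
    and b: "\<And>i \<omega>. i \<in> I \<Longrightarrow> norm (W i \<omega>) \<le> b"
    and e: "\<And>i. i \<in> I \<Longrightarrow> norm (expectation (W i)) \<le> e i"
    and v: "\<And>i. i \<in> I \<Longrightarrow> expectation (\<lambda>\<omega>. (norm (W i \<omega>))\<^sup>2) \<le> v i"
    and s: "0 < s"
  shows "\<P>(\<omega> in M. x < norm (\<Sum>i\<in>I. W i \<omega>))
    \<le> 2 * real CARD('d) * exp (- s * (x / real CARD('d)) + s * (\<Sum>i\<in>I. e i) + s\<^sup>2 * exp (s * b) * (\<Sum>i\<in>I. v i))"
proof -
  define d where "d = real CARD('d)"
  have d: "0 < d" by (simp add: d_def)
  define B where "B = exp (- s * (x / d) + s * (\<Sum>i\<in>I. e i) + s\<^sup>2 * exp (s * b) * (\<Sum>i\<in>I. v i))"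
  have Wm [measurable]: "W i \<in> borel_measurable M" if "i \<in> I" for i
    using ind that by (auto simp: indep_vars_def2)
  have nthm: "(\<lambda>y::real^'d. y $ k) \<in> borel_measurable borel" for k
    by (intro borel_measurable_continuous_onI continuous_intros)
  have Sm [measurable]: "(\<lambda>\<omega>. \<Sum>i\<in>I. W i \<omega>) \<in> borel_measurable M"
    by (intro borel_measurable_sum Wm)
  have intW: "integrable M (W i)" if "i \<in> I" for i
    by (rule integrable_const_bound[of _ b]) (use b that in auto)
  define E where "E \<sigma> k = {\<omega>\<in>space M. x / d < (\<Sum>i\<in>I. \<sigma> * W i \<omega> $ k)}" for \<sigma> :: real and k
  have coord: "prob (E \<sigma> k) \<le> B" if sg: "\<bar>\<sigma>\<bar> = 1" for \<sigma> k
    unfolding B_def E_def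
  proof (rule chernoff_bounded_sum[OF fin _ _ _ _ s])
    show "indep_vars (\<lambda>_. borel) (\<lambda>i \<omega>. \<sigma> * W i \<omega> $ k) I"
      by (rule indep_vars_compose2[OF ind]) (use nthm in measurable)
    fix i assume i: "i \<in> I"
    have cb: "\<bar>\<sigma> * y $ k\<bar> \<le> norm y" for y :: "real^'d"
      using component_le_norm_cart[of y k] sg by (simp add: abs_mult)
    show "\<bar>\<sigma> * W i \<omega> $ k\<bar> \<le> b" for \<omega> using cb[of "W i \<omega>"] b[OF i, of \<omega>] by linarith
    have eq: "expectation (\<lambda>\<omega>. \<sigma> * W i \<omega> $ k) = \<sigma> * (expectation (W i)) $ k"
      using integral_bounded_linear[OF bounded_linear_vec_nth intW[OF i], of k] by simp
    show "\<bar>expectation (\<lambda>\<omega>. \<sigma> * W i \<omega> $ k)\<bar> \<le> e i"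
      unfolding eq using cb[of "expectation (W i)"] e[OF i] by linarith
    have "(norm (W i \<omega>))\<^sup>2 \<le> b\<^sup>2" for \<omega> using b[OF i, of \<omega>] by (intro power_mono) auto
    hence int2: "integrable M (\<lambda>\<omega>. (norm (W i \<omega>))\<^sup>2)"
      by (intro integrable_const_bound[of _ "b\<^sup>2"]) (use i in auto)
    have "expectation (\<lambda>\<omega>. (\<sigma> * W i \<omega> $ k)\<^sup>2) \<le> expectation (\<lambda>\<omega>. (norm (W i \<omega>))\<^sup>2)"
    proof (rule integral_mono'[OF int2])
      show "(\<sigma> * W i \<omega> $ k)\<^sup>2 \<le> (norm (W i \<omega>))\<^sup>2" for \<omega>
        using cb[of "W i \<omega>"] by (metis abs_norm_cancel abs_le_square_iff)
    qed auto
    thus "expectation (\<lambda>\<omega>. (\<sigma> * W i \<omega> $ k)\<^sup>2) \<le> v i" using v[OF i] by linarith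
  qed
  have Em: "E \<sigma> k \<in> events" for \<sigma> k
  proof -
    have "(\<lambda>\<omega>. \<Sum>i\<in>I. \<sigma> * W i \<omega> $ k) \<in> borel_measurable M"
      using measurable_compose[OF Wm nthm] by (intro borel_measurable_sum borel_measurable_times) auto
    thus ?thesis unfolding E_def by measurable
  qed
  have "\<P>(\<omega> in M. x < norm (\<Sum>i\<in>I. W i \<omega>)) \<le> prob (\<Union>k. E 1 k \<union> E (-1) k)"
  proof (rule finite_measure_mono)
    show "{\<omega>\<in>space M. x < norm (\<Sum>i\<in>I. W i \<omega>)} \<subseteq> (\<Union>k. E 1 k \<union> E (-1) k)"
    proof
      fix \<omega> assume w: "\<omega> \<in> {\<omega>\<in>space M. x < norm (\<Sum>i\<in>I. W i \<omega>)}"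
      let ?S = "\<Sum>i\<in>I. W i \<omega>"
      have "\<exists>k. x / d < \<bar>?S $ k\<bar>"
      proof (rule ccontr)
        assume "\<not> ?thesis"
        hence "(\<Sum>k\<in>UNIV. \<bar>?S $ k\<bar>) \<le> (\<Sum>k\<in>(UNIV::'d set). x / d)" by (intro sum_mono) (auto simp: not_less)
        also have "\<dots> = x" using d by (simp add: d_def)
        finally show False using w norm_le_l1_cart[of ?S] by auto
      qed
      then obtain k where k: "x / d < \<bar>?S $ k\<bar>" by blast
      have eq: "(\<Sum>i\<in>I. \<sigma> * W i \<omega> $ k) = \<sigma> * ?S $ k" for \<sigma>
        by (simp add: sum_distrib_left)
      have "\<omega> \<in> E 1 k \<or> \<omega> \<in> E (-1) k"
        unfolding E_def mem_Collect_eq eq using k w by (auto simp: abs_real_def split: if_splits)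
      thus "\<omega> \<in> (\<Union>k. E 1 k \<union> E (-1) k)" by blast
    qed
  qed (use Em in auto)
  also have "\<dots> \<le> (\<Sum>k\<in>UNIV. prob (E 1 k \<union> E (-1) k))"
    by (rule finite_measure_subadditive_finite) (use Em in auto)
  also have "\<dots> \<le> (\<Sum>k\<in>(UNIV::'d set). 2 * B)"
  proof (rule sum_mono)
    fix k show "prob (E 1 k \<union> E (-1) k) \<le> 2 * B"
      using measure_Un_le[OF Em Em, of 1 k "-1" k] coord[of 1 k] coord[of "-1" k] by simp
  qed
  also have "\<dots> = 2 * d * B" by (simp add: d_def)
  finally show ?thesis by (simp add: B_def d_def)
qed

end

section \<open>Regularly varying random vectors\<close>

locale regular_tail = prob_space M for M :: "'a measure" +
  fixes Z0 :: "'a \<Rightarrow> real^'d" and \<alpha> :: real and \<nu> :: "(ereal^'d) measure"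
  assumes Z0_meas [measurable]: "Z0 \<in> borel_measurable M"
    and alpha: "1 < \<alpha>"
    and rv: "regularly_varying M Z0 \<alpha> \<nu>"
begin

definition tail :: "real \<Rightarrow> real" where
  "tail u = \<P>(\<omega> in M. u < norm (Z0 \<omega>))"

text \<open>Real-valued, so it is 0 by default on sets of infinite mass; the lemmas below therefore
  work with subsets of a closed set that misses the origin, on which \<nu> is finite.\<close>

definition tm :: "(real^'d) set \<Rightarrow> real" where
  "tm G = measure \<nu> (embE ` G)"

lemma tail_nonneg: "0 \<le> tail u" by (simp add: tail_def)

lemma tail_pos: "\<forall>\<^sub>F u in at_top. 0 < tail u"
  using rv by (simp add: regularly_varying_def tail_def)

lemma tail_antimono: "u \<le> v \<Longrightarrow> tail v \<le> tail u"
  unfolding tail_def by (intro finite_measure_mono) auto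

lemma sets_nu [measurable_cong]: "sets \<nu> = sets borel"
  using rv by (simp add: regularly_varying_def tail_measure_def)

lemma space_nu: "space \<nu> = UNIV"
  using sets_eq_imp_space_eq[OF sets_nu] by simp

lemma nu_finite: "closed K \<Longrightarrow> 0 \<notin> K \<Longrightarrow> emeasure \<nu> K < \<infinity>"
  using rv closed_imp_compact_ereal_vec[of K] by (auto simp: regularly_varying_def tail_measure_def)

lemma nu_scale: "\<Phi> \<in> sets borel \<Longrightarrow> 0 < c \<Longrightarrow>
    emeasure \<nu> (scaleE c ` \<Phi>) = ennreal (c powr (- \<alpha>)) * emeasure \<nu> \<Phi>"
  using rv sets_nu by (auto simp: regularly_varying_def tail_measure_def)

text \<open>The set of points with an infinite coordinate is invariant under scaling by 2 and is
  closed without 0, so its mass r is finite. Homogeneity gives r = 2 powr (-\<alpha>) times r, with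
  a factor below 1.\<close>

lemma nu_infinite_part: "emeasure \<nu> (- finite_part) = 0"
proof -
  have eq: "scaleE 2 ` (- finite_part) = (- finite_part :: (ereal^'d) set)"
  proof -
    have 1: "scaleE 2 y \<in> finite_part \<longleftrightarrow> y \<in> finite_part" for y :: "ereal^'d"
    proof -
      have "\<bar>ereal 2 * t\<bar> = \<infinity> \<longleftrightarrow> \<bar>t\<bar> = \<infinity>" for t by (cases t) auto
      thus ?thesis by (simp add: finite_part_def scaleE_def)
    qed
    have 2: "scaleE 2 (scaleE (1/2) y) = y" for y :: "ereal^'d"
    proof -
      have "ereal 2 * (ereal (1/2) * t) = t" for t by (cases t) auto
      thus ?thesis by (simp add: scaleE_def vec_eq_iff)
    qed
    show ?thesis
    proof
      show "scaleE 2 ` (- finite_part) \<subseteq> (- finite_part :: (ereal^'d) set)" using 1 by auto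
      show "(- finite_part :: (ereal^'d) set) \<subseteq> scaleE 2 ` (- finite_part)"
        using 1 2 by (metis (no_types, opaque_lifting) ComplD ComplI image_eqI subsetI)
    qed
  qed
  have fin: "emeasure \<nu> (- finite_part) < \<infinity>"
  proof (rule nu_finite)
    show "closed (- finite_part :: (ereal^'d) set)" using open_finite_part by auto
    show "0 \<notin> (- finite_part :: (ereal^'d) set)" by (metis ComplD embE_0 embE_in_finite_part)
  qed
  have "emeasure \<nu> (- finite_part) = ennreal (2 powr (- \<alpha>)) * emeasure \<nu> (- finite_part)"
    using nu_scale[of "- finite_part" 2] eq by simp
  moreover obtain r where r: "emeasure \<nu> (- finite_part) = ennreal r" "0 \<le> r"
    using fin by (cases "emeasure \<nu> (- finite_part)") auto
  ultimately have "r = 2 powr (- \<alpha>) * r" by (simp add: ennreal_mult[symmetric])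
  moreover have "(2::real) powr (- \<alpha>) < 1"
    using alpha powr_less_mono[of "- \<alpha>" 0 2] by simp
  ultimately show ?thesis using r alpha by simp
qed

text \<open>Upper half of a portmanteau argument: some continuous majorant \<open>f k\<close> of the
  indicator has \<nu>-integral within \<theta> of the mass of \<open>K\<close>, and vague
  convergence is applied to this one function.\<close>

lemma limsup_closed:
  assumes K: "closed K" "0 \<notin> K" and \<theta>: "0 < \<theta>"
  shows "\<forall>\<^sub>F u in at_top. \<P>(\<omega> in M. embE ((1 / u) *\<^sub>R Z0 \<omega>) \<in> K) \<le> (measure \<nu> K + \<theta>) * tail u"
proof -
  obtain f :: "nat \<Rightarrow> ereal^'d \<Rightarrow> real" and C where f:
    "closed C" "0 \<notin> C" "\<And>k. continuous_on UNIV (f k)" "\<And>k y. indicator K y \<le> f k y"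
    "\<And>k y. f k y \<le> indicator C y" "\<And>y. (\<lambda>k. f k y) \<longlonglongrightarrow> indicator K y"
    by (rule approx_closed_above[OF K], rule that)
  have fnn: "0 \<le> f k y" for k y by (rule order_trans[OF indicator_pos_le f(4)])
  have f1: "f k y \<le> 1" for k y by (rule order_trans[OF f(5) indicator_le_1])
  have [measurable]: "f k \<in> borel_measurable borel" for k by (intro borel_measurable_continuous_onI f)
  have Cs: "closed C" "compact C" using f(1) closed_imp_compact_ereal_vec by auto
  have Cm [measurable]: "C \<in> sets borel" "K \<in> sets borel" using Cs(1) K(1) by auto
  have "(\<lambda>k. \<integral>y. f k y \<partial>\<nu>) \<longlonglongrightarrow> (\<integral>y. indicator K y \<partial>\<nu>)"
  proof (rule integral_dominated_convergence[where w="indicator C"])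
    show "integrable \<nu> (indicator C :: _ \<Rightarrow> real)"
      using nu_finite[OF Cs(1) f(2)] by (intro integrable_real_indicator) (auto simp: sets_nu)
    show "AE x in \<nu>. norm (f i x) \<le> indicator C x" for i using fnn f(5) by simp
  qed (use f(6) in \<open>auto simp: measurable_cong_sets[OF sets_nu]\<close>)
  hence "(\<lambda>k. \<integral>y. f k y \<partial>\<nu>) \<longlonglongrightarrow> measure \<nu> K" by (simp add: space_nu)
  hence "\<forall>\<^sub>F k in sequentially. (\<integral>y. f k y \<partial>\<nu>) < measure \<nu> K + \<theta>"
    using \<theta> by (intro order_tendstoD) auto
  then obtain k where k: "(\<integral>y. f k y \<partial>\<nu>) < measure \<nu> K + \<theta>"
    by (auto simp: eventually_sequentially)
  have "((\<lambda>u. (\<integral>\<omega>. f k (embE ((1 / u) *\<^sub>R Z0 \<omega>)) \<partial>M) / tail u) \<longlongrightarrow> (\<integral>y. f k y \<partial>\<nu>)) at_top"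
  proof -
    have "f k y = 0" if "y \<notin> C" for y using that fnn[of k y] f(5)[of k y] by simp
    thus ?thesis using rv Cs(2) f(2,3) unfolding regularly_varying_def tail_def by blast
  qed
  hence "\<forall>\<^sub>F u in at_top. (\<integral>\<omega>. f k (embE ((1 / u) *\<^sub>R Z0 \<omega>)) \<partial>M) / tail u < measure \<nu> K + \<theta>"
    using k by (rule order_tendstoD(2))
  thus ?thesis using tail_pos
  proof eventually_elim
    case (elim u)
    have "\<P>(\<omega> in M. embE ((1 / u) *\<^sub>R Z0 \<omega>) \<in> K)
        = (\<integral>\<omega>. indicator K (embE ((1 / u) *\<^sub>R Z0 \<omega>)) \<partial>M)"
      by (simp add: expectation_of_bool[symmetric] indicator_def)
    also have "\<dots> \<le> (\<integral>\<omega>. f k (embE ((1 / u) *\<^sub>R Z0 \<omega>)) \<partial>M)"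
    proof (rule integral_mono)
      show "integrable M (\<lambda>\<omega>. indicator K (embE ((1 / u) *\<^sub>R Z0 \<omega>)) :: real)"
        by (rule integrable_const_bound[of _ 1]) (auto simp: indicator_def)
      show "integrable M (\<lambda>\<omega>. f k (embE ((1 / u) *\<^sub>R Z0 \<omega>)))"
        by (rule integrable_const_bound[of _ 1]) (auto simp: fnn f1)
    qed (rule f(4))
    also have "\<dots> \<le> (measure \<nu> K + \<theta>) * tail u" using elim by (simp add: field_simps)
    finally show ?case .
  qed
qed

text \<open>The dual argument with continuous minorants. The condition on the closure of
  \<open>U\<close> supplies the compact support that vague convergence requires.\<close>

lemma liminf_open:
  assumes U: "open U" "0 \<notin> closure U" and \<theta>: "0 < \<theta>"
  shows "\<forall>\<^sub>F u in at_top. (measure \<nu> U - \<theta>) * tail u \<le> \<P>(\<omega> in M. embE ((1 / u) *\<^sub>R Z0 \<omega>) \<in> U)"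
proof -
  obtain f :: "nat \<Rightarrow> ereal^'d \<Rightarrow> real" where f:
    "\<And>k. continuous_on UNIV (f k)" "\<And>k y. 0 \<le> f k y"
    "\<And>k y. f k y \<le> indicator U y" "\<And>y. (\<lambda>k. f k y) \<longlonglongrightarrow> indicator U y"
    by (rule approx_open_below[OF U], rule that)
  have f1: "f k y \<le> 1" for k y by (rule order_trans[OF f(3) indicator_le_1])
  have [measurable]: "f k \<in> borel_measurable borel" for k by (intro borel_measurable_continuous_onI f)
  have Um [measurable]: "U \<in> sets borel" using U(1) by auto
  have "(\<lambda>k. \<integral>y. f k y \<partial>\<nu>) \<longlonglongrightarrow> (\<integral>y. indicator U y \<partial>\<nu>)"
  proof (rule integral_dominated_convergence[where w="indicator U"])
    have "emeasure \<nu> U \<le> emeasure \<nu> (closure U)"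
      by (intro emeasure_mono closure_subset) (auto simp: sets_nu)
    also have "\<dots> < \<infinity>" using U(2) by (intro nu_finite) auto
    finally show "integrable \<nu> (indicator U :: _ \<Rightarrow> real)"
      by (intro integrable_real_indicator) (auto simp: sets_nu)
    show "AE x in \<nu>. norm (f i x) \<le> indicator U x" for i using f by simp
  qed (use f(4) in \<open>auto simp: measurable_cong_sets[OF sets_nu]\<close>)
  hence "(\<lambda>k. \<integral>y. f k y \<partial>\<nu>) \<longlonglongrightarrow> measure \<nu> U" by (simp add: space_nu)
  hence "\<forall>\<^sub>F k in sequentially. measure \<nu> U - \<theta> < (\<integral>y. f k y \<partial>\<nu>)"
    using \<theta> by (intro order_tendstoD) auto
  then obtain k where k: "measure \<nu> U - \<theta> < (\<integral>y. f k y \<partial>\<nu>)"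
    by (auto simp: eventually_sequentially)
  have "((\<lambda>u. (\<integral>\<omega>. f k (embE ((1 / u) *\<^sub>R Z0 \<omega>)) \<partial>M) / tail u) \<longlongrightarrow> (\<integral>y. f k y \<partial>\<nu>)) at_top"
  proof -
    have "f k y = 0" if "y \<notin> closure U" for y
    proof -
      have "y \<notin> U" using that closure_subset[of U] by auto
      thus ?thesis using f(2,3)[of k y] by simp
    qed
    moreover have "compact (closure U)" by (simp add: closed_imp_compact_ereal_vec)
    ultimately show ?thesis using rv U(2) f(1) unfolding regularly_varying_def tail_def by blast
  qed
  hence "\<forall>\<^sub>F u in at_top. measure \<nu> U - \<theta> < (\<integral>\<omega>. f k (embE ((1 / u) *\<^sub>R Z0 \<omega>)) \<partial>M) / tail u"
    using k by (rule order_tendstoD(1))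
  thus ?thesis using tail_pos
  proof eventually_elim
    case (elim u)
    have "(measure \<nu> U - \<theta>) * tail u \<le> (\<integral>\<omega>. f k (embE ((1 / u) *\<^sub>R Z0 \<omega>)) \<partial>M)"
      using elim by (simp add: field_simps)
    also have "\<dots> \<le> (\<integral>\<omega>. indicator U (embE ((1 / u) *\<^sub>R Z0 \<omega>)) \<partial>M)"
    proof (rule integral_mono)
      show "integrable M (\<lambda>\<omega>. indicator U (embE ((1 / u) *\<^sub>R Z0 \<omega>)) :: real)"
        by (rule integrable_const_bound[of _ 1]) (auto simp: indicator_def)
      show "integrable M (\<lambda>\<omega>. f k (embE ((1 / u) *\<^sub>R Z0 \<omega>)))"
        by (rule integrable_const_bound[of _ 1]) (auto simp: f f1)
    qed (rule f(3))
    also have "\<dots> = \<P>(\<omega> in M. embE ((1 / u) *\<^sub>R Z0 \<omega>) \<in> U)"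
      by (simp add: expectation_of_bool[symmetric] indicator_def)
    finally show ?case .
  qed
qed

text \<open>The closure differs from the image only by points at infinity, which are null. Through
  this, bounds on the compactification become bounds for closed subsets of Euclidean space.\<close>

lemma nu_closure_embE_image:
  assumes "closed F"
  shows "emeasure \<nu> (closure (embE ` F)) = emeasure \<nu> (embE ` F)"
proof -
  have "emeasure \<nu> (closure (embE ` F)) = emeasure \<nu> (closure (embE ` F) \<inter> finite_part)"
  proof -
    have "- finite_part \<in> null_sets \<nu>"
      using nu_infinite_part by (auto simp: null_sets_def sets_nu)
    hence "emeasure \<nu> (closure (embE ` F)) = emeasure \<nu> (closure (embE ` F) - (- finite_part))"
      by (subst emeasure_Diff_null_set) (auto simp: sets_nu)
    thus ?thesis by (simp add: Diff_eq)
  qed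
  thus ?thesis using closure_embE_image[OF assms] by simp
qed

lemma nu_embE_finite:
  assumes "closed F" "0 \<notin> F" "G \<subseteq> F"
  shows "emeasure \<nu> (embE ` G) < \<infinity>"
proof -
  have "emeasure \<nu> (embE ` G) \<le> emeasure \<nu> (closure (embE ` F))"
    using assms(3) closure_subset[of "embE ` F"] by (intro emeasure_mono) (auto simp: sets_nu)
  also have "\<dots> < \<infinity>"
    using assms(1,2) zero_notin_closure_embE_image[of F] by (intro nu_finite) auto
  finally show ?thesis .
qed

lemma tm_mono:
  assumes "closed F" "0 \<notin> F" "G \<subseteq> H" "H \<subseteq> F" "H \<in> sets borel"
  shows "tm G \<le> tm H"
proof -
  have "emeasure \<nu> (embE ` G) \<le> emeasure \<nu> (embE ` H)"
    using assms by (intro emeasure_mono) (auto simp: sets_nu)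
  thus ?thesis unfolding tm_def measure_def
    using nu_embE_finite[OF assms(1,2,4)] by (intro enn2real_mono) auto
qed

lemma tm_scale:
  assumes "G \<in> sets borel" "0 < c"
  shows "tm ((*\<^sub>R) c ` G) = c powr (- \<alpha>) * tm G"
proof -
  have "embE ` (*\<^sub>R) c ` G = scaleE c ` (embE ` G)"
    by (auto simp: scaleE_embE image_iff)
  thus ?thesis using nu_scale[of "embE ` G" c] assms
    by (simp add: tm_def measure_def enn2real_mult sets_embE_image)
qed

lemma tm_limsup:
  assumes "closed F" "0 \<notin> F" "0 < \<theta>"
  shows "\<forall>\<^sub>F u in at_top. \<P>(\<omega> in M. (1 / u) *\<^sub>R Z0 \<omega> \<in> F) \<le> (tm F + \<theta>) * tail u"
proof -
  have "\<forall>\<^sub>F u in at_top. \<P>(\<omega> in M. embE ((1 / u) *\<^sub>R Z0 \<omega>) \<in> closure (embE ` F))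
      \<le> (measure \<nu> (closure (embE ` F)) + \<theta>) * tail u"
    using assms zero_notin_closure_embE_image[of F] by (intro limsup_closed) auto
  moreover have "measure \<nu> (closure (embE ` F)) = tm F"
    by (simp add: tm_def measure_def nu_closure_embE_image[OF assms(1)])
  moreover have "embE x \<in> closure (embE ` F) \<longleftrightarrow> x \<in> F" for x
  proof -
    have "embE x \<in> closure (embE ` F) \<longleftrightarrow> embE x \<in> closure (embE ` F) \<inter> finite_part"
      by (simp add: embE_in_finite_part)
    thus ?thesis unfolding closure_embE_image[OF assms(1)] by simp
  qed
  ultimately show ?thesis by simp
qed

lemma tm_liminf:
  assumes "open U" "0 \<notin> closure U" "0 < \<theta>"
  shows "\<forall>\<^sub>F u in at_top. (tm U - \<theta>) * tail u \<le> \<P>(\<omega> in M. (1 / u) *\<^sub>R Z0 \<omega> \<in> U)"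
  using liminf_open[OF open_embE_image[OF assms(1)] zero_notin_closure_embE_image[OF assms(2)] assms(3)]
  by (simp add: tm_def)

lemma tm_frontier:
  assumes "emeasure \<nu> (frontier (embE ` G)) = 0"
  shows "tm (frontier G) = 0"
proof -
  have "emeasure \<nu> (embE ` frontier G) \<le> emeasure \<nu> (frontier (embE ` G))"
    by (intro emeasure_mono embE_frontier_subset) (auto simp: sets_nu)
  thus ?thesis using assms by (simp add: tm_def measure_def)
qed

lemma tm_Un_null:
  assumes "closed F" "0 \<notin> F" "G \<in> sets borel" "N \<in> sets borel" "G \<subseteq> F" "N \<subseteq> F" "tm N = 0"
  shows "tm (G \<union> N) = tm G"
proof (rule antisym)
  have "tm (G \<union> N) \<le> tm G + tm N"
    unfolding tm_def image_Un using assms by (intro measure_Un_le) (auto simp: sets_nu sets_embE_image)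
  thus "tm (G \<union> N) \<le> tm G" using assms by simp
  show "tm G \<le> tm (G \<union> N)" using assms by (intro tm_mono[OF assms(1,2)]) auto
qed

text \<open>\<open>G\<close> is squeezed between its interior and its closure, which have the same
  mass because the frontier is null; the two portmanteau bounds then meet.\<close>

lemma tm_limit:
  assumes G: "G \<in> sets borel" "0 \<notin> closure G" "tm (frontier G) = 0"
  shows "((\<lambda>u. \<P>(\<omega> in M. (1 / u) *\<^sub>R Z0 \<omega> \<in> G) / tail u) \<longlongrightarrow> tm G) at_top"
proof -
  have cl: "tm (closure G) = tm G"
  proof -
    have "closure G = G \<union> frontier G" by (rule closure_Un_frontier)
    thus ?thesis using tm_Un_null[of "closure G" G "frontier G"] G closure_subset[of G]
      by (auto simp: frontier_def)
  qed
  have int: "tm (interior G) = tm G"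
  proof -
    have "tm (interior G \<union> frontier G) = tm (interior G)"
      using G closure_subset[of G] interior_subset[of G] by (intro tm_Un_null[of "closure G"]) (auto simp: frontier_def)
    moreover have "interior G \<union> frontier G = closure G"
      using closure_subset[of G] interior_subset[of G] by (auto simp: frontier_def)
    ultimately show ?thesis using cl by simp
  qed
  have [measurable]: "G \<in> sets borel" by fact
  have mono: "\<P>(\<omega> in M. (1 / u) *\<^sub>R Z0 \<omega> \<in> A) \<le> \<P>(\<omega> in M. (1 / u) *\<^sub>R Z0 \<omega> \<in> B)"
    if "A \<subseteq> B" and [measurable]: "B \<in> sets borel" for A B u
    using that(1) by (intro finite_measure_mono) auto
  show ?thesis
  proof (rule tendstoI)
    fix e :: real assume e: "0 < e"
    have "\<forall>\<^sub>F u in at_top. \<P>(\<omega> in M. (1 / u) *\<^sub>R Z0 \<omega> \<in> closure G) \<le> (tm G + e/2) * tail u"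
      using tm_limsup[of "closure G" "e/2"] G e cl by simp
    moreover have "\<forall>\<^sub>F u in at_top. (tm G - e/2) * tail u \<le> \<P>(\<omega> in M. (1 / u) *\<^sub>R Z0 \<omega> \<in> interior G)"
    proof -
      have "0 \<notin> closure (interior G)" using G(2) closure_mono[OF interior_subset[of G]] by auto
      thus ?thesis using tm_liminf[of "interior G" "e/2"] e int by simp
    qed
    ultimately show "\<forall>\<^sub>F u in at_top. dist (\<P>(\<omega> in M. (1 / u) *\<^sub>R Z0 \<omega> \<in> G) / tail u) (tm G) < e"
      using tail_pos
    proof eventually_elim
      case (elim u)
      have "\<P>(\<omega> in M. (1 / u) *\<^sub>R Z0 \<omega> \<in> G) \<le> (tm G + e/2) * tail u"
        using elim(1) mono[of G "closure G" u] closure_subset[of G] by force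
      moreover have "(tm G - e/2) * tail u \<le> \<P>(\<omega> in M. (1 / u) *\<^sub>R Z0 \<omega> \<in> G)"
        using elim(2) mono[of "interior G" G u] interior_subset[of G] by force
      ultimately have "\<P>(\<omega> in M. (1 / u) *\<^sub>R Z0 \<omega> \<in> G) / tail u \<le> tm G + e/2"
        "tm G - e/2 \<le> \<P>(\<omega> in M. (1 / u) *\<^sub>R Z0 \<omega> \<in> G) / tail u"
        using elim(3) by (simp_all add: field_simps)
      thus ?case using e by (simp add: dist_real_def abs_real_def)
    qed
  qed
qed

text \<open>Continuity from above, legitimate because the largest set avoids the origin and so has
  finite mass. It is used for neighbourhoods shrinking to a null boundary.\<close>

lemma tm_decseq:
  assumes "\<And>k::nat. closed (F k)" "0 \<notin> F 0" "decseq F"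
  shows "(\<lambda>k. tm (F k)) \<longlonglongrightarrow> tm (\<Inter>k. F k)"
proof -
  have "(\<lambda>k. measure \<nu> (embE ` F k)) \<longlonglongrightarrow> measure \<nu> (\<Inter>k. embE ` F k)"
  proof (rule Lim_measure_decseq)
    show "range (\<lambda>k. embE ` F k) \<subseteq> sets \<nu>" using assms(1) by (auto simp: sets_nu)
    show "decseq (\<lambda>k. embE ` F k)" using assms(3) by (auto simp: decseq_def image_mono)
    show "emeasure \<nu> (embE ` F i) \<noteq> \<infinity>" for i
      using nu_embE_finite[of "F 0" "F i"] assms by (auto simp: decseq_def top.not_eq_extremum)
  qed
  moreover have "(\<Inter>k. embE ` F k) = embE ` (\<Inter>k. F k)"
    by (rule image_INT[symmetric, of _ UNIV]) (use inj_embE in auto)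
  ultimately show ?thesis by (simp add: tm_def)
qed

section \<open>Mass outside balls\<close>

definition far :: "real \<Rightarrow> (real^'d) set" where "far t = {x. t \<le> norm x}"
definition ofar :: "real \<Rightarrow> (real^'d) set" where "ofar t = {x. t < norm x}"

lemma closed_far: "closed (far t)"
  unfolding far_def by (intro closed_Collect_le continuous_intros)

lemma open_ofar: "open (ofar t)"
  unfolding ofar_def by (intro open_Collect_less continuous_intros)

lemma ofar_subset_far: "ofar t \<subseteq> far t" "t < s \<Longrightarrow> far s \<subseteq> ofar t"
  by (auto simp: far_def ofar_def)

lemma zero_notin_far: "0 < t \<Longrightarrow> 0 \<notin> far t" by (simp add: far_def)

lemma zero_notin_closure_ofar: "0 < t \<Longrightarrow> 0 \<notin> closure (ofar t)"
  using closure_minimal[OF ofar_subset_far(1) closed_far] zero_notin_far by auto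

lemma tm_far_scale: "0 < t \<Longrightarrow> tm (far t) = t powr (- \<alpha>) * tm (far 1)"
proof -
  assume t: "0 < t"
  have "(*\<^sub>R) t ` far 1 = (far t :: (real^'d) set)"
  proof (intro equalityI subsetI)
    fix x :: "real^'d" assume "x \<in> far t"
    hence "(1/t) *\<^sub>R x \<in> far 1" "x = t *\<^sub>R ((1/t) *\<^sub>R x)" using t by (auto simp: far_def)
    thus "x \<in> (*\<^sub>R) t ` far 1" by blast
  qed (use t in \<open>auto simp: far_def\<close>)
  thus ?thesis using tm_scale[of "far 1" t] t closed_far by auto
qed

lemma tm_ofar_scale: "0 < t \<Longrightarrow> tm (ofar t) = t powr (- \<alpha>) * tm (ofar 1)"
proof -
  assume t: "0 < t"
  have "(*\<^sub>R) t ` ofar 1 = (ofar t :: (real^'d) set)"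
  proof (intro equalityI subsetI)
    fix x :: "real^'d" assume "x \<in> ofar t"
    hence "(1/t) *\<^sub>R x \<in> ofar 1" "x = t *\<^sub>R ((1/t) *\<^sub>R x)" using t by (auto simp: ofar_def field_simps)
    thus "x \<in> (*\<^sub>R) t ` ofar 1" by blast
  qed (use t in \<open>auto simp: ofar_def\<close>)
  thus ?thesis using tm_scale[of "ofar 1" t] t open_ofar by auto
qed

lemma prob_ofar: "0 < u \<Longrightarrow> \<P>(\<omega> in M. (1 / u) *\<^sub>R Z0 \<omega> \<in> ofar t) = tail (t * u)"
  unfolding tail_def ofar_def by (intro arg_cong[where f=prob]) (auto simp: field_simps)

lemma tail_le_prob_far: "0 < u \<Longrightarrow> tail (t * u) \<le> \<P>(\<omega> in M. (1 / u) *\<^sub>R Z0 \<omega> \<in> far t)"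
proof -
  have [measurable]: "far t \<in> sets borel" using closed_far by auto
  assume u: "0 < u"
  have "tail (t * u) = \<P>(\<omega> in M. (1 / u) *\<^sub>R Z0 \<omega> \<in> ofar t)" using prob_ofar[OF u] by simp
  also have "\<dots> \<le> \<P>(\<omega> in M. (1 / u) *\<^sub>R Z0 \<omega> \<in> far t)"
    using ofar_subset_far(1)[of t] by (intro finite_measure_mono) auto
  finally show ?thesis .
qed

text \<open>At t = 1 the probability in question is exactly the normalisation \<open>tail u\<close>,
  so the limiting ratio is 1. The open set gives one inequality, and the closed set gives the
  opposite one in the next lemma.\<close>

lemma tm_ofar_1_le: "tm (ofar 1) \<le> 1"
proof (rule field_le_epsilon)
  fix e :: real assume e: "0 < e"
  have "\<forall>\<^sub>F u in at_top. (tm (ofar 1) - e) * tail u \<le> \<P>(\<omega> in M. (1 / u) *\<^sub>R Z0 \<omega> \<in> ofar 1)"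
    using e zero_notin_closure_ofar open_ofar by (intro tm_liminf) auto
  hence "\<forall>\<^sub>F u::real in at_top. tm (ofar 1) \<le> 1 + e"
    using tail_pos eventually_gt_at_top[of 0]
  proof eventually_elim
    case (elim u)
    hence "(tm (ofar 1) - e) * tail u \<le> 1 * tail u" using prob_ofar[of u 1] by simp
    thus ?case using elim by (simp only: mult_le_cancel_right_pos)
  qed
  thus "tm (ofar 1) \<le> 1 + e" by simp
qed

lemma tm_far_1_ge: "1 \<le> tm (far 1)"
proof (rule field_le_epsilon)
  fix e :: real assume e: "0 < e"
  have "\<forall>\<^sub>F u in at_top. \<P>(\<omega> in M. (1 / u) *\<^sub>R Z0 \<omega> \<in> far 1) \<le> (tm (far 1) + e) * tail u"
    using e zero_notin_far closed_far by (intro tm_limsup) auto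
  hence "\<forall>\<^sub>F u::real in at_top. 1 \<le> tm (far 1) + e"
    using tail_pos eventually_gt_at_top[of 0]
  proof eventually_elim
    case (elim u)
    hence "1 * tail u \<le> (tm (far 1) + e) * tail u" using tail_le_prob_far[of u 1, simplified mult_1] by linarith
    thus ?case using elim(2) mult_right_le_imp_le[of 1 "tail u" "tm (far 1) + e"] by blast
  qed
  thus "1 \<le> tm (far 1) + e" by simp
qed

text \<open>The unit sphere carries no mass. Otherwise the outside of a slightly smaller ball, whose
  mass is controlled by homogeneity and the bound for the open set, would be lighter than the set
  \<open>far 1\<close> that it contains.\<close>

lemma tm_far_1_le: "tm (far 1) \<le> 1"
proof (rule ccontr)
  assume "\<not> ?thesis"
  hence gt: "1 < tm (far 1)" by simp
  \<comment> \<open>Chosen so that \<open>s powr (- \<alpha>)\<close> is the square root of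
    \<open>tm (far 1)\<close>, which is strictly smaller than \<open>tm (far 1)\<close> when the
    latter exceeds 1.\<close>
  define s where "s = tm (far 1) powr (- 1 / (2 * \<alpha>))"
  have s: "0 < s" "s < 1"
    using gt alpha powr_less_mono[of "- 1 / (2 * \<alpha>)" 0 "tm (far 1)"] by (auto simp: s_def)
  have "tm (far 1) \<le> tm (ofar s)"
    using s zero_notin_far closed_far ofar_subset_far open_ofar by (intro tm_mono[of "far s"]) auto
  also have "\<dots> \<le> s powr (- \<alpha>)" using tm_ofar_1_le tm_ofar_scale[OF s(1)] by (simp add: mult_left_le)
  also have "\<dots> = tm (far 1) powr (1/2)" using alpha by (simp add: s_def powr_powr)
  also have "\<dots> < tm (far 1) powr 1" using gt by (intro powr_less_mono) auto
  finally show False using gt by simp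
qed

lemma tm_far: "0 < t \<Longrightarrow> tm (far t) = t powr (- \<alpha>)"
  using tm_far_scale tm_far_1_le tm_far_1_ge by (metis antisym mult.right_neutral)

lemma tm_ofar_ge: "0 < t \<Longrightarrow> (2 * t) powr (- \<alpha>) \<le> tm (ofar t)"
  using tm_far[of "2 * t"] tm_mono[of "far t" "far (2*t)" "ofar t"] zero_notin_far[of t] closed_far[of t]
    ofar_subset_far(1)[of t] ofar_subset_far(2)[of t "2*t"] borel_open[OF open_ofar] by simp

section \<open>Growth and decay of the tail function\<close>

lemma tail_mult_le:
  assumes "0 < t" "t powr (- \<alpha>) < c"
  shows "\<forall>\<^sub>F u in at_top. tail (t * u) \<le> c * tail u"
proof -
  have "\<forall>\<^sub>F u in at_top. \<P>(\<omega> in M. (1 / u) *\<^sub>R Z0 \<omega> \<in> far t)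
      \<le> (tm (far t) + (c - t powr (- \<alpha>))) * tail u"
    using assms zero_notin_far closed_far by (intro tm_limsup) auto
  thus ?thesis using eventually_gt_at_top[of 0]
  proof eventually_elim
    case (elim u)
    thus ?case using tail_le_prob_far[of u t] tm_far[OF assms(1)] by simp
  qed
qed

text \<open>A crude exponent suffices: the mass of \<open>ofar 2\<close> is at least
  \<open>4 powr (- \<alpha>)\<close>, half of it is given up to reach a bound valid for large u, and
  half of this value equals \<open>2 powr (- (2 * \<alpha> + 1))\<close>.\<close>

lemma tail_mult_ge:
  "\<exists>c>0. \<forall>\<^sub>F u in at_top. 2 powr (- c) * tail u \<le> tail (2 * u)"
proof (intro exI conjI)
  show "0 < 2 * \<alpha> + 1" using alpha by simp
  define m where "m = 4 powr (- \<alpha>)"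
  have m: "m \<le> tm (ofar 2)" "0 < m" using tm_ofar_ge[of 2] by (auto simp: m_def)
  have "\<forall>\<^sub>F u in at_top. (tm (ofar 2) - m / 2) * tail u \<le> \<P>(\<omega> in M. (1 / u) *\<^sub>R Z0 \<omega> \<in> ofar 2)"
    using m zero_notin_closure_ofar open_ofar by (intro tm_liminf) auto
  thus "\<forall>\<^sub>F u in at_top. 2 powr (- (2 * \<alpha> + 1)) * tail u \<le> tail (2 * u)"
    using eventually_gt_at_top[of 0]
  proof eventually_elim
    case (elim u)
    have "2 powr (- (2 * \<alpha> + 1)) = m / 2"
    proof -
      have "(2::real) powr (- (2 * \<alpha> + 1)) = 2 powr (2 * - \<alpha> + - 1)" by (intro arg_cong[where f="(powr) 2"]) simp
      also have "\<dots> = 2 powr (2 * - \<alpha>) * 2 powr (- 1)" by (rule powr_add)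
      also have "(2::real) powr (2 * - \<alpha>) = m" unfolding m_def by (subst powr_powr[symmetric]) simp
      finally show ?thesis by (simp add: powr_minus)
    qed
    also have "\<dots> \<le> tm (ofar 2) - m / 2" using m by simp
    finally have "2 powr (- (2 * \<alpha> + 1)) * tail u \<le> (tm (ofar 2) - m / 2) * tail u"
      by (intro mult_right_mono tail_nonneg)
    thus ?case using elim prob_ofar[of u 2] by simp
  qed
qed

text \<open>Any exponents with \<open>1 < \<beta> < \<alpha>\<close> and \<open>0 < \<kappa> < min 1 (\<beta> - 1)\<close> would do below.\<close>

definition \<beta> :: real where "\<beta> = (1 + \<alpha>) / 2"

lemma beta: "1 < \<beta>" "\<beta> < \<alpha>" using alpha by (auto simp: \<beta>_def)

lemma tail_potter:
  obtains u0 where "0 < u0" "\<And>u t. u0 \<le> u \<Longrightarrow> 1 \<le> t \<Longrightarrow> tail (t * u) \<le> 2 powr \<beta> * t powr (- \<beta>) * tail u"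
proof -
  have "\<forall>\<^sub>F u in at_top. tail (2 * u) \<le> 2 powr (- \<beta>) * tail u"
    using beta by (intro tail_mult_le powr_less_mono) auto
  then obtain u1 where u1: "\<And>u. u1 \<le> u \<Longrightarrow> tail (2 * u) \<le> 2 powr (- \<beta>) * tail u"
    by (auto simp: eventually_at_top_linorder)
  show ?thesis
  proof (rule that[of "max 1 u1"])
    fix u t :: real assume ut: "max 1 u1 \<le> u" "1 \<le> t"
    have "tail (t * u) \<le> 2 powr \<beta> * t powr (- \<beta>) * tail u"
    proof (rule doubling_upper)
      show "max 1 u1 \<le> u" by fact
    qed (use ut u1 beta in \<open>auto simp: tail_nonneg tail_antimono\<close>)
    thus "tail (t * u) \<le> 2 powr \<beta> * t powr (- \<beta>) * tail u" .
  qed simp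
qed

text \<open>Needed to recognise a power of n from the Chernoff bound as negligible against
  \<open>tail n\<close>; the size of \<gamma> is irrelevant because the Chernoff exponent is at our
  disposal.\<close>

lemma tail_polynomial_lower:
  obtains c \<gamma> where "0 < c" "0 < \<gamma>" "\<forall>\<^sub>F u in at_top. c * u powr (- \<gamma>) \<le> tail u"
proof -
  obtain \<gamma> where g: "0 < \<gamma>" "\<forall>\<^sub>F u in at_top. 2 powr (- \<gamma>) * tail u \<le> tail (2 * u)"
    using tail_mult_ge by blast
  have "\<forall>\<^sub>F u in at_top. 2 powr (- \<gamma>) * tail u \<le> tail (2 * u) \<and> 0 < tail u \<and> 1 \<le> u"
    using g(2) tail_pos eventually_ge_at_top[of 1] by eventually_elim auto
  then obtain u0 where u0: "\<And>u. u0 \<le> u \<Longrightarrow> 2 powr (- \<gamma>) * tail u \<le> tail (2 * u) \<and> 0 < tail u \<and> 1 \<le> u"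
    by (auto simp: eventually_at_top_linorder)
  have pos: "0 < u0" "0 < tail u0" using u0[of u0] by auto
  define c where "c = 2 powr (- \<gamma>) * u0 powr \<gamma> * tail u0"
  show ?thesis
  proof (rule that[of c \<gamma>])
    show "\<forall>\<^sub>F u in at_top. c * u powr (- \<gamma>) \<le> tail u"
      using eventually_ge_at_top[of u0]
    proof eventually_elim
      case (elim u)
      have "2 powr (- \<gamma>) * (u / u0) powr (- \<gamma>) * tail u0 \<le> tail ((u / u0) * u0)"
        using u0 g(1) pos elim by (intro doubling_lower[where g=tail] tail_antimono tail_nonneg) auto
      thus ?case using pos elim by (simp add: c_def powr_divide powr_minus field_simps)
    qed
  qed (use g pos in \<open>auto simp: c_def\<close>)
qed

text \<open>For t \<ge> 1 Potter's bound decays with exponent \<beta> > 1, hence at least like 1 /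
  t. On the remaining range monotonicity reduces to the single ratio at t = v.\<close>

lemma tail_uniform:
  assumes "0 < v"
  obtains K where "0 < K" "\<forall>\<^sub>F u in at_top. \<forall>t\<ge>v. tail (t * u) \<le> K / t * tail u"
proof -
  obtain u0 where u0: "0 < u0" "\<And>u t. u0 \<le> u \<Longrightarrow> 1 \<le> t \<Longrightarrow> tail (t * u) \<le> 2 powr \<beta> * t powr (- \<beta>) * tail u"
    using tail_potter by blast
  define c where "c = v powr (- \<alpha>) + 1"
  define K where "K = max c (2 powr \<beta>)"
  have K: "0 < K" "c \<le> K" "2 powr \<beta> \<le> K" by (auto simp: K_def c_def intro: add_nonneg_pos less_max_iff_disj[THEN iffD2])
  have "\<forall>\<^sub>F u in at_top. tail (v * u) \<le> c * tail u"
    using assms by (intro tail_mult_le) (auto simp: c_def)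
  hence "\<forall>\<^sub>F u in at_top. \<forall>t\<ge>v. tail (t * u) \<le> K / t * tail u"
    using eventually_ge_at_top[of u0]
  proof eventually_elim
    case (elim u)
    show ?case
    proof (intro allI impI)
      fix t assume t: "v \<le> t"
      show "tail (t * u) \<le> K / t * tail u"
      proof (cases "1 \<le> t")
        case True
        have "tail (t * u) \<le> 2 powr \<beta> * t powr (- \<beta>) * tail u" using u0 elim True by auto
        also have "\<dots> \<le> K * t powr (- 1) * tail u"
          using K True beta by (intro mult_right_mono mult_mono powr_mono tail_nonneg) auto
        finally show ?thesis using True by (simp add: powr_minus divide_inverse)
      next
        case False
        have "tail (t * u) \<le> tail (v * u)" using t elim u0(1) by (intro tail_antimono mult_right_mono) auto
        also have "\<dots> \<le> c * tail u" using elim by simp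
        also have "\<dots> \<le> K / t * tail u"
        proof (intro mult_right_mono tail_nonneg)
          have "c \<le> K" using K by simp
          also have "K \<le> K / t" using False t assms K(1) by (simp add: le_divide_eq mult_left_le)
          finally show "c \<le> K / t" .
        qed
        finally show ?thesis .
      qed
    qed
  qed
  thus ?thesis using that K by blast
qed

text \<open>The bound is linear in the weight c with a constant valid for all weights up to a.
  Summing over infinitely many indices then requires only that the weights be summable.\<close>

lemma tail_weighted:
  assumes "0 < a" "0 < v"
  obtains K where "0 < K" "\<forall>\<^sub>F u in at_top. \<forall>c. 0 \<le> c \<and> c \<le> a \<longrightarrow>
     \<P>(\<omega> in M. v * u < c * norm (Z0 \<omega>)) \<le> K * c * tail u"
proof -
  obtain K where K: "0 < K" "\<forall>\<^sub>F u in at_top. \<forall>t\<ge>v/a. tail (t * u) \<le> K / t * tail u"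
    using tail_uniform[of "v/a"] assms by auto
  have "\<forall>\<^sub>F u in at_top. \<forall>c. 0 \<le> c \<and> c \<le> a \<longrightarrow>
     \<P>(\<omega> in M. v * u < c * norm (Z0 \<omega>)) \<le> (K / v) * c * tail u"
    using K(2) eventually_gt_at_top[of 0]
  proof eventually_elim
    case (elim u)
    show ?case
    proof (intro allI impI)
      fix c assume c: "0 \<le> c \<and> c \<le> a"
      show "\<P>(\<omega> in M. v * u < c * norm (Z0 \<omega>)) \<le> (K / v) * c * tail u"
      proof (cases "c = 0")
        case True
        \<comment> \<open>A zero weight makes the event empty, and the quotient \<open>v / c\<close>
          used in the other case would be meaningless.\<close>
        have "\<not> v * u < 0" using assms elim by (simp add: not_less)
        thus ?thesis using True by simp
      next
        case False
        hence c: "0 < c" "c \<le> a" using c by auto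
        have "{\<omega>\<in>space M. v * u < c * norm (Z0 \<omega>)} = {\<omega>\<in>space M. (v / c) * u < norm (Z0 \<omega>)}"
          using c by (auto simp: field_simps)
        hence "\<P>(\<omega> in M. v * u < c * norm (Z0 \<omega>)) = tail ((v / c) * u)" by (simp add: tail_def)
        also have "\<dots> \<le> K / (v / c) * tail u"
        proof -
          have "v / a \<le> v / c" using c assms by (intro divide_left_mono) auto
          thus ?thesis using elim by blast
        qed
        finally show ?thesis by simp
      qed
    qed
  qed
  thus ?thesis using that[of "K / v"] K(1) assms by auto
qed

lemma tail_polynomial_upper:
  obtains C u0 where "0 < C" "0 < u0" "\<And>u. u0 \<le> u \<Longrightarrow> tail u \<le> C * u powr (- \<beta>)"
proof -
  obtain u0 where u0: "0 < u0" "\<And>u t. u0 \<le> u \<Longrightarrow> 1 \<le> t \<Longrightarrow> tail (t * u) \<le> 2 powr \<beta> * t powr (- \<beta>) * tail u"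
    using tail_potter by blast
  have "tail u \<le> (2 powr \<beta> * u0 powr \<beta>) * u powr (- \<beta>)" if "u0 \<le> u" for u
  proof -
    have "tail u = tail ((u / u0) * u0)" using u0 by simp
    also have "\<dots> \<le> 2 powr \<beta> * (u / u0) powr (- \<beta>) * tail u0" using u0 that by (intro u0(2)) auto
    also have "\<dots> \<le> 2 powr \<beta> * (u / u0) powr (- \<beta>) * 1" by (intro mult_left_mono) (auto simp: tail_def)
    also have "\<dots> = (2 powr \<beta> * u0 powr \<beta>) * u powr (- \<beta>)"
      using u0 that by (simp add: powr_divide powr_minus field_simps)
    finally show ?thesis .
  qed
  thus ?thesis using that u0(1) by (metis mult_pos_pos powr_gt_zero zero_less_numeral less_numeral_extra(3))
qed

text \<open>Here \<alpha> > 1 enters through \<beta> > 1. The expected number of big jumps tends to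
  0, so its square, which governs pairs of big jumps, is negligible against it.\<close>

lemma mult_tail_tendsto_0: "((\<lambda>u. u * tail u) \<longlongrightarrow> 0) at_top"
proof -
  obtain C u0 where C: "0 < C" "0 < u0" "\<And>u. u0 \<le> u \<Longrightarrow> tail u \<le> C * u powr (- \<beta>)"
    using tail_polynomial_upper by blast
  have "((\<lambda>u. C * u powr (1 - \<beta>)) \<longlongrightarrow> C * 0) at_top"
    using beta by (intro tendsto_mult tendsto_const tendsto_neg_powr filterlim_ident) auto
  hence lim: "((\<lambda>u. C * u powr (1 - \<beta>)) \<longlongrightarrow> 0) at_top" by simp
  show ?thesis
  proof (rule tendsto_sandwich[OF _ _ tendsto_const lim])
    show "\<forall>\<^sub>F u in at_top. 0 \<le> u * tail u"
      using eventually_ge_at_top[of 0] by eventually_elim (simp add: tail_nonneg)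
    show "\<forall>\<^sub>F u in at_top. u * tail u \<le> C * u powr (1 - \<beta>)"
      using eventually_ge_at_top[of u0]
    proof eventually_elim
      case (elim u)
      have "u * tail u \<le> u * (C * u powr (- \<beta>))" using C elim by (intro mult_left_mono) auto
      also have "\<dots> = C * u powr (1 - \<beta>)" using C elim by (simp add: powr_diff powr_minus field_simps)
      finally show ?case .
    qed
  qed
qed

definition \<kappa> :: real where "\<kappa> = min (1/2) ((\<beta> - 1) / 2)"

lemma kappa: "0 < \<kappa>" "\<kappa> < 1" "1 + \<kappa> < \<beta>"
  using beta by (auto simp: \<kappa>_def min_def field_simps)

text \<open>Decompose into dyadic shells of radii \<open>2 ^ k * u0\<close>: the shell contributes
  at most its outer radius to the power q times the tail at its inner radius, and q < \<beta> makes
  these contributions geometric.\<close>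

lemma integrable_moment: "integrable M (\<lambda>\<omega>. norm (Z0 \<omega>) powr (1 + \<kappa>))"
proof -
  obtain C u0 where C: "0 < C" "0 < u0" "\<And>u. u0 \<le> u \<Longrightarrow> tail u \<le> C * u powr (- \<beta>)"
    using tail_polynomial_upper by blast
  define q where "q = 1 + \<kappa>"
  have q: "0 < q" "q < \<beta>" using kappa by (auto simp: q_def)
  define g where "g k = (2 ^ Suc k * u0) powr q" for k :: nat
  have term_le: "f k \<le> suminf f" for f :: "nat \<Rightarrow> ennreal" and k
    using sum_le_suminf[of f "{k}"] by simp
  have pt: "ennreal (norm z powr q) \<le> ennreal (u0 powr q) + (\<Sum>k. ennreal (g k) * indicator {z. 2 ^ k * u0 < norm z} z)"
    for z :: "real^'d"
  proof (cases "norm z \<le> u0")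
    case True
    hence "norm z powr q \<le> u0 powr q" using q by (intro powr_mono2) auto
    thus ?thesis by (intro add_increasing2 ennreal_leI) auto
  next
    case False
    obtain k :: nat where k: "2 ^ k \<le> norm z / u0" "norm z / u0 < 2 ^ Suc k"
      using obtain_dyadic[of "norm z / u0"] False C by (auto simp: field_simps)
    show ?thesis
    proof (cases "2 ^ k * u0 < norm z")
      case True
      have "norm z powr q \<le> g k"
        unfolding g_def using k C q by (intro powr_mono2) (auto simp: field_simps)
      hence "ennreal (norm z powr q) \<le> ennreal (g k) * indicator {z. 2 ^ k * u0 < norm z} z"
        using True by (simp add: ennreal_leI)
      also have "\<dots> \<le> (\<Sum>k. ennreal (g k) * indicator {z. 2 ^ k * u0 < norm z} z)"
        by (rule term_le)
      finally show ?thesis by (rule add_increasing[OF zero_le])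
    next
      \<comment> \<open>On a shell boundary the strict indicator of shell k is 0, so the preceding
        shell is used; it exists because the norm exceeds \<open>u0\<close>, which excludes k =
        0.\<close>
      case nlt: False
      hence eq: "norm z = 2 ^ k * u0" using k C by (simp add: field_simps)
      then obtain j where j: "k = Suc j" using False by (cases k) auto
      have "norm z powr q \<le> g j" unfolding g_def eq j by simp
      hence "ennreal (norm z powr q) \<le> ennreal (g j) * indicator {z. 2 ^ j * u0 < norm z} z"
        using C by (simp add: ennreal_leI eq j)
      also have "\<dots> \<le> (\<Sum>k. ennreal (g k) * indicator {z. 2 ^ k * u0 < norm z} z)"
        by (rule term_le)
      finally show ?thesis by (rule add_increasing[OF zero_le])
    qed
  qed
  define r where "r = 2 powr (q - \<beta>)"
  have r: "0 < r" "r < 1" using q powr_less_mono[of "q - \<beta>" 0 2] by (auto simp: r_def)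
  define D where "D = 2 powr q * u0 powr (q - \<beta>) * C"
  have gt: "g k * tail (2 ^ k * u0) \<le> D * r ^ k" for k
  proof -
    have "u0 \<le> 2 ^ k * u0" using C(2) by (simp add: one_le_power)
    hence "g k * tail (2 ^ k * u0) \<le> g k * (C * (2 ^ k * u0) powr (- \<beta>))"
      by (intro mult_left_mono C(3)) (auto simp: g_def)
    also have "\<dots> = D * r ^ k"
    proof -
      have "g k = 2 powr q * (2 ^ k) powr q * u0 powr q" using C(2) by (simp add: g_def powr_mult mult.assoc)
      moreover have "(2 ^ k * u0) powr (- \<beta>) = (2 ^ k) powr (- \<beta>) * u0 powr (- \<beta>)" using C(2) by (simp add: powr_mult)
      moreover have "r ^ k = (2 ^ k) powr q * (2 ^ k) powr (- \<beta>)"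
        by (simp add: r_def powr_realpow[symmetric] powr_powr algebra_simps flip: powr_add)
      moreover have "u0 powr (q - \<beta>) = u0 powr q * u0 powr (- \<beta>)"
        by (simp flip: powr_add)
      ultimately show ?thesis by (simp add: D_def mult_ac)
    qed
    finally show ?thesis .
  qed
  have "(\<integral>\<^sup>+\<omega>. ennreal (norm (Z0 \<omega>) powr q) \<partial>M)
      \<le> (\<integral>\<^sup>+\<omega>. ennreal (u0 powr q) + (\<Sum>k. ennreal (g k) * indicator {\<omega>\<in>space M. 2 ^ k * u0 < norm (Z0 \<omega>)} \<omega>) \<partial>M)"
  proof (rule nn_integral_mono)
    fix \<omega> assume "\<omega> \<in> space M"
    thus "ennreal (norm (Z0 \<omega>) powr q)
      \<le> ennreal (u0 powr q) + (\<Sum>k. ennreal (g k) * indicator {\<omega>\<in>space M. 2 ^ k * u0 < norm (Z0 \<omega>)} \<omega>)"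
      using pt[of "Z0 \<omega>"] by (simp add: indicator_def)
  qed
  also have "\<dots> = ennreal (u0 powr q) + (\<Sum>k. ennreal (g k) * emeasure M {\<omega>\<in>space M. 2 ^ k * u0 < norm (Z0 \<omega>)})"
    by (simp add: nn_integral_add nn_integral_suminf nn_integral_cmult_indicator emeasure_space_1)
  also have "\<dots> \<le> ennreal (u0 powr q) + (\<Sum>k. ennreal (D * r ^ k))"
  proof (intro add_left_mono suminf_le)
    show "ennreal (g k) * emeasure M {\<omega>\<in>space M. 2 ^ k * u0 < norm (Z0 \<omega>)} \<le> ennreal (D * r ^ k)" for k
    proof -
      have "emeasure M {\<omega>\<in>space M. 2 ^ k * u0 < norm (Z0 \<omega>)} = ennreal (tail (2 ^ k * u0))"
        by (simp add: tail_def emeasure_eq_measure)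
      thus ?thesis using gt[of k] by (simp add: ennreal_mult'[symmetric] tail_nonneg g_def ennreal_leI)
    qed
  qed auto
  also have "(\<Sum>k. ennreal (D * r ^ k)) < \<infinity>"
  proof -
    have "summable (\<lambda>k. D * r ^ k)" using r by (intro summable_mult summable_geometric) auto
    moreover have "0 \<le> D" using C by (simp add: D_def)
    ultimately have "(\<Sum>k. ennreal (D * r ^ k)) = ennreal (\<Sum>k. D * r ^ k)"
      using r by (intro suminf_ennreal2) auto
    thus ?thesis by simp
  qed
  finally have "(\<integral>\<^sup>+\<omega>. ennreal (norm (Z0 \<omega>) powr q) \<partial>M) < \<infinity>" by simp
  thus ?thesis unfolding q_def[symmetric] by (intro integrableI_bounded) auto
qed

end

section \<open>Linear processes\<close>

locale heavy_tail_process = regular_tail M "Z 0" \<alpha> \<nu>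
  for M :: "'a measure" and Z :: "int \<Rightarrow> 'a \<Rightarrow> real^'d" and \<alpha> :: real and \<nu> :: "(ereal^'d) measure" +
  fixes A :: "int \<Rightarrow> real^'d^'d"
  assumes Z_meas [measurable]: "\<And>i. Z i \<in> borel_measurable M"
    and Z_indep: "indep_vars (\<lambda>_. borel) Z UNIV"
    and Z_distr: "\<And>i. distr M borel (Z i) = distr M borel (Z 0)"
    and Z_integrable: "integrable M (Z 0)"
    and Z_mean: "expectation (Z 0) = 0"
    and A_summable: "(\<lambda>i. onorm ((*v) (A i))) summable_on UNIV"
begin

section \<open>Weights in the block sums\<close>

definition nA :: "int \<Rightarrow> real" where "nA i = onorm ((*v) (A i))"
text \<open>The summand 1 keeps the constant at least 1, so that thresholds may be divided by
  it.\<close>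

definition a :: real where "a = 1 + infsum nA UNIV"
definition \<tau> :: "nat \<Rightarrow> real" where "\<tau> h = infsum nA {i. int h < \<bar>i\<bar>}"
definition \<A> :: "real^'d^'d" where "\<A> = (\<Sum>\<^sub>\<infinity>i. A i)"
text \<open>The matrix multiplying \<open>Z m\<close> in \<open>block_sum A Z n j\<close> after the
  sum over the block and the series are interchanged.\<close>

definition cf :: "nat \<Rightarrow> int \<Rightarrow> int \<Rightarrow> real^'d^'d" where
  "cf n j m = (\<Sum>k\<in>{j..j + int n - 1}. A (k - m))"

text \<open>An upper bound, uniform in \<open>\<bar>j\<bar> \<le> n\<close>, for the weight of \<open>Z m\<close> in \<open>block_sum A Z n j\<close>.\<close>

definition D :: "nat \<Rightarrow> int \<Rightarrow> real" where
  "D n m = (if \<bar>m\<bar> \<le> 3 * int n then a else (\<Sum>k\<in>{- int n..2 * int n - 1}. nA (k - m)))"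

lemma nA_nonneg: "0 \<le> nA i"
  unfolding nA_def by (rule onorm_pos_le) (simp add: matrix_vector_mul_bounded_linear)

lemma norm_A_mult: "norm (A i *v x) \<le> nA i * norm x"
  unfolding nA_def by (rule onorm) (simp add: matrix_vector_mul_bounded_linear)

lemma nA_summable: "nA summable_on S"
proof -
  have "nA summable_on UNIV" using A_summable by (simp add: nA_def[abs_def])
  thus ?thesis by (rule summable_on_subset_banach) simp
qed

lemma a_ge_1: "1 \<le> a" unfolding a_def by (simp add: infsum_nonneg nA_nonneg)

lemma tau_nonneg: "0 \<le> \<tau> h" unfolding \<tau>_def by (simp add: infsum_nonneg nA_nonneg)

lemma sum_nA_le_infsum: "finite S \<Longrightarrow> S \<subseteq> T \<Longrightarrow> (\<Sum>i\<in>S. nA i) \<le> infsum nA T"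
  by (intro finite_sum_le_infsum nA_summable nA_nonneg)

lemma sum_nA_le: "finite S \<Longrightarrow> (\<Sum>i\<in>S. nA i) \<le> a"
  using sum_nA_le_infsum[of S UNIV] by (simp add: a_def)

lemma tau_le: "\<tau> h \<le> a"
proof -
  have "\<tau> h \<le> infsum nA UNIV" unfolding \<tau>_def
    by (intro infsum_mono_neutral nA_summable) (auto simp: nA_nonneg)
  thus ?thesis by (simp add: a_def)
qed

lemma tau_tendsto_0: "\<tau> \<longlonglongrightarrow> 0"
proof (rule LIMSEQ_I)
  fix e :: real assume e: "0 < e"
  have "(nA has_sum infsum nA UNIV) UNIV" using nA_summable by (rule has_sum_infsum)
  hence "\<forall>\<^sub>F Y in finite_subsets_at_top UNIV. dist (sum nA Y) (infsum nA UNIV) < e"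
    unfolding has_sum_def using e by (rule tendstoD)
  then obtain S where S: "finite S" "\<And>Y. finite Y \<Longrightarrow> S \<subseteq> Y \<Longrightarrow> dist (sum nA Y) (infsum nA UNIV) < e"
    by (auto simp: eventually_finite_subsets_at_top)
  obtain N :: nat where N: "\<And>i. i \<in> S \<Longrightarrow> \<bar>i\<bar> \<le> int N"
  proof -
    have "\<bar>i\<bar> \<le> int (nat (Max (insert 0 (abs ` S))))" if "i \<in> S" for i
      using S(1) that by (auto simp: nat_le_eq_zle intro!: Max_ge)
    thus ?thesis using that by blast
  qed
  show "\<exists>no. \<forall>n\<ge>no. norm (\<tau> n - 0) < e"
  proof (intro exI allI impI)
    fix n assume n: "N \<le> n"
    have fin: "finite {i::int. \<bar>i\<bar> \<le> int n}"
      by (rule finite_subset[of _ "{- int n..int n}"]) auto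
    have "infsum nA UNIV = infsum nA {i::int. \<bar>i\<bar> \<le> int n} + infsum nA {i. int n < \<bar>i\<bar>}"
    proof -
      have "UNIV = {i::int. \<bar>i\<bar> \<le> int n} \<union> {i. int n < \<bar>i\<bar>}" by auto
      thus ?thesis by (metis (mono_tags, lifting) Collect_disj_eq disjoint_iff infsum_Un_disjoint linorder_not_less mem_Collect_eq nA_summable)
    qed
    hence "\<tau> n = infsum nA UNIV - sum nA {i. \<bar>i\<bar> \<le> int n}" using fin by (simp add: \<tau>_def)
    moreover have "S \<subseteq> {i. \<bar>i\<bar> \<le> int n}" using N n by force
    ultimately show "norm (\<tau> n - 0) < e" using S(2)[OF fin] by (simp add: dist_real_def)
  qed
qed

lemma sum_nA_shift_le: "finite K \<Longrightarrow> (\<Sum>k\<in>K. nA (k - m)) \<le> a" "finite K \<Longrightarrow> (\<Sum>k\<in>K. nA (m - k)) \<le> a"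
  using sum_nA_le[of "(\<lambda>k. k - m) ` K"] sum_nA_le[of "(\<lambda>k. m - k) ` K"]
  by (simp_all add: sum.reindex[OF inj_on_int_shift(1)] sum.reindex[OF inj_on_int_shift(2)] o_def)

lemma sum_nA_shift_le_tau:
  "finite K \<Longrightarrow> (\<And>k. k \<in> K \<Longrightarrow> int h < \<bar>k - m\<bar>) \<Longrightarrow> (\<Sum>k\<in>K. nA (k - m)) \<le> \<tau> h"
  "finite K \<Longrightarrow> (\<And>k. k \<in> K \<Longrightarrow> int h < \<bar>m - k\<bar>) \<Longrightarrow> (\<Sum>k\<in>K. nA (m - k)) \<le> \<tau> h"
  using sum_nA_le_infsum[of "(\<lambda>k. k - m) ` K" "{i. int h < \<bar>i\<bar>}"]
    sum_nA_le_infsum[of "(\<lambda>k. m - k) ` K" "{i. int h < \<bar>i\<bar>}"]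
  by (auto simp add: sum.reindex[OF inj_on_int_shift(1)] sum.reindex[OF inj_on_int_shift(2)] o_def \<tau>_def)

lemma norm_cf_le_sum: "norm (cf n j m *v x) \<le> (\<Sum>k\<in>{j..j + int n - 1}. nA (k - m)) * norm x"
proof -
  have "cf n j m *v x = (\<Sum>k\<in>{j..j + int n - 1}. A (k - m) *v x)"
    unfolding cf_def by (induction rule: infinite_finite_induct) (auto simp: matrix_vector_mult_add_rdistrib)
  also have "norm \<dots> \<le> (\<Sum>k\<in>{j..j + int n - 1}. nA (k - m) * norm x)"
    by (intro order_trans[OF norm_sum] sum_mono norm_A_mult)
  finally show ?thesis by (simp add: sum_distrib_right)
qed

lemma D_nonneg: "0 \<le> D n m"
  unfolding D_def using a_ge_1 by (auto intro: sum_nonneg nA_nonneg)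

lemma D_le: "D n m \<le> a"
  unfolding D_def by (auto intro: sum_nA_shift_le)

lemma norm_cf_le_D:
  assumes "\<bar>j\<bar> \<le> int n"
  shows "norm (cf n j m *v x) \<le> D n m * norm x"
proof -
  have "(\<Sum>k\<in>{j..j + int n - 1}. nA (k - m)) \<le> D n m"
    unfolding D_def using assms by (auto intro!: sum_nA_shift_le sum_mono2 nA_nonneg)
  thus ?thesis using norm_cf_le_sum[of n j m x] by (meson mult_right_mono norm_ge_zero order_trans)
qed

text \<open>Under either alternative every index k of the block satisfies |k - m| > h, so only
  matrices beyond lag h enter the weight. The alternatives are asymmetric because the last index of
  the block is j + n - 1.\<close>

lemma norm_cf_outer:
  assumes "m - j < - int h \<or> int n + int h \<le> m - j"
  shows "norm (cf n j m *v x) \<le> \<tau> h * norm x"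
proof -
  have "(\<Sum>k\<in>{j..j + int n - 1}. nA (k - m)) \<le> \<tau> h"
    using assms by (intro sum_nA_shift_le_tau) auto
  thus ?thesis using norm_cf_le_sum[of n j m x] by (meson mult_right_mono norm_ge_zero order_trans)
qed

text \<open>The norm of the matrix type is not the operator norm, but each entry is bounded by the
  latter, by evaluation at a basis vector. Thus the series defining \<open>\<A>\<close> converges
  unconditionally rather than taking a default value.\<close>

lemma A_summable_matrix: "A summable_on UNIV"
proof (rule abs_summable_summable)
  have entry: "\<bar>A i $ r $ c\<bar> \<le> nA i" for i r c
  proof -
    have "\<bar>(A i *v axis c 1) $ r\<bar> \<le> norm (A i *v axis c 1)" by (rule component_le_norm_cart)
    also have "\<dots> \<le> nA i * norm (axis c (1::real) :: real^'d)" by (rule norm_A_mult)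
    also have "norm (axis c (1::real) :: real^'d) = 1" by simp
    finally show ?thesis by (simp add: matrix_vector_mul_component inner_axis)
  qed
  have bound: "norm (A i) \<le> real CARD('d) * (real CARD('d) * nA i)" for i
  proof -
    have "norm (A i) \<le> (\<Sum>r\<in>UNIV. norm (A i $ r))"
      unfolding norm_vec_def by (intro L2_set_le_sum) auto
    also have "\<dots> \<le> (\<Sum>r\<in>(UNIV::'d set). \<Sum>c\<in>(UNIV::'d set). nA i)"
    proof (rule sum_mono)
      fix r
      have "norm (A i $ r) \<le> (\<Sum>c\<in>UNIV. \<bar>A i $ r $ c\<bar>)" by (rule norm_le_l1_cart)
      also have "\<dots> \<le> (\<Sum>c\<in>(UNIV::'d set). nA i)" by (intro sum_mono entry)
      finally show "norm (A i $ r) \<le> (\<Sum>c\<in>(UNIV::'d set). nA i)" .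
    qed
    finally show ?thesis by simp
  qed
  show "(\<lambda>i. norm (A i)) summable_on UNIV"
  proof (rule summable_on_comparison_test)
    show "(\<lambda>i. real CARD('d) * (real CARD('d) * nA i)) summable_on UNIV"
      by (intro summable_on_cmult_right nA_summable)
  qed (use bound in auto)
qed

lemma A_mult_has_sum: "((\<lambda>i. A i *v x) has_sum (\<A> *v x)) UNIV"
  unfolding \<A>_def
  by (rule has_sum_bounded_linear[OF bounded_linear_matrix_apply has_sum_infsum[OF A_summable_matrix], unfolded o_def])

text \<open>All lags of modulus at most h occur in the block, so what is missing from the full
  series is part of its tail beyond h.\<close>

lemma norm_cf_inner:
  assumes "int h \<le> m - j" "m - j \<le> int n - 1 - int h"
  shows "norm (cf n j m *v x - \<A> *v x) \<le> \<tau> h * norm x"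
proof -
  define S where "S = (\<lambda>k. k - m) ` {j..j + int n - 1}"
  have S: "finite S" by (simp add: S_def)
  have "cf n j m *v x = (\<Sum>k\<in>{j..j + int n - 1}. A (k - m) *v x)"
    unfolding cf_def by (induction rule: infinite_finite_induct) (auto simp: matrix_vector_mult_add_rdistrib)
  also have "\<dots> = (\<Sum>i\<in>S. A i *v x)"
    unfolding S_def by (subst sum.reindex[OF inj_on_int_shift(1)]) (simp add: o_def)
  finally have cf: "cf n j m *v x = (\<Sum>i\<in>S. A i *v x)" .
  have nsum: "(\<lambda>i. nA i * norm x) summable_on T" for T
    by (intro summable_on_cmult_left nA_summable)
  have abs: "(\<lambda>i. norm (A i *v x)) summable_on T" for T
    by (rule summable_on_comparison_test[OF nsum]) (auto simp: norm_A_mult)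
  have "\<A> *v x = (\<Sum>\<^sub>\<infinity>i. A i *v x)" by (rule infsumI[OF A_mult_has_sum, symmetric])
  also have "\<dots> = infsum (\<lambda>i. A i *v x) (S \<union> - S)" by simp
  also have "\<dots> = (\<Sum>i\<in>S. A i *v x) + infsum (\<lambda>i. A i *v x) (- S)"
    using infsum_Un_disjoint[OF summable_on_finite[OF S] abs_summable_summable[OF abs], of "- S"] S by simp
  finally have "norm (cf n j m *v x - \<A> *v x) = norm (infsum (\<lambda>i. A i *v x) (- S))" by (simp add: cf)
  also have "\<dots> \<le> infsum (\<lambda>i. norm (A i *v x)) (- S)" by (rule norm_infsum_bound[OF abs])
  also have "\<dots> \<le> infsum (\<lambda>i. nA i * norm x) {i. int h < \<bar>i\<bar>}"
  proof (rule infsum_mono_neutral[OF abs nsum])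
    fix i assume "i \<in> - S - {i. int h < \<bar>i\<bar>}"
    hence i: "i \<notin> S" "\<bar>i\<bar> \<le> int h" by auto
    have "i + m \<in> {j..j + int n - 1}" using i(2) assms by auto
    hence "i \<in> S" unfolding S_def by (rule rev_image_eqI) simp
    thus "norm (A i *v x) \<le> 0" using i by simp
  qed (auto simp: norm_A_mult nA_nonneg)
  also have "\<dots> = \<tau> h * norm x" unfolding \<tau>_def by (rule infsum_cmult_left') 
  finally show ?thesis .
qed

text \<open>Blocks with |j| \<le> n lie in {-n, ..., 2n - 1}, so an index with |m| > 3n is at
  distance more than n from each of these 3n points. After the two sums are exchanged each inner sum
  is at most \<open>\<tau> n\<close>. The total is o(n), which makes big jumps outside the window
  negligible.\<close>

lemma sum_D_far:
  assumes "finite F" "\<And>m. m \<in> F \<Longrightarrow> 3 * int n < \<bar>m\<bar>"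
  shows "(\<Sum>m\<in>F. D n m) \<le> 3 * real n * \<tau> n"
proof -
  have "(\<Sum>m\<in>F. D n m) = (\<Sum>m\<in>F. \<Sum>k\<in>{- int n..2 * int n - 1}. nA (k - m))"
    using assms(2) by (intro sum.cong) (force simp: D_def)+
  also have "\<dots> = (\<Sum>k\<in>{- int n..2 * int n - 1}. \<Sum>m\<in>F. nA (k - m))" by (rule sum.swap)
  also have "\<dots> \<le> (\<Sum>k\<in>{- int n..2 * int n - 1}. \<tau> n)"
  proof (rule sum_mono, rule sum_nA_shift_le_tau(2)[OF assms(1)])
    fix k m assume "k \<in> {- int n..2 * int n - 1}" "m \<in> F"
    thus "int n < \<bar>k - m\<bar>" using assms(2)[of m] by auto
  qed
  finally show ?thesis by simp
qed

text \<open>The 6n + 1 central indices count a each and the outer ones 3n * a altogether; for n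
  \<ge> 1 this is at most 10n * a.\<close>

lemma sum_D:
  assumes "finite F" "1 \<le> n"
  shows "(\<Sum>m\<in>F. D n m) \<le> 10 * real n * a"
proof -
  have "(\<Sum>m\<in>F. D n m) = (\<Sum>m\<in>F \<inter> {- 3 * int n..3 * int n}. D n m) + (\<Sum>m\<in>F - {- 3 * int n..3 * int n}. D n m)"
    using assms(1) by (rule sum.Int_Diff)
  moreover have "(\<Sum>m\<in>F \<inter> {- 3 * int n..3 * int n}. D n m) \<le> (6 * real n + 1) * a"
  proof -
    have "(\<Sum>m\<in>F \<inter> {- 3 * int n..3 * int n}. D n m) \<le> (\<Sum>m\<in>{- 3 * int n..3 * int n}. a)"
      using a_ge_1 by (intro order_trans[OF sum_mono2 sum_mono]) (auto simp: D_nonneg D_le)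
    also have "\<dots> = (6 * real n + 1) * a" by simp
    finally show ?thesis .
  qed
  moreover have "(\<Sum>m\<in>F - {- 3 * int n..3 * int n}. D n m) \<le> 3 * real n * a"
  proof -
    have "(\<Sum>m\<in>F - {- 3 * int n..3 * int n}. D n m) \<le> 3 * real n * \<tau> n"
      using assms(1) by (intro sum_D_far) auto
    also have "\<dots> \<le> 3 * real n * a" using tau_le by (intro mult_left_mono) auto
    finally show ?thesis .
  qed
  ultimately have "(\<Sum>m\<in>F. D n m) \<le> (6 * real n + 1) * a + 3 * real n * a" by linarith
  also have "\<dots> \<le> 10 * real n * a"
  proof -
    have "(6 * real n + 1 + 3 * real n) * a \<le> (10 * real n) * a"
      using a_ge_1 assms(2) by (intro mult_right_mono) auto
    thus ?thesis by (simp add: algebra_simps)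
  qed
  finally show ?thesis .
qed

lemma prob_Z: "G \<in> sets borel \<Longrightarrow> \<P>(\<omega> in M. Z m \<omega> \<in> G) = \<P>(\<omega> in M. Z 0 \<omega> \<in> G)"
proof -
  assume G: "G \<in> sets borel"
  have "measure (distr M borel (Z i)) G = \<P>(\<omega> in M. Z i \<omega> \<in> G)" for i
    using G by (subst measure_distr) (auto intro!: arg_cong[where f=prob])
  thus ?thesis using Z_distr by metis
qed

lemma expectation_Z:
  fixes f :: "real^'d \<Rightarrow> 'c::{banach, second_countable_topology}"
  assumes [measurable]: "f \<in> borel_measurable borel"
  shows "expectation (\<lambda>\<omega>. f (Z m \<omega>)) = expectation (\<lambda>\<omega>. f (Z 0 \<omega>))"
    and "integrable M (\<lambda>\<omega>. f (Z m \<omega>)) \<longleftrightarrow> integrable M (\<lambda>\<omega>. f (Z 0 \<omega>))"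
proof -
  have "integral\<^sup>L (distr M borel (Z i)) f = expectation (\<lambda>\<omega>. f (Z i \<omega>))" for i
    by (rule integral_distr) auto
  thus "expectation (\<lambda>\<omega>. f (Z m \<omega>)) = expectation (\<lambda>\<omega>. f (Z 0 \<omega>))" using Z_distr by metis
  have "integrable (distr M borel (Z i)) f \<longleftrightarrow> integrable M (\<lambda>\<omega>. f (Z i \<omega>))" for i
    by (rule integrable_distr_eq) auto
  thus "integrable M (\<lambda>\<omega>. f (Z m \<omega>)) \<longleftrightarrow> integrable M (\<lambda>\<omega>. f (Z 0 \<omega>))" using Z_distr by metis
qed

section \<open>Truncated sums\<close>

text \<open>The threshold applies to the variable times its largest weight over all starts |j| \<le>
  n. Hence one family of truncated variables serves all starts, and every weighted term is at most
  \<open>\<epsilon> * real n\<close>.\<close>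

definition Y :: "nat \<Rightarrow> real \<Rightarrow> int \<Rightarrow> 'a \<Rightarrow> real^'d" where
  "Y n \<epsilon> m \<omega> = (if D n m * norm (Z m \<omega>) \<le> \<epsilon> * real n then Z m \<omega> else 0)"

abbreviation trunc_sum :: "int set \<Rightarrow> nat \<Rightarrow> real \<Rightarrow> int \<Rightarrow> 'a \<Rightarrow> real^'d" where
  "trunc_sum F n \<epsilon> j \<omega> \<equiv> \<Sum>m\<in>F. cf n j m *v Y n \<epsilon> m \<omega>"

definition mtail :: "real \<Rightarrow> real" where
  "mtail v = expectation (\<lambda>\<omega>. norm (Z 0 \<omega>) * indicator {z. v < norm z} (Z 0 \<omega>))"

definition \<mu> :: real where "\<mu> = expectation (\<lambda>\<omega>. norm (Z 0 \<omega>) powr (1 + \<kappa>))"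

lemma mu_nonneg: "0 \<le> \<mu>" unfolding \<mu>_def by (rule integral_nonneg_AE) auto

lemma mtail_tendsto_0: "(mtail \<longlongrightarrow> 0) at_top"
proof -
  have "((\<lambda>v. expectation (\<lambda>\<omega>. norm (Z 0 \<omega>) * indicator {z. v < norm z} (Z 0 \<omega>))) \<longlongrightarrow> expectation (\<lambda>\<omega>. 0)) at_top"
  proof (rule integral_dominated_convergence_at_top[where w="\<lambda>\<omega>. norm (Z 0 \<omega>)"])
    show "integrable M (\<lambda>\<omega>. norm (Z 0 \<omega>))" using Z_integrable by simp
    show "\<forall>\<^sub>F i in at_top. AE \<omega> in M. norm (norm (Z 0 \<omega>) * indicator {z. i < norm z} (Z 0 \<omega>)) \<le> norm (Z 0 \<omega>)"
      by (auto simp: indicator_def)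
    show "AE \<omega> in M. ((\<lambda>i. norm (Z 0 \<omega>) * indicator {z. i < norm z} (Z 0 \<omega>)) \<longlongrightarrow> 0) at_top"
    proof (rule AE_I2)
      fix \<omega>
      show "((\<lambda>i. norm (Z 0 \<omega>) * indicator {z. i < norm z} (Z 0 \<omega>)) \<longlongrightarrow> 0) at_top"
        by (rule tendsto_eventually)
           (use eventually_ge_at_top[of "norm (Z 0 \<omega>)"] in eventually_elim, simp)
    qed
  qed auto
  thus ?thesis by (simp add: mtail_def[abs_def])
qed

lemma norm_cf_Y_le:
  assumes "\<bar>j\<bar> \<le> int n" "0 < \<epsilon>"
  shows "norm (cf n j m *v Y n \<epsilon> m \<omega>) \<le> \<epsilon> * real n"
  using norm_cf_le_D[OF assms(1), of m "Z m \<omega>"] assms(2) by (auto simp: Y_def)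

lemma Y_measurable [measurable]: "Y n \<epsilon> m \<in> borel_measurable M"
  unfolding Y_def by measurable

lemma Y_integrable: "integrable M (Y n \<epsilon> m)"
proof -
  have "integrable M (Z m)" using expectation_Z(2)[of "\<lambda>z. z" m] Z_integrable by simp
  thus ?thesis by (rule Bochner_Integration.integrable_bound) (auto simp: Y_def)
qed

text \<open>\<open>Z m\<close> is centred, so the mean of its truncation is minus the mean of the
  removed part. That part lives where the norm exceeds \<open>\<epsilon> * real n / a\<close>, since
  all weights are at most a.\<close>

lemma norm_expectation_cf_Y:
  assumes "\<bar>j\<bar> \<le> int n"
  shows "norm (expectation (\<lambda>\<omega>. cf n j m *v Y n \<epsilon> m \<omega>)) \<le> D n m * mtail (\<epsilon> * real n / a)"
proof -
  have Zm: "integrable M (Z m)" "expectation (Z m) = 0"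
    using expectation_Z[of "\<lambda>z. z" m] Z_integrable Z_mean by simp_all
  have "expectation (Y n \<epsilon> m) = expectation (\<lambda>\<omega>. Z m \<omega> - (Z m \<omega> - Y n \<epsilon> m \<omega>))" by simp
  also have "\<dots> = - expectation (\<lambda>\<omega>. Z m \<omega> - Y n \<epsilon> m \<omega>)"
    using Zm Y_integrable by (subst Bochner_Integration.integral_diff) auto
  finally have "norm (expectation (Y n \<epsilon> m)) = norm (expectation (\<lambda>\<omega>. Z m \<omega> - Y n \<epsilon> m \<omega>))" by simp
  also have "\<dots> \<le> expectation (\<lambda>\<omega>. norm (Z m \<omega> - Y n \<epsilon> m \<omega>))" by (rule integral_norm_bound)
  also have "\<dots> \<le> expectation (\<lambda>\<omega>. norm (Z m \<omega>) * indicator {z. \<epsilon> * real n / a < norm z} (Z m \<omega>))"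
  proof (rule integral_mono')
    show "integrable M (\<lambda>\<omega>. norm (Z m \<omega>) * indicator {z. \<epsilon> * real n / a < norm z} (Z m \<omega>))"
      by (rule Bochner_Integration.integrable_bound[OF integrable_norm[OF Zm(1)]]) (auto simp: indicator_def)
    fix \<omega>
    have "\<epsilon> * real n / a < norm (Z m \<omega>)" if "\<epsilon> * real n < D n m * norm (Z m \<omega>)"
    proof -
      have "D n m * norm (Z m \<omega>) \<le> a * norm (Z m \<omega>)" by (intro mult_right_mono D_le) auto
      hence "\<epsilon> * real n < a * norm (Z m \<omega>)" using that by linarith
      thus ?thesis using a_ge_1 by (simp add: field_simps)
    qed
    thus "norm (Z m \<omega> - Y n \<epsilon> m \<omega>) \<le> norm (Z m \<omega>) * indicator {z. \<epsilon> * real n / a < norm z} (Z m \<omega>)"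
      by (auto simp: Y_def not_le)
  qed auto
  also have "\<dots> = mtail (\<epsilon> * real n / a)"
    unfolding mtail_def by (rule expectation_Z(1)) measurable
  finally have *: "norm (expectation (Y n \<epsilon> m)) \<le> mtail (\<epsilon> * real n / a)" .
  have "expectation (\<lambda>\<omega>. cf n j m *v Y n \<epsilon> m \<omega>) = cf n j m *v expectation (Y n \<epsilon> m)"
    by (rule integral_bounded_linear[OF matrix_vector_mul_bounded_linear Y_integrable])
  also have "norm \<dots> \<le> D n m * norm (expectation (Y n \<epsilon> m))" by (rule norm_cf_le_D[OF assms])
  also have "\<dots> \<le> D n m * mtail (\<epsilon> * real n / a)" by (intro mult_left_mono * D_nonneg)
  finally show ?thesis .
qed

text \<open>Second moments may be infinite before truncation. The square is split into powers 1 -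
  \<kappa> and 1 + \<kappa>: the first is bounded by the truncation level, the second by the
  available moment. One factor \<open>D n m\<close> is kept, so that the sum over m is of order
  n.\<close>

lemma expectation_norm_cf_Y_sq:
  assumes "\<bar>j\<bar> \<le> int n" "0 < \<epsilon>"
  shows "expectation (\<lambda>\<omega>. (norm (cf n j m *v Y n \<epsilon> m \<omega>))\<^sup>2)
    \<le> D n m * ((\<epsilon> * real n) powr (1 - \<kappa>) * a powr \<kappa> * \<mu>)"
proof -
  define c where "c = D n m * ((\<epsilon> * real n) powr (1 - \<kappa>) * a powr \<kappa>)"
  have int: "integrable M (\<lambda>\<omega>. norm (Z m \<omega>) powr (1 + \<kappa>))"
    using expectation_Z(2)[of "\<lambda>z. norm z powr (1 + \<kappa>)" m] integrable_moment by simp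
  have c: "0 \<le> c" unfolding c_def by (intro mult_nonneg_nonneg D_nonneg) auto
  have "expectation (\<lambda>\<omega>. (norm (cf n j m *v Y n \<epsilon> m \<omega>))\<^sup>2) \<le> expectation (\<lambda>\<omega>. c * norm (Z m \<omega>) powr (1 + \<kappa>))"
  proof (rule integral_mono')
    show "integrable M (\<lambda>\<omega>. c * norm (Z m \<omega>) powr (1 + \<kappa>))" using int by simp
    fix \<omega>
    show "(norm (cf n j m *v Y n \<epsilon> m \<omega>))\<^sup>2 \<le> c * norm (Z m \<omega>) powr (1 + \<kappa>)"
    proof (cases "D n m * norm (Z m \<omega>) \<le> \<epsilon> * real n")
      case True
      define w where "w = D n m * norm (Z m \<omega>)"
      have w: "0 \<le> w" "w \<le> \<epsilon> * real n" using True D_nonneg by (auto simp: w_def)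
      have "(norm (cf n j m *v Y n \<epsilon> m \<omega>))\<^sup>2 \<le> w\<^sup>2"
        using norm_cf_le_D[OF assms(1), of m "Z m \<omega>"] True by (intro power_mono) (auto simp: Y_def w_def)
      also have "w\<^sup>2 = w powr (1 - \<kappa>) * w powr (1 + \<kappa>)"
        using w by (cases "w = 0") (simp_all flip: powr_add)
      also have "\<dots> \<le> (\<epsilon> * real n) powr (1 - \<kappa>) * w powr (1 + \<kappa>)"
        using w kappa by (intro mult_right_mono powr_mono2) auto
      also have "w powr (1 + \<kappa>) = D n m powr (1 + \<kappa>) * norm (Z m \<omega>) powr (1 + \<kappa>)"
        unfolding w_def using D_nonneg by (simp add: powr_mult)
      also have "D n m powr (1 + \<kappa>) = D n m * D n m powr \<kappa>"
        using D_nonneg by (simp add: powr_mult_base)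
      also have "(\<epsilon> * real n) powr (1 - \<kappa>) * (D n m * D n m powr \<kappa> * norm (Z m \<omega>) powr (1 + \<kappa>))
          \<le> (\<epsilon> * real n) powr (1 - \<kappa>) * (D n m * a powr \<kappa> * norm (Z m \<omega>) powr (1 + \<kappa>))"
        using kappa by (intro mult_left_mono mult_right_mono powr_mono2 D_le D_nonneg) auto
      finally show ?thesis by (simp add: c_def mult_ac)
    next
      case False
      thus ?thesis using c by (simp add: Y_def)
    qed
  qed (use c in auto)
  also have "\<dots> = c * \<mu>"
    using expectation_Z(1)[of "\<lambda>z. norm z powr (1 + \<kappa>)" m] by (simp add: \<mu>_def)
  finally show ?thesis by (simp add: c_def mult_ac)
qed

lemma truncated_sum_chernoff:
  assumes "\<bar>j\<bar> \<le> int n" "0 < \<epsilon>" "0 < s" "finite F" "1 \<le> n"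
  shows "\<P>(\<omega> in M. \<delta> * real n < norm (trunc_sum F n \<epsilon> j \<omega>))
    \<le> 2 * real CARD('d) * exp (- s * (\<delta> * real n / real CARD('d))
        + s * (10 * real n * a * mtail (\<epsilon> * real n / a))
        + s\<^sup>2 * exp (s * (\<epsilon> * real n)) * (10 * real n * a * ((\<epsilon> * real n) powr (1 - \<kappa>) * a powr \<kappa> * \<mu>)))"
proof -
  define E where "E = mtail (\<epsilon> * real n / a)"
  define V where "V = (\<epsilon> * real n) powr (1 - \<kappa>) * a powr \<kappa> * \<mu>"
  have E0: "0 \<le> E" unfolding E_def mtail_def by (rule integral_nonneg_AE) auto
  have V0: "0 \<le> V" unfolding V_def using mu_nonneg by simp
  have ind: "indep_vars (\<lambda>_. borel) (\<lambda>m \<omega>. cf n j m *v Y n \<epsilon> m \<omega>) F"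
  proof -
    have "indep_vars (\<lambda>_. borel)
        (\<lambda>m \<omega>. (\<lambda>z. cf n j m *v (if D n m * norm z \<le> \<epsilon> * real n then z else 0)) (Z m \<omega>)) F"
      by (rule indep_vars_compose2[OF indep_vars_subset[OF Z_indep]]) auto
    thus ?thesis by (simp add: Y_def)
  qed
  have "\<P>(\<omega> in M. \<delta> * real n < norm (trunc_sum F n \<epsilon> j \<omega>))
    \<le> 2 * real CARD('d) * exp (- s * (\<delta> * real n / real CARD('d)) + s * (\<Sum>m\<in>F. D n m * E)
        + s\<^sup>2 * exp (s * (\<epsilon> * real n)) * (\<Sum>m\<in>F. D n m * V))"
    unfolding E_def V_def
    by (rule chernoff_bounded_sum_vec[OF assms(4) ind norm_cf_Y_le norm_expectation_cf_Y expectation_norm_cf_Y_sq])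
       (use assms in auto)
  also have "\<dots> \<le> 2 * real CARD('d) * exp (- s * (\<delta> * real n / real CARD('d)) + s * (10 * real n * a * E)
        + s\<^sup>2 * exp (s * (\<epsilon> * real n)) * (10 * real n * a * V))"
    using sum_D[OF assms(4,5)] assms E0 V0
    by (intro mult_left_mono iffD2[OF exp_le_cancel_iff] add_mono order_refl)
       (auto simp flip: sum_distrib_right intro!: mult_right_mono)
  finally show ?thesis by (simp add: E_def V_def)
qed

text \<open>Choosing the Chernoff parameter of order \<open>ln n / n\<close> makes the truncated part smaller than any
  given power of \<open>n\<close>, once the truncation level is small enough.\<close>

lemma truncated_sum_deviation:
  assumes "0 < \<delta>" "0 < \<gamma>" "0 < \<epsilon>\<^sub>0"
  obtains \<epsilon> where "0 < \<epsilon>" "\<epsilon> \<le> \<epsilon>\<^sub>0"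
    "\<forall>\<^sub>F n in sequentially. \<forall>j F. \<bar>j\<bar> \<le> int n \<and> finite F \<longrightarrow>
      \<P>(\<omega> in M. \<delta> * real n < norm (trunc_sum F n \<epsilon> j \<omega>))
        \<le> 2 * real CARD('d) * exp 1 * real n powr (- \<gamma>)"
proof -
  define d where "d = real CARD('d)"
  have d: "0 < d" by (simp add: d_def)
  \<comment> \<open>With \<open>s = g * ln n / n\<close> the leading exponent is -(\<gamma> + 1) ln
    n. One power of n is reserved for the drift of the truncated means; the quadratic term costs
    only the constant factor \<open>exp 1\<close>.\<close>
  define g where "g = d * (\<gamma> + 1) / \<delta>"
  have g: "0 < g" using d assms by (simp add: g_def)
  \<comment> \<open>Makes \<open>exp (s * (\<epsilon> * real n))\<close>, a power of n with exponent
    \<open>g * \<epsilon>\<close>, at most \<open>n powr (\<kappa> / 2)\<close>. The other factors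
    of the quadratic term are of order (ln n)^2 times \<open>n powr (- \<kappa>)\<close>, so their
    product tends to 0.\<close>
  define \<epsilon> where "\<epsilon> = min \<epsilon>\<^sub>0 (\<kappa> / (2 * g))"
  have eps: "0 < \<epsilon>" "\<epsilon> \<le> \<epsilon>\<^sub>0" "g * \<epsilon> \<le> \<kappa> / 2"
  proof -
    show "0 < \<epsilon>" "\<epsilon> \<le> \<epsilon>\<^sub>0" using assms kappa g by (auto simp: \<epsilon>_def)
    have "g * \<epsilon> \<le> g * (\<kappa> / (2 * g))" using g by (intro mult_left_mono) (auto simp: \<epsilon>_def)
    thus "g * \<epsilon> \<le> \<kappa> / 2" using g by simp
  qed
  define C where "C = g\<^sup>2 * 10 * a * (\<epsilon> powr (1 - \<kappa>) * a powr \<kappa> * \<mu>)"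
  have C: "0 \<le> C" using a_ge_1 mu_nonneg by (simp add: C_def)
  have ev1: "\<forall>\<^sub>F n in sequentially. g * 10 * a * mtail (\<epsilon> * real n / a) < 1"
  proof -
    have "filterlim (\<lambda>n. \<epsilon> * real n / a) at_top sequentially"
    proof -
      have "filterlim (\<lambda>n. (\<epsilon> / a) * real n) at_top sequentially"
        using eps a_ge_1
        by (intro filterlim_tendsto_pos_mult_at_top[OF tendsto_const _ filterlim_real_sequentially]) auto
      thus ?thesis by simp
    qed
    hence "(\<lambda>n. g * 10 * a * mtail (\<epsilon> * real n / a)) \<longlonglongrightarrow> g * 10 * a * 0"
      by (intro tendsto_mult tendsto_const filterlim_compose[OF mtail_tendsto_0])
    thus ?thesis by (intro order_tendstoD(2)) auto
  qed
  have ev2: "\<forall>\<^sub>F n in sequentially. C * ((ln (real n))\<^sup>2 * real n powr (- (\<kappa> / 2))) < 1"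
  proof -
    have "(\<lambda>n. (ln (real n))\<^sup>2 * real n powr (- (\<kappa> / 2))) \<longlonglongrightarrow> 0"
      using kappa(1) by real_asymp
    hence "(\<lambda>n. C * ((ln (real n))\<^sup>2 * real n powr (- (\<kappa> / 2)))) \<longlonglongrightarrow> C * 0"
      by (intro tendsto_mult tendsto_const)
    thus ?thesis by (intro order_tendstoD(2)) auto
  qed
  have "\<forall>\<^sub>F n in sequentially. \<forall>j F. \<bar>j\<bar> \<le> int n \<and> finite F \<longrightarrow>
      \<P>(\<omega> in M. \<delta> * real n < norm (trunc_sum F n \<epsilon> j \<omega>))
        \<le> 2 * d * exp 1 * real n powr (- \<gamma>)"
    using ev1 ev2 eventually_ge_at_top[of 2]
  proof eventually_elim
    case (elim n)
    define L where "L = ln (real n)"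
    define s where "s = g * L / real n"
    have n: "2 \<le> real n" using elim by simp
    have L: "0 < L" using n by (simp add: L_def)
    have s: "0 < s" using g L n by (simp add: s_def)
    have t1: "- s * (\<delta> * real n / d) = - (\<gamma> + 1) * L"
      using n d assms by (simp add: s_def g_def field_simps)
    have t2: "s * (10 * real n * a * mtail (\<epsilon> * real n / a)) \<le> L"
    proof -
      have "s * (10 * real n * a * mtail (\<epsilon> * real n / a)) = L * (g * 10 * a * mtail (\<epsilon> * real n / a))"
        using n by (simp add: s_def)
      also have "\<dots> \<le> L * 1" using elim L by (intro mult_left_mono) auto
      finally show ?thesis by simp
    qed
    have t3: "s\<^sup>2 * exp (s * (\<epsilon> * real n)) * (10 * real n * a * ((\<epsilon> * real n) powr (1 - \<kappa>) * a powr \<kappa> * \<mu>)) \<le> 1"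
    proof -
      have "exp (s * (\<epsilon> * real n)) = real n powr (g * \<epsilon>)"
        using n by (simp add: s_def powr_def L_def mult_ac)
      also have "\<dots> \<le> real n powr (\<kappa> / 2)" using n eps by (intro powr_mono) auto
      finally have e: "exp (s * (\<epsilon> * real n)) \<le> real n powr (\<kappa> / 2)" .
      have "s\<^sup>2 * exp (s * (\<epsilon> * real n)) * (10 * real n * a * ((\<epsilon> * real n) powr (1 - \<kappa>) * a powr \<kappa> * \<mu>))
        \<le> s\<^sup>2 * real n powr (\<kappa> / 2) * (10 * real n * a * ((\<epsilon> * real n) powr (1 - \<kappa>) * a powr \<kappa> * \<mu>))"
        using e a_ge_1 mu_nonneg by (intro mult_right_mono mult_left_mono) auto
      also have "\<dots> = C * (L\<^sup>2 * (real n powr (\<kappa> / 2) * (real n * real n powr (1 - \<kappa>) / (real n)\<^sup>2)))"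
        using eps n by (simp add: s_def C_def powr_mult power_mult_distrib power_divide)
      also have "real n powr (\<kappa> / 2) * (real n * real n powr (1 - \<kappa>) / (real n)\<^sup>2) = real n powr (- (\<kappa> / 2))"
      proof -
        have "real n * real n powr (1 - \<kappa>) / (real n)\<^sup>2 = real n powr (- \<kappa>)"
          using n by (simp add: powr_diff powr_minus field_simps power2_eq_square)
        thus ?thesis by (simp flip: powr_add)
      qed
      finally show ?thesis using elim by (simp add: L_def)
    qed
    have ex: "exp (- (\<gamma> + 1) * L + L + 1) = exp 1 * real n powr (- \<gamma>)"
    proof -
      have "- (\<gamma> + 1) * L + L + 1 = 1 + - \<gamma> * L" by (simp add: algebra_simps)
      thus ?thesis using n by (simp only: exp_add powr_def L_def) simp
    qed
    show ?case
    proof (intro allI impI, elim conjE)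
      fix j :: int and F :: "int set" assume jF: "\<bar>j\<bar> \<le> int n" "finite F"
      have "\<P>(\<omega> in M. \<delta> * real n < norm (trunc_sum F n \<epsilon> j \<omega>))
        \<le> 2 * d * exp (- s * (\<delta> * real n / d)
        + s * (10 * real n * a * mtail (\<epsilon> * real n / a))
        + s\<^sup>2 * exp (s * (\<epsilon> * real n)) * (10 * real n * a * ((\<epsilon> * real n) powr (1 - \<kappa>) * a powr \<kappa> * \<mu>)))"
        unfolding d_def using elim by (intro truncated_sum_chernoff jF eps(1) s) auto
      also have "\<dots> \<le> 2 * d * exp (- (\<gamma> + 1) * L + L + 1)"
        using t1 t2 t3 d by (intro mult_left_mono iffD2[OF exp_le_cancel_iff]) auto
      also have "\<dots> = 2 * d * exp 1 * real n powr (- \<gamma>)" by (simp only: ex mult.assoc)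
      finally show "\<P>(\<omega> in M. \<delta> * real n < norm (trunc_sum F n \<epsilon> j \<omega>))
        \<le> 2 * d * exp 1 * real n powr (- \<gamma>)" .
    qed
  qed
  thus ?thesis using that[OF eps(1,2)] by (simp add: d_def)
qed

section \<open>Measurability and truncation of the infinite series\<close>

text \<open>The set \<open>S\<close> of absolute convergence is measurable, and the partial sums
  over symmetric windows, set to 0 off \<open>S\<close>, converge everywhere. Off \<open>S\<close>
  their limit agrees with \<open>lin_proc\<close> because \<open>infsum\<close> is 0 on families
  that are not summable.\<close>

lemma lin_proc_measurable [measurable]: "lin_proc A Z k \<in> borel_measurable M"
proof -
  define f where "f \<omega> i = A i *v Z (k - i) \<omega>" for \<omega> i
  have fm [measurable]: "(\<lambda>\<omega>. f \<omega> i) \<in> borel_measurable M" for i unfolding f_def by measurable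
  define S where "S = {\<omega>\<in>space M. \<exists>B::nat. \<forall>N::nat. (\<Sum>i\<in>{- int N..int N}. norm (f \<omega> i)) \<le> real B}"
  have Sm [measurable]: "S \<in> sets M" unfolding S_def by measurable
  have S: "\<omega> \<in> S \<longleftrightarrow> f \<omega> summable_on UNIV" if "\<omega> \<in> space M" for \<omega>
    using that by (simp add: S_def summable_on_vec_iff_norm summable_on_int_iff_bounded)
  define u where "u N \<omega> = (if \<omega> \<in> S then \<Sum>i\<in>{- int N..int N}. f \<omega> i else 0)" for N \<omega>
  show ?thesis
  proof (rule borel_measurable_LIMSEQ_metric)
    show "u N \<in> borel_measurable M" for N unfolding u_def by measurable
    fix \<omega> assume w: "\<omega> \<in> space M"
    show "(\<lambda>N. u N \<omega>) \<longlonglongrightarrow> lin_proc A Z k \<omega>"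
    proof (cases "\<omega> \<in> S")
      case True
      hence "(f \<omega> has_sum lin_proc A Z k \<omega>) UNIV"
        using S[OF w] unfolding lin_proc_def f_def by (intro has_sum_infsum) auto
      hence "(sum (f \<omega>) \<longlongrightarrow> lin_proc A Z k \<omega>) (finite_subsets_at_top UNIV)" by (simp add: has_sum_def)
      from filterlim_compose[OF this filterlim_int_window] show ?thesis using True by (simp add: u_def)
    next
      case False
      hence "\<not> f \<omega> summable_on UNIV" using S[OF w] by simp
      hence "lin_proc A Z k \<omega> = 0" unfolding lin_proc_def f_def by (rule infsum_not_exists)
      thus ?thesis using False by (simp add: u_def)
    qed
  qed
qed

lemma block_sum_measurable [measurable]: "block_sum A Z n j \<in> borel_measurable M"
  unfolding block_sum_def by measurable

text \<open>Padding by zeros lets the sums below run over the whole enumeration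
  \<open>int_decode\<close> of the integers. A series in \<open>ennreal\<close> over the naturals is
  measurable and may be integrated term by term.\<close>

definition wA :: "nat \<Rightarrow> int \<Rightarrow> real" where "wA l i = (if int l < \<bar>i\<bar> then nA i else 0)"

lemma wA_nonneg: "0 \<le> wA l i" by (simp add: wA_def nA_nonneg)

text \<open>An upper bound, uniform in \<open>\<bar>j\<bar> \<le> n\<close>, for the contribution to \<open>block_sum A Z n j\<close> of the \<open>Z m\<close>
  with \<open>m\<close> far outside the window.\<close>

definition remainder :: "nat \<Rightarrow> nat \<Rightarrow> 'a \<Rightarrow> ennreal" where
  "remainder n l \<omega> = (\<Sum>k\<in>{- int n..2 * int n - 1}.
     \<Sum>p. ennreal (wA l (int_decode p) * norm (Z (k - int_decode p) \<omega>)))"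

lemma remainder_measurable [measurable]: "remainder n l \<in> borel_measurable M"
  unfolding remainder_def by measurable

lemma suminf_wA_le: "(\<Sum>p. ennreal (wA l (int_decode p))) \<le> ennreal (\<tau> l)"
proof -
  have "(\<Sum>p<N. ennreal (wA l (int_decode p))) \<le> ennreal (\<tau> l)" for N
  proof -
    have "(\<Sum>p<N. wA l (int_decode p)) = (\<Sum>i\<in>int_decode ` {..<N}. wA l i)"
      by (subst sum.reindex) (auto simp: inj_int_decode)
    also have "\<dots> = (\<Sum>i\<in>int_decode ` {..<N} \<inter> {i. int l < \<bar>i\<bar>}. nA i)"
      by (simp add: wA_def sum.inter_restrict)
    also have "\<dots> \<le> \<tau> l" unfolding \<tau>_def by (intro sum_nA_le_infsum) auto
    finally have "(\<Sum>p<N. wA l (int_decode p)) \<le> \<tau> l" .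
    thus ?thesis by (simp add: sum_ennreal wA_nonneg ennreal_leI)
  qed
  thus ?thesis unfolding suminf_eq_SUP by (rule SUP_least)
qed

text \<open>Term by term integration with identically distributed variables; the factor 3n counts
  the indices k that occur in some block with |j| \<le> n.\<close>

lemma nn_integral_remainder_le:
  "(\<integral>\<^sup>+\<omega>. remainder n l \<omega> \<partial>M) \<le> ennreal (3 * real n * \<tau> l * expectation (\<lambda>\<omega>. norm (Z 0 \<omega>)))"
proof -
  define e where "e = expectation (\<lambda>\<omega>. norm (Z 0 \<omega>))"
  have e0: "0 \<le> e" unfolding e_def by simp
  have nnZ: "(\<integral>\<^sup>+\<omega>. ennreal (norm (Z m \<omega>)) \<partial>M) = ennreal e" for m
  proof -
    have "integrable M (\<lambda>\<omega>. norm (Z m \<omega>))"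
      using expectation_Z(2)[of norm m] Z_integrable by simp
    hence "(\<integral>\<^sup>+\<omega>. ennreal (norm (Z m \<omega>)) \<partial>M) = ennreal (expectation (\<lambda>\<omega>. norm (Z m \<omega>)))"
      by (rule nn_integral_eq_integral) auto
    thus ?thesis using expectation_Z(1)[of norm m] by (simp add: e_def)
  qed
  have "(\<integral>\<^sup>+\<omega>. remainder n l \<omega> \<partial>M)
    = (\<Sum>k\<in>{- int n..2 * int n - 1}. \<Sum>p. \<integral>\<^sup>+\<omega>. ennreal (wA l (int_decode p) * norm (Z (k - int_decode p) \<omega>)) \<partial>M)"
    unfolding remainder_def by (subst nn_integral_sum) (auto simp: nn_integral_suminf)
  also have "\<dots> = (\<Sum>k\<in>{- int n..2 * int n - 1}. (\<Sum>p. ennreal (wA l (int_decode p))) * ennreal e)"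
  proof (intro sum.cong refl)
    fix k
    have "(\<integral>\<^sup>+\<omega>. ennreal (wA l (int_decode p) * norm (Z (k - int_decode p) \<omega>)) \<partial>M)
        = ennreal (wA l (int_decode p)) * ennreal e" for p
      by (simp add: ennreal_mult' wA_nonneg nn_integral_cmult nnZ)
    thus "(\<Sum>p. \<integral>\<^sup>+\<omega>. ennreal (wA l (int_decode p) * norm (Z (k - int_decode p) \<omega>)) \<partial>M)
        = (\<Sum>p. ennreal (wA l (int_decode p))) * ennreal e" by simp
  qed
  also have "\<dots> \<le> (\<Sum>k\<in>{- int n..2 * int n - 1}. ennreal (\<tau> l) * ennreal e)"
    by (intro sum_mono mult_right_mono suminf_wA_le) auto
  also have "\<dots> = ennreal (3 * real n * \<tau> l * e)"
    using tau_nonneg e0 by (simp add: ennreal_mult[symmetric] ennreal_of_nat_eq_real_of_nat mult_ac nat_mult_distrib)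
  finally show ?thesis by (simp add: e_def)
qed

text \<open>Markov's inequality. No factor \<open>tail n\<close> appears on the right; it is gained
  later by taking l large depending on n.\<close>

lemma prob_remainder_le:
  assumes "0 < c"
  shows "\<P>(\<omega> in M. ennreal c < remainder n l \<omega>) \<le> 3 * real n * \<tau> l * expectation (\<lambda>\<omega>. norm (Z 0 \<omega>)) / c"
proof -
  define R where "R = 3 * real n * \<tau> l * expectation (\<lambda>\<omega>. norm (Z 0 \<omega>))"
  have R: "0 \<le> R" unfolding R_def using tau_nonneg by simp
  have "ennreal c * emeasure M {\<omega>\<in>space M. ennreal c < remainder n l \<omega>}
      = (\<integral>\<^sup>+\<omega>. ennreal c * indicator {\<omega>\<in>space M. ennreal c < remainder n l \<omega>} \<omega> \<partial>M)"
    by (subst nn_integral_cmult_indicator) auto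
  also have "\<dots> \<le> (\<integral>\<^sup>+\<omega>. remainder n l \<omega> \<partial>M)"
    by (intro nn_integral_mono) (auto simp: indicator_def)
  also have "\<dots> \<le> ennreal R" unfolding R_def by (rule nn_integral_remainder_le)
  finally have "c * \<P>(\<omega> in M. ennreal c < remainder n l \<omega>) \<le> R"
    using assms R by (simp add: emeasure_eq_measure ennreal_mult[symmetric] ennreal_le_iff)
  thus ?thesis using assms unfolding R_def[symmetric] by (simp add: field_simps)
qed

text \<open>Contains every k - i with k in {-n, ..., 2n - 1} and |i| \<le> l, so every variable left
  out enters the blocks only through lags beyond l.\<close>

definition Fw :: "nat \<Rightarrow> nat \<Rightarrow> int set" where "Fw n l = {- (2 * int n + int l)..2 * int n + int l}"

lemma finite_Fw [simp]: "finite (Fw n l)" by (simp add: Fw_def)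

text \<open>A pointwise statement: a finite remainder at \<omega> already implies absolute
  convergence of the series at that point, so no exceptional null set has to be carried
  along.\<close>

lemma block_sum_approx:
  assumes "remainder n l \<omega> \<le> ennreal c" "0 \<le> c" "\<bar>j\<bar> \<le> int n"
  shows "norm (block_sum A Z n j \<omega> - (\<Sum>m\<in>Fw n l. cf n j m *v Z m \<omega>)) \<le> c"
proof -
  define K where "K = {- int n..2 * int n - 1}"
  define J where "J = {j..j + int n - 1}"
  have JK: "J \<subseteq> K" using assms(3) by (auto simp: J_def K_def)
  have fin: "finite J" "finite K" by (auto simp: J_def K_def)
  define R where "R k = (\<Sum>p. ennreal (wA l (int_decode p) * norm (Z (k - int_decode p) \<omega>)))" for k
  have Rsum: "(\<Sum>k\<in>J. R k) \<le> ennreal c"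
  proof -
    have "(\<Sum>k\<in>J. R k) \<le> (\<Sum>k\<in>K. R k)" using JK fin by (intro sum_mono2) auto
    thus ?thesis using assms(1) by (simp add: remainder_def R_def K_def)
  qed
  have Rfin: "R k < \<infinity>" if "k \<in> J" for k
  proof -
    have "R k \<le> (\<Sum>k\<in>J. R k)" using that fin by (intro member_le_sum) auto
    also have "\<dots> < \<infinity>" using Rsum by (auto intro: le_less_trans)
    finally show ?thesis .
  qed
  have key: "norm (lin_proc A Z k \<omega> - (\<Sum>m\<in>Fw n l. A (k - m) *v Z m \<omega>)) \<le> enn2real (R k)" if k: "k \<in> J" for k
  proof -
    define r where "r = enn2real (R k)"
    have r: "R k = ennreal r" using Rfin[OF k] by (simp add: r_def)
    define S where "S = (\<lambda>m. k - m) ` Fw n l"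
    have S: "finite S" by (simp add: S_def)
    have far: "int l < \<bar>i\<bar>" if "i \<notin> S" for i
    proof (rule ccontr)
      assume "\<not> ?thesis"
      hence "k - i \<in> Fw n l" using k JK by (force simp: Fw_def K_def)
      hence "i \<in> S" unfolding S_def by (rule rev_image_eqI) simp
      thus False using that by simp
    qed
    have part: "(\<Sum>i\<in>G. norm (A i *v Z (k - i) \<omega>)) \<le> r" if G: "finite G" "G \<subseteq> - S" for G
    proof -
      have "ennreal (\<Sum>i\<in>G. norm (A i *v Z (k - i) \<omega>)) \<le> ennreal (\<Sum>i\<in>G. wA l i * norm (Z (k - i) \<omega>))"
        using G far by (intro ennreal_leI sum_mono) (auto simp: wA_def norm_A_mult)
      also have "\<dots> = (\<Sum>i\<in>G. ennreal (wA l i * norm (Z (k - i) \<omega>)))"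
        by (simp add: sum_ennreal wA_nonneg)
      also have "\<dots> = (\<Sum>p\<in>int_encode ` G. ennreal (wA l (int_decode p) * norm (Z (k - int_decode p) \<omega>)))"
        by (subst sum.reindex) (auto simp: inj_int_encode)
      also have "\<dots> \<le> R k" unfolding R_def using G by (intro sum_le_suminf) auto
      finally show ?thesis unfolding r by (subst (asm) ennreal_le_iff) (simp_all add: r_def)
    qed
    \<comment> \<open>Finite sums outside \<open>S\<close> are bounded by the remainder, which gives
      the summability needed to split the series.\<close>
    have abs: "(\<lambda>i. norm (A i *v Z (k - i) \<omega>)) summable_on - S"
      by (rule nonneg_bdd_above_summable_on) (auto intro!: bdd_aboveI2[where M=r] part)
    have "lin_proc A Z k \<omega> = infsum (\<lambda>i. A i *v Z (k - i) \<omega>) (S \<union> - S)"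
      by (simp add: lin_proc_def)
    also have "\<dots> = infsum (\<lambda>i. A i *v Z (k - i) \<omega>) S + infsum (\<lambda>i. A i *v Z (k - i) \<omega>) (- S)"
      by (rule infsum_Un_disjoint[OF summable_on_finite[OF S] abs_summable_summable[OF abs]]) simp
    also have "infsum (\<lambda>i. A i *v Z (k - i) \<omega>) S = (\<Sum>m\<in>Fw n l. A (k - m) *v Z m \<omega>)"
    proof -
      have "infsum (\<lambda>i. A i *v Z (k - i) \<omega>) S = (\<Sum>i\<in>S. A i *v Z (k - i) \<omega>)" using S by simp
      also have "\<dots> = (\<Sum>m\<in>Fw n l. A (k - m) *v Z (k - (k - m)) \<omega>)"
        unfolding S_def by (subst sum.reindex[OF inj_on_int_shift(2)]) (simp add: o_def)
      finally show ?thesis by simp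
    qed
    finally have "norm (lin_proc A Z k \<omega> - (\<Sum>m\<in>Fw n l. A (k - m) *v Z m \<omega>))
        = norm (infsum (\<lambda>i. A i *v Z (k - i) \<omega>) (- S))" by simp
    also have "\<dots> \<le> infsum (\<lambda>i. norm (A i *v Z (k - i) \<omega>)) (- S)" by (rule norm_infsum_bound[OF abs])
    also have "\<dots> \<le> r" using abs part by (intro infsum_le_finite_sums) auto
    finally show ?thesis by (simp add: r_def)
  qed
  have "(\<Sum>m\<in>Fw n l. cf n j m *v Z m \<omega>) = (\<Sum>m\<in>Fw n l. \<Sum>k\<in>J. A (k - m) *v Z m \<omega>)"
  proof (intro sum.cong refl)
    fix m
    show "cf n j m *v Z m \<omega> = (\<Sum>k\<in>J. A (k - m) *v Z m \<omega>)"
      unfolding cf_def J_def by (induction rule: infinite_finite_induct) (auto simp: matrix_vector_mult_add_rdistrib)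
  qed
  also have "\<dots> = (\<Sum>k\<in>J. \<Sum>m\<in>Fw n l. A (k - m) *v Z m \<omega>)" by (rule sum.swap)
  finally have "block_sum A Z n j \<omega> - (\<Sum>m\<in>Fw n l. cf n j m *v Z m \<omega>)
      = (\<Sum>k\<in>J. lin_proc A Z k \<omega> - (\<Sum>m\<in>Fw n l. A (k - m) *v Z m \<omega>))"
    by (simp add: block_sum_def J_def sum_subtractf)
  also have "norm \<dots> \<le> (\<Sum>k\<in>J. enn2real (R k))" by (intro order_trans[OF norm_sum] sum_mono key)
  also have "\<dots> = enn2real (\<Sum>k\<in>J. R k)" using Rfin by (simp add: enn2real_sum)
  also have "\<dots> \<le> c" using Rsum assms(2) by (simp add: enn2real_leI)
  finally show ?thesis .
qed

section \<open>Exits and the single big jump\<close>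

abbreviation big :: "nat \<Rightarrow> real \<Rightarrow> int \<Rightarrow> 'a \<Rightarrow> bool" where
  "big n \<epsilon> m \<omega> \<equiv> \<epsilon> * real n < D n m * norm (Z m \<omega>)"

abbreviation hits :: "(real^'d) set \<Rightarrow> nat \<Rightarrow> 'a \<Rightarrow> bool" where
  "hits \<Gamma> n \<omega> \<equiv> block_sum A Z n 0 \<omega> \<in> (\<lambda>y. real n *\<^sub>R y) ` \<Gamma>"

definition window :: "nat \<Rightarrow> int set" where "window n = {- 3 * int n..3 * int n}"

definition exits :: "(real^'d) set \<Rightarrow> nat \<Rightarrow> 'a \<Rightarrow> ereal \<times> ereal" where
  "exits \<Psi> n \<omega> = (J_plus A Z \<Psi> n \<omega> / ereal (real n), - J_minus A Z \<Psi> n \<omega> / ereal (real n))"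

text \<open>The idealised value of S_j / n when the only large variable is \<open>Z m\<close> and it
  lies well inside the block.\<close>

definition limit_jump :: "nat \<Rightarrow> int \<Rightarrow> 'a \<Rightarrow> real^'d" where
  "limit_jump n m \<omega> = (1 / real n) *\<^sub>R (\<A> *v Z m \<omega>)"

text \<open>The value that the test function times the conditioning indicator would take if
  \<open>Z m\<close> were the only jump and all approximations were exact. The pair (0, 0) belongs
  to a jump into \<Gamma> but not into \<Psi>, where the sums exit at once on both sides.\<close>

definition single_jump_value ::
  "(real^'d) set \<Rightarrow> (real^'d) set \<Rightarrow> (ereal \<times> ereal \<Rightarrow> real) \<Rightarrow> nat \<Rightarrow> int \<Rightarrow> 'a \<Rightarrow> real" where
  "single_jump_value \<Gamma> \<Psi> f n m \<omega> = (if limit_jump n m \<omega> \<in> \<Gamma>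
     then if limit_jump n m \<omega> \<in> \<Psi> then f (ereal (real_of_int m / real n), ereal (1 - real_of_int m / real n)) else f (0, 0)
     else 0)"

lemma norm_\<A>_le: "norm (\<A> *v x) \<le> a * norm x"
proof -
  have nsum: "(\<lambda>i. nA i * norm x) summable_on UNIV"
    by (intro summable_on_cmult_left nA_summable)
  have abs: "(\<lambda>i. norm (A i *v x)) summable_on UNIV"
    by (rule summable_on_comparison_test[OF nsum]) (auto simp: norm_A_mult)
  have "\<A> *v x = (\<Sum>\<^sub>\<infinity>i. A i *v x)" by (rule infsumI[OF A_mult_has_sum, symmetric])
  hence "norm (\<A> *v x) \<le> (\<Sum>\<^sub>\<infinity>i. norm (A i *v x))" by (simp add: norm_infsum_bound[OF abs])
  also have "\<dots> \<le> (\<Sum>\<^sub>\<infinity>i. nA i * norm x)" by (rule infsum_mono[OF abs nsum norm_A_mult])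
  also have "\<dots> = infsum nA UNIV * norm x" by (rule infsum_cmult_left')
  also have "\<dots> \<le> a * norm x" by (intro mult_right_mono) (auto simp: a_def)
  finally show ?thesis .
qed

lemma D_window: "m \<in> window n \<Longrightarrow> D n m = a"
  by (auto simp: window_def D_def)

text \<open>For \<epsilon> at most the distance of \<Gamma> from the origin, this confines nonzero
  values of \<open>single_jump_value\<close> to big jumps.\<close>

lemma norm_limit_jump_le:
  assumes "m \<in> window n" "\<not> big n \<epsilon> m \<omega>" "1 \<le> n"
  shows "norm (limit_jump n m \<omega>) \<le> \<epsilon>"
proof -
  have "norm (\<A> *v Z m \<omega>) \<le> \<epsilon> * real n"
    using norm_\<A>_le[of "Z m \<omega>"] assms(1,2) D_window by simp
  thus ?thesis using assms(3) by (simp add: limit_jump_def field_simps)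
qed

lemma block_sum_single_big:
  assumes rem: "remainder n l \<omega> \<le> ennreal (\<delta> * real n)" and d: "0 \<le> \<delta>" and j: "\<bar>j\<bar> \<le> int n"
    and trunc: "norm (trunc_sum (Fw n l) n \<epsilon> j \<omega>) \<le> \<delta> * real n"
    and far: "\<And>m. m \<in> Fw n l \<Longrightarrow> m \<noteq> m0 \<Longrightarrow> \<not> big n \<epsilon> m \<omega>" and m0: "m0 \<in> Fw n l" "big n \<epsilon> m0 \<omega>"
  shows "norm (block_sum A Z n j \<omega> - cf n j m0 *v Z m0 \<omega>) \<le> 2 * \<delta> * real n"
proof -
  have "(\<Sum>m\<in>Fw n l. cf n j m *v Z m \<omega>)
      = cf n j m0 *v Z m0 \<omega> + (\<Sum>m\<in>Fw n l - {m0}. cf n j m *v Z m \<omega>)"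
    using m0 by (intro sum.remove) auto
  also have "(\<Sum>m\<in>Fw n l - {m0}. cf n j m *v Z m \<omega>) = (\<Sum>m\<in>Fw n l - {m0}. cf n j m *v Y n \<epsilon> m \<omega>)"
    using far[unfolded not_less] by (intro sum.cong) (simp_all add: Y_def)
  \<comment> \<open>The truncation of the big variable is 0, so the index \<open>m0\<close> may be
    put back and the bound for the full truncated sum applies.\<close>
  also have "\<dots> = trunc_sum (Fw n l) n \<epsilon> j \<omega>"
    using m0 by (subst (2) sum.remove[of _ m0]) (auto simp: Y_def)
  finally have eq: "(\<Sum>m\<in>Fw n l. cf n j m *v Z m \<omega>)
      = cf n j m0 *v Z m0 \<omega> + trunc_sum (Fw n l) n \<epsilon> j \<omega>" .
  have app: "norm (block_sum A Z n j \<omega> - (\<Sum>m\<in>Fw n l. cf n j m *v Z m \<omega>)) \<le> \<delta> * real n"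
    using d by (intro block_sum_approx[OF rem _ j]) auto
  have split: "block_sum A Z n j \<omega> - cf n j m0 *v Z m0 \<omega>
      = (block_sum A Z n j \<omega> - (\<Sum>m\<in>Fw n l. cf n j m *v Z m \<omega>)) + trunc_sum (Fw n l) n \<epsilon> j \<omega>"
    by (simp add: eq)
  show ?thesis unfolding split using app trunc norm_triangle_ineq[of "block_sum A Z n j \<omega> - (\<Sum>m\<in>Fw n l. cf n j m *v Z m \<omega>)"
      "trunc_sum (Fw n l) n \<epsilon> j \<omega>"] by linarith
qed

lemma block_sum_no_big:
  assumes rem: "remainder n l \<omega> \<le> ennreal (\<delta> * real n)" and d: "0 \<le> \<delta>" and j: "\<bar>j\<bar> \<le> int n"
    and trunc: "norm (trunc_sum (Fw n l) n \<epsilon> j \<omega>) \<le> \<delta> * real n"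
    and far: "\<And>m. m \<in> Fw n l \<Longrightarrow> \<not> big n \<epsilon> m \<omega>"
  shows "norm (block_sum A Z n j \<omega>) \<le> 2 * \<delta> * real n"
proof -
  have eq: "(\<Sum>m\<in>Fw n l. cf n j m *v Z m \<omega>) = trunc_sum (Fw n l) n \<epsilon> j \<omega>"
    using far[unfolded not_less] by (intro sum.cong) (simp_all add: Y_def)
  have "norm (block_sum A Z n j \<omega> - (\<Sum>m\<in>Fw n l. cf n j m *v Z m \<omega>)) \<le> \<delta> * real n"
    using d by (intro block_sum_approx[OF rem _ j]) auto
  thus ?thesis using trunc eq norm_triangle_sub[of "block_sum A Z n j \<omega>" "trunc_sum (Fw n l) n \<epsilon> j \<omega>"]
    by simp
qed

text \<open>The lower bound on the norm keeps the set away from the origin for every radius r, so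
  its mass is finite even before r is small.\<close>

definition near_boundary :: "real \<Rightarrow> real \<Rightarrow> (real^'d) set \<Rightarrow> (real^'d) set" where
  "near_boundary \<delta>\<^sub>0 r G = {x. \<delta>\<^sub>0 / 2 \<le> norm x \<and> (\<exists>z\<in>frontier G. dist x z \<le> r)}"

text \<open>Points of norm below half of \<open>\<delta>\<^sub>0\<close>, together with all points
  within r of them, are outside \<open>G\<close> anyway; elsewhere the distance to the frontier
  decides.\<close>

lemma mem_iff_outside_near_boundary:
  assumes "x \<notin> near_boundary \<delta>\<^sub>0 r G" "dist x y \<le> r" "2 * r \<le> \<delta>\<^sub>0" "G \<subseteq> {y. \<delta>\<^sub>0 < norm y}" "0 < \<delta>\<^sub>0"
  shows "x \<in> G \<longleftrightarrow> y \<in> G"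
proof (cases "\<delta>\<^sub>0 / 2 \<le> norm x")
  case True
  show ?thesis
    by (rule mem_iff_of_far_from_frontier[OF _ assms(2)]) (use assms(1) True in \<open>auto simp: near_boundary_def not_le[symmetric]\<close>)
next
  case False
  have "norm y \<le> norm x + dist x y" by (metis dist_commute dist_norm norm_triangle_sub)
  hence "norm y < \<delta>\<^sub>0" using False assms(2,3) by linarith
  thus ?thesis using False assms(4,5) by auto
qed

text \<open>The deterministic core, with the good event spelled out as hypotheses. Rescaled sums
  deviate from their ideal values by at most 3\<delta>: one \<delta> each from the remainder, the
  truncated part and the weight of the big jump. The count on the right makes the error 0 without a
  big jump, so that its expectation is of order \<open>n * tail n\<close>.\<close>

lemma exits_comparison:
  fixes f :: "ereal \<times> ereal \<Rightarrow> real"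
  assumes n: "1 \<le> n" and l: "n \<le> l" and d: "0 < \<delta>" "6 * \<delta> \<le> \<delta>\<^sub>0" and eps: "\<epsilon> \<le> \<delta>\<^sub>0"
    and G: "\<Gamma> \<subseteq> {y. \<delta>\<^sub>0 < norm y}" and P: "\<Psi> \<subseteq> {y. \<delta>\<^sub>0 < norm y}"
    and rem: "remainder n l \<omega> \<le> ennreal (\<delta> * real n)"
    and trunc: "\<And>j. \<bar>j\<bar> \<le> int n \<Longrightarrow> norm (trunc_sum (Fw n l) n \<epsilon> j \<omega>) \<le> \<delta> * real n"
    and far: "\<And>m. m \<in> Fw n l - window n \<Longrightarrow> \<not> big n \<epsilon> m \<omega>"
    and tau: "\<And>m. m \<in> window n \<Longrightarrow> \<tau> h * norm (Z m \<omega>) \<le> \<delta> * real n"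
    and edge: "\<And>m. m \<in> {- int h..int h} \<union> {int n - 1 - int h..int n + int h} \<Longrightarrow> \<not> big n \<epsilon> m \<omega>"
    and bnd: "\<And>m. m \<in> {0..int n - 1} \<Longrightarrow> limit_jump n m \<omega> \<notin> near_boundary \<delta>\<^sub>0 (3 * \<delta>) \<Gamma> \<union> near_boundary \<delta>\<^sub>0 (3 * \<delta>) \<Psi>"
    and pairs: "\<And>m m'. m \<in> window n \<Longrightarrow> m' \<in> window n \<Longrightarrow> big n \<epsilon> m \<omega> \<Longrightarrow> big n \<epsilon> m' \<omega> \<Longrightarrow> m = m'"
    and osc: "\<And>m x y. m \<in> {0..int n - 1} \<Longrightarrow> \<bar>x - real_of_int m / real n\<bar> \<le> (real h + 1) / real n \<Longrightarrow>
        \<bar>y - (1 - real_of_int m / real n)\<bar> \<le> (real h + 1) / real n \<Longrightarrow>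
        \<bar>f (ereal x, ereal y) - f (ereal (real_of_int m / real n), ereal (1 - real_of_int m / real n))\<bar> \<le> \<theta>"
    and osc0: "\<bar>f (0, ereal (1 / real n)) - f (0, 0)\<bar> \<le> \<theta>"
  shows "\<bar>f (exits \<Psi> n \<omega>) * of_bool (hits \<Gamma> n \<omega>)
      - (\<Sum>m\<in>{0..int n - 1}. single_jump_value \<Gamma> \<Psi> f n m \<omega>)\<bar>
    \<le> \<theta> * real (card {m\<in>window n. big n \<epsilon> m \<omega>})"
proof -
  have npos: "0 < real n" using n by simp
  have \<delta>0: "0 < \<delta>\<^sub>0" using d by linarith
  have sub: "window n \<subseteq> Fw n l" "{0..int n - 1} \<subseteq> window n" using l by (auto simp: window_def Fw_def)
  have finW: "finite (window n)" by (simp add: window_def)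
  define T where "T j = (1 / real n) *\<^sub>R block_sum A Z n j \<omega>" for j
  have mem: "block_sum A Z n j \<omega> \<in> (\<lambda>y. real n *\<^sub>R y) ` H \<longleftrightarrow> T j \<in> H" for j H
    unfolding T_def using npos by (intro mem_scaleR_image_iff) simp
  have norm_T: "norm (T j) \<le> c" if "norm (block_sum A Z n j \<omega>) \<le> c * real n" for j c
    using that npos by (simp add: T_def field_simps)
  have F0: "single_jump_value \<Gamma> \<Psi> f n m \<omega> = 0" if "m \<in> window n" "\<not> big n \<epsilon> m \<omega>" for m
  proof -
    have "limit_jump n m \<omega> \<notin> \<Gamma>" using norm_limit_jump_le[OF that n] eps G by auto
    thus ?thesis by (simp add: single_jump_value_def)
  qed
  show ?thesis
  proof (cases "\<exists>m0\<in>window n. big n \<epsilon> m0 \<omega>")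
    case False
    hence "\<not> big n \<epsilon> m \<omega>" if "m \<in> Fw n l" for m using that far by blast
    hence "norm (block_sum A Z n 0 \<omega>) \<le> 2 * \<delta> * real n"
      using d by (intro block_sum_no_big[OF rem _ _ trunc]) auto
    hence "T 0 \<notin> \<Gamma>" using norm_T[of 0 "2 * \<delta>"] G d by auto
    moreover have "(\<Sum>m\<in>{0..int n - 1}. single_jump_value \<Gamma> \<Psi> f n m \<omega>) = 0"
      using False sub by (intro sum.neutral ballI F0) blast+
    moreover have "0 \<le> \<theta>" using osc0 by linarith
    ultimately show ?thesis by (simp add: mem)
  next
    case True
    then obtain m0 where m0: "m0 \<in> window n" "big n \<epsilon> m0 \<omega>" by blast
    have others: "\<not> big n \<epsilon> m \<omega>" if "m \<in> Fw n l" "m \<noteq> m0" for m using that far pairs m0 by blast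
    have "{m\<in>window n. big n \<epsilon> m \<omega>} = {m0}" using m0 pairs by blast
    hence card1: "card {m\<in>window n. big n \<epsilon> m \<omega>} = 1" by simp
    have approx: "norm (block_sum A Z n j \<omega> - cf n j m0 *v Z m0 \<omega>) \<le> 2 * \<delta> * real n" if "\<bar>j\<bar> \<le> int n" for j
      using that d sub m0 others by (intro block_sum_single_big[OF rem _ that trunc[OF that]]) auto
    have outer: "norm (T j) \<le> 3 * \<delta>" if "\<bar>j\<bar> \<le> int n" "m0 - j < - int h \<or> int n + int h \<le> m0 - j" for j
    proof (rule norm_T)
      have "norm (cf n j m0 *v Z m0 \<omega>) \<le> \<delta> * real n"
        using norm_cf_outer[OF that(2), of "Z m0 \<omega>"] tau[OF m0(1)] by linarith
      thus "norm (block_sum A Z n j \<omega>) \<le> 3 * \<delta> * real n"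
        using approx[OF that(1)] norm_triangle_sub[of "block_sum A Z n j \<omega>" "cf n j m0 *v Z m0 \<omega>"] by linarith
    qed
    have inner: "dist (limit_jump n m0 \<omega>) (T j) \<le> 3 * \<delta>"
      if "\<bar>j\<bar> \<le> int n" "int h \<le> m0 - j" "m0 - j \<le> int n - 1 - int h" for j
    proof -
      have "norm (cf n j m0 *v Z m0 \<omega> - \<A> *v Z m0 \<omega>) \<le> \<delta> * real n"
        using norm_cf_inner[OF that(2,3), of "Z m0 \<omega>"] tau[OF m0(1)] by linarith
      hence "norm (block_sum A Z n j \<omega> - \<A> *v Z m0 \<omega>) \<le> 3 * \<delta> * real n"
        using approx[OF that(1)] norm_triangle_ineq[of "block_sum A Z n j \<omega> - cf n j m0 *v Z m0 \<omega>"
            "cf n j m0 *v Z m0 \<omega> - \<A> *v Z m0 \<omega>"] by simp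
      moreover have "dist (limit_jump n m0 \<omega>) (T j) = (1 / real n) * norm (block_sum A Z n j \<omega> - \<A> *v Z m0 \<omega>)"
        by (simp add: dist_norm limit_jump_def T_def norm_minus_commute flip: scaleR_diff_right)
      ultimately have "real n * dist (limit_jump n m0 \<omega>) (T j) \<le> real n * (3 * \<delta>)"
        using npos by (simp add: mult_ac)
      thus ?thesis using npos by (simp only: mult_le_cancel_left_pos)
    qed
    have outside: "T j \<notin> \<Psi>" "T j \<notin> \<Gamma>"
      if "\<bar>j\<bar> \<le> int n" "m0 - j < - int h \<or> int n + int h \<le> m0 - j" for j
      using outer[OF that] G P d by auto
    have not_edge: "m0 \<notin> {- int h..int h}" "m0 \<notin> {int n - 1 - int h..int n + int h}"
      using edge[of m0] m0(2) by auto
    show ?thesis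
    proof (cases "m0 \<in> {0..int n - 1}")
      case False
      hence "m0 - 0 < - int h \<or> int n + int h \<le> m0 - 0" using not_edge by auto
      hence "T 0 \<notin> \<Gamma>" using outside(2)[of 0] by simp
      moreover have "(\<Sum>m\<in>{0..int n - 1}. single_jump_value \<Gamma> \<Psi> f n m \<omega>) = 0"
        using False sub others by (intro sum.neutral ballI F0) (blast | metis subsetD)+
      moreover have "0 \<le> \<theta>" using osc0 by linarith
      ultimately show ?thesis by (simp add: mem)
    next
      case True
      \<comment> \<open>The excluded edge zones push the jump more than h away from both ends, so
        the weights at j = 0 and j = -1 are close to the full sum of the matrices.\<close>
      hence bulk: "int h < m0" "m0 < int n - 1 - int h" using not_edge by auto
      let ?y = "limit_jump n m0 \<omega>"
      have "(\<Sum>m\<in>{0..int n - 1}. single_jump_value \<Gamma> \<Psi> f n m \<omega>)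
          = single_jump_value \<Gamma> \<Psi> f n m0 \<omega> + (\<Sum>m\<in>{0..int n - 1} - {m0}. single_jump_value \<Gamma> \<Psi> f n m \<omega>)"
        using True by (intro sum.remove) auto
      also have "(\<Sum>m\<in>{0..int n - 1} - {m0}. single_jump_value \<Gamma> \<Psi> f n m \<omega>) = 0"
      proof (intro sum.neutral ballI F0)
        fix m assume m: "m \<in> {0..int n - 1} - {m0}"
        thus "m \<in> window n" using sub by blast
        thus "\<not> big n \<epsilon> m \<omega>" using m sub others by blast
      qed
      finally have sum_eq: "(\<Sum>m\<in>{0..int n - 1}. single_jump_value \<Gamma> \<Psi> f n m \<omega>) = single_jump_value \<Gamma> \<Psi> f n m0 \<omega>"
        by simp
      have inG: "?y \<in> \<Gamma> \<longleftrightarrow> T j \<in> \<Gamma>" and inP: "?y \<in> \<Psi> \<longleftrightarrow> T j \<in> \<Psi>"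
        if "\<bar>j\<bar> \<le> int n" "int h \<le> m0 - j" "m0 - j \<le> int n - 1 - int h" for j
        using mem_iff_outside_near_boundary[OF _ inner[OF that] _ G \<delta>0]
          mem_iff_outside_near_boundary[OF _ inner[OF that] _ P \<delta>0] bnd[OF True] d by auto
      have B: "T 0 \<in> \<Gamma> \<longleftrightarrow> ?y \<in> \<Gamma>" using inG[of 0] bulk by auto
      have Jp: "J_plus A Z \<Psi> n \<omega> = Inf {ereal (real_of_int j) | j. 0 \<le> j \<and> T j \<notin> \<Psi>}"
        unfolding J_plus_def by (simp add: mem)
      have Jm: "J_minus A Z \<Psi> n \<omega> = Sup {ereal (real_of_int j) | j. j < 0 \<and> T j \<notin> \<Psi>}"
        unfolding J_minus_def by (simp add: mem)
      have "\<bar>f (exits \<Psi> n \<omega>) - single_jump_value \<Gamma> \<Psi> f n m0 \<omega>\<bar> \<le> \<theta>" if yG: "?y \<in> \<Gamma>"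
      proof (cases "?y \<in> \<Psi>")
        case yP: True
        \<comment> \<open>Up to j = m0 - h the block contains the jump with margin h; at j = m0 + h
          + 1 it lies beyond the jump by more than h. Both bounds are in the range |j| \<le>
          n.\<close>
        obtain x where x: "J_plus A Z \<Psi> n \<omega> = ereal x" "real_of_int (m0 - int h + 1) \<le> x" "x \<le> real_of_int (m0 + int h + 1)"
          unfolding Jp
        proof (rule Inf_ereal_int_bounds[of "m0 - int h + 1" "\<lambda>j. T j \<notin> \<Psi>" "m0 + int h + 1"])
          show "\<not> T j \<notin> \<Psi>" if "0 \<le> j" "j < m0 - int h + 1" for j
            using inP[of j] yP that bulk by auto
          show "T (m0 + int h + 1) \<notin> \<Psi>" using bulk by (intro outside) auto
        qed (use bulk in auto)
        \<comment> \<open>Going backwards, the jump keeps margin h while j > m0 - n + h and has been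
          lost by j = m0 - n - h.\<close>
        obtain x' where x': "J_minus A Z \<Psi> n \<omega> = ereal x'" "real_of_int (m0 - int n - int h) \<le> x'" "x' \<le> real_of_int (m0 - int n + int h)"
          unfolding Jm
        proof (rule Sup_ereal_int_bounds[of "m0 - int n + int h" "\<lambda>j. T j \<notin> \<Psi>" "m0 - int n - int h"])
          show "\<not> T j \<notin> \<Psi>" if "j < 0" "m0 - int n + int h < j" for j
            using inP[of j] yP that bulk by auto
          show "T (m0 - int n - int h) \<notin> \<Psi>" using bulk by (intro outside) auto
        qed (use bulk in auto)
        have V: "exits \<Psi> n \<omega> = (ereal (x / real n), ereal (- x' / real n))"
          using npos by (simp add: exits_def x(1) x'(1))
        have "\<bar>x / real n - real_of_int m0 / real n\<bar> = \<bar>x - real_of_int m0\<bar> / real n"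
          using npos by (simp flip: diff_divide_distrib add: abs_divide)
        also have "\<dots> \<le> (real h + 1) / real n"
          using x(2,3) npos by (intro divide_right_mono) auto
        finally have b1: "\<bar>x / real n - real_of_int m0 / real n\<bar> \<le> (real h + 1) / real n" .
        have "- x' / real n - (1 - real_of_int m0 / real n) = (real_of_int m0 - x' - real n) / real n"
          using npos by (simp add: field_simps)
        hence "\<bar>- x' / real n - (1 - real_of_int m0 / real n)\<bar> = \<bar>real_of_int m0 - x' - real n\<bar> / real n"
          by (simp add: abs_divide)
        also have "\<dots> \<le> (real h + 1) / real n"
          using x'(2,3) npos by (intro divide_right_mono) auto
        finally have b2: "\<bar>- x' / real n - (1 - real_of_int m0 / real n)\<bar> \<le> (real h + 1) / real n" .
        show ?thesis unfolding V using osc[OF True b1 b2] yG yP by (simp add: single_jump_value_def)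
      next
        case yP: False
        \<comment> \<open>Here j = 0 is itself an exit, and so is j = -1. The negative exit
          therefore rescales to 1 / n rather than 0, which the hypothesis \<open>osc0\<close>
          absorbs.\<close>
        obtain x where x: "J_plus A Z \<Psi> n \<omega> = ereal x" "real_of_int 0 \<le> x" "x \<le> real_of_int 0"
          unfolding Jp
        proof (rule Inf_ereal_int_bounds[of 0 "\<lambda>j. T j \<notin> \<Psi>" 0])
          show "T 0 \<notin> \<Psi>" using inP[of 0] yP bulk by auto
        qed auto
        obtain x' where x': "J_minus A Z \<Psi> n \<omega> = ereal x'" "real_of_int (-1) \<le> x'" "x' \<le> real_of_int (-1)"
          unfolding Jm
        proof (rule Sup_ereal_int_bounds[of "-1" "\<lambda>j. T j \<notin> \<Psi>" "-1"])
          show "T (-1) \<notin> \<Psi>" using inP[of "-1"] yP bulk n by auto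
        qed auto
        have "exits \<Psi> n \<omega> = (0, ereal (1 / real n))"
          using x x' npos by (simp add: exits_def zero_ereal_def)
        thus ?thesis using osc0 yG yP by (simp add: single_jump_value_def)
      qed
      moreover have "single_jump_value \<Gamma> \<Psi> f n m0 \<omega> = 0" if "?y \<notin> \<Gamma>"
        using that by (simp add: single_jump_value_def)
      moreover have "0 \<le> \<theta>" using osc0 by linarith
      ultimately show ?thesis
        unfolding sum_eq card1 mem B by (cases "?y \<in> \<Gamma>") auto
    qed
  qed
qed

section \<open>Probabilities of limit jumps and measurability of the exits\<close>

lemma limit_jump_eq: "limit_jump n m \<omega> = \<A> *v ((1 / real n) *\<^sub>R Z m \<omega>)"
  by (simp add: limit_jump_def matrix_vector_mult_scaleR)

lemma limit_jump_measurable [measurable]: "limit_jump n m \<in> borel_measurable M"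
  unfolding limit_jump_def by measurable

lemma prob_limit_jump:
  assumes "G \<in> sets borel"
  shows "\<P>(\<omega> in M. limit_jump n m \<omega> \<in> G) = \<P>(\<omega> in M. limit_jump n 0 \<omega> \<in> G)"
proof -
  have [measurable]: "(\<lambda>z. (1 / real n) *\<^sub>R (\<A> *v z)) \<in> borel_measurable borel" by measurable
  have "{z. (1 / real n) *\<^sub>R (\<A> *v z) \<in> G} \<in> sets borel" using assms by measurable
  from prob_Z[OF this, of m] show ?thesis by (simp add: limit_jump_def)
qed

lemma closed_near_boundary: "closed (near_boundary \<delta>\<^sub>0 r G)"
proof -
  have "near_boundary \<delta>\<^sub>0 r G = far (\<delta>\<^sub>0 / 2) \<inter> {x. \<exists>z\<in>frontier G. dist x z \<le> r}"
    by (auto simp: near_boundary_def far_def)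
  thus ?thesis by (simp add: closed_Int closed_far closed_near_closed_set)
qed

lemma zero_notin_closure_mat_preimage:
  assumes "0 < c" "G \<subseteq> {y. c < norm y}"
  shows "0 \<notin> closure (mat_preimage \<A> G)"
proof -
  have "closed (mat_preimage \<A> (far c))" unfolding mat_preimage_eq_vimage
    by (intro closed_vimage closed_far continuous_on_matrix_vector_mult)
  moreover have "mat_preimage \<A> G \<subseteq> mat_preimage \<A> (far c)"
    using assms(2) by (auto simp: mat_preimage_def far_def)
  ultimately have "closure (mat_preimage \<A> G) \<subseteq> mat_preimage \<A> (far c)" by (rule closure_minimal[rotated])
  moreover have "0 \<notin> mat_preimage \<A> (far c)" using assms(1) by (auto simp: mat_preimage_def far_def)
  ultimately show ?thesis by blast
qed

text \<open>The closed boundary layers of radius 1 / (k + 1), pulled back by \<open>\<A>\<close>,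
  decrease to a subset of a null frontier. Continuity from above makes one of them light, and the
  bound for closed sets transfers this to the probabilities.\<close>

lemma prob_near_boundary:
  assumes inv: "invertible \<A>" and null: "emeasure \<nu> (frontier (embE ` mat_preimage \<A> G)) = 0"
    and "0 < \<delta>\<^sub>0" "0 < \<theta>"
  obtains r where "0 < r"
    "\<forall>\<^sub>F n in sequentially. \<P>(\<omega> in M. limit_jump n 0 \<omega> \<in> near_boundary \<delta>\<^sub>0 r G) \<le> \<theta> * tail (real n)"
proof -
  define N where "N k = mat_preimage \<A> (near_boundary \<delta>\<^sub>0 (1 / (real k + 1)) G)" for k :: nat
  have clN: "closed (N k)" for k unfolding N_def mat_preimage_eq_vimage
    by (intro closed_vimage closed_near_boundary continuous_on_matrix_vector_mult)
  have z: "0 \<notin> N k" for k using assms by (auto simp: N_def mat_preimage_def near_boundary_def)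
  have dec: "decseq N"
  proof (rule decseq_SucI, rule subsetI)
    fix k x assume "x \<in> N (Suc k)"
    then obtain y where "\<delta>\<^sub>0 / 2 \<le> norm (\<A> *v x)" "y \<in> frontier G" "dist (\<A> *v x) y \<le> 1 / (real (Suc k) + 1)"
      by (auto simp: N_def mat_preimage_def near_boundary_def)
    moreover have "1 / (real (Suc k) + 1) \<le> 1 / (real k + 1)" by (intro divide_left_mono) auto
    ultimately show "x \<in> N k" by (force simp: N_def mat_preimage_def near_boundary_def)
  qed
  have int: "(\<Inter>k. N k) \<subseteq> frontier (mat_preimage \<A> G)"
  proof
    fix x assume x: "x \<in> (\<Inter>k. N k)"
    have "\<A> *v x \<in> closure (frontier G)"
      unfolding closure_approachable
    proof (intro allI impI)
      fix e :: real assume "0 < e"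
      then obtain k :: nat where k: "1 / (real k + 1) < e"
        using nat_approx_posE[of e] by (metis Suc_eq_plus1 of_nat_Suc add.commute)
      obtain y where "y \<in> frontier G" "dist (\<A> *v x) y \<le> 1 / (real k + 1)"
        using x by (auto simp: N_def mat_preimage_def near_boundary_def)
      thus "\<exists>y\<in>frontier G. dist y (\<A> *v x) < e" using k by (intro bexI[of _ y]) (auto simp: dist_commute)
    qed
    hence "x \<in> mat_preimage \<A> (frontier G)" by (simp add: mat_preimage_def)
    thus "x \<in> frontier (mat_preimage \<A> G)" by (simp only: frontier_mat_preimage[OF inv])
  qed
  have "tm (\<Inter>k. N k) = 0"
  proof -
    have "emeasure \<nu> (embE ` (\<Inter>k. N k)) \<le> emeasure \<nu> (frontier (embE ` mat_preimage \<A> G))"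
      using int embE_frontier_subset[of "mat_preimage \<A> G"] by (intro emeasure_mono) (auto simp: sets_nu)
    thus ?thesis using null by (simp add: tm_def measure_def)
  qed
  hence "(\<lambda>k. tm (N k)) \<longlonglongrightarrow> 0" using tm_decseq[OF clN z dec] by simp
  hence "\<forall>\<^sub>F k in sequentially. tm (N k) < \<theta> / 2" using assms by (intro order_tendstoD(2)) auto
  then obtain k where k: "tm (N k) < \<theta> / 2" using eventually_happens'[OF sequentially_bot] by blast
  have "\<forall>\<^sub>F u in at_top. \<P>(\<omega> in M. (1 / u) *\<^sub>R Z 0 \<omega> \<in> N k) \<le> (tm (N k) + \<theta> / 2) * tail u"
    using assms by (intro tm_limsup clN z) auto
  hence "\<forall>\<^sub>F n in sequentially. \<P>(\<omega> in M. (1 / real n) *\<^sub>R Z 0 \<omega> \<in> N k) \<le> (tm (N k) + \<theta> / 2) * tail (real n)"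
    by (rule eventually_compose_filterlim[OF _ filterlim_real_sequentially])
  hence "\<forall>\<^sub>F n in sequentially. \<P>(\<omega> in M. limit_jump n 0 \<omega> \<in> near_boundary \<delta>\<^sub>0 (1 / (real k + 1)) G) \<le> \<theta> * tail (real n)"
  proof eventually_elim
    case (elim n)
    have "(tm (N k) + \<theta> / 2) * tail (real n) \<le> \<theta> * tail (real n)"
      using k by (intro mult_right_mono tail_nonneg) auto
    thus ?case using elim by (simp add: N_def mat_preimage_def limit_jump_eq)
  qed
  thus ?thesis using that[of "1 / (real k + 1)"] by simp
qed

lemma prob_limit_jump_tendsto:
  assumes G: "G \<in> sets borel" "G \<subseteq> {y. c < norm y}" "0 < c" "tm (frontier (mat_preimage \<A> G)) = 0"
  shows "(\<lambda>n. \<P>(\<omega> in M. limit_jump n 0 \<omega> \<in> G) / tail (real n)) \<longlonglongrightarrow> tm (mat_preimage \<A> G)"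
proof -
  have pre: "mat_preimage \<A> G \<in> sets borel"
  proof -
    have "(*v) \<A> \<in> borel_measurable borel"
      by (intro borel_measurable_continuous_onI continuous_on_matrix_vector_mult)
    from measurable_sets[OF this G(1)] show ?thesis by (simp add: mat_preimage_eq_vimage)
  qed
  have "((\<lambda>u. \<P>(\<omega> in M. (1 / u) *\<^sub>R Z 0 \<omega> \<in> mat_preimage \<A> G) / tail u) \<longlongrightarrow> tm (mat_preimage \<A> G)) at_top"
    using G by (intro tm_limit pre zero_notin_closure_mat_preimage)
  from filterlim_compose[OF this filterlim_real_sequentially]
  show ?thesis by (simp add: limit_jump_eq mat_preimage_def)
qed

text \<open>Assigning infinity to indices that are not exits leaves the infimum unchanged and turns
  an infimum over a random set into a countable infimum of measurable functions.\<close>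

lemma J_plus_measurable:
  assumes "\<Psi> \<in> sets borel" "1 \<le> n"
  shows "J_plus A Z \<Psi> n \<in> borel_measurable M"
proof -
  have [measurable]: "\<Psi> \<in> sets borel" by fact
  define Q where "Q j \<omega> \<longleftrightarrow> 0 \<le> j \<and> (1 / real n) *\<^sub>R block_sum A Z n j \<omega> \<notin> \<Psi>" for j \<omega>
  have [measurable]: "Measurable.pred M (Q j)" for j unfolding Q_def by measurable
  have "J_plus A Z \<Psi> n \<omega> = (INF j. if Q j \<omega> then ereal (real_of_int j) else \<infinity>)" for \<omega>
  proof -
    have "J_plus A Z \<Psi> n \<omega> = Inf {ereal (real_of_int j) | j. Q j \<omega>}"
      unfolding J_plus_def Q_def using assms(2) by (simp add: mem_scaleR_image_iff)
    also have "\<dots> = (INF j. if Q j \<omega> then ereal (real_of_int j) else \<infinity>)"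
    proof (rule antisym)
      show "Inf {ereal (real_of_int j) | j. Q j \<omega>} \<le> (INF j. if Q j \<omega> then ereal (real_of_int j) else \<infinity>)"
        by (rule INF_greatest) (auto intro!: Inf_lower)
      show "(INF j. if Q j \<omega> then ereal (real_of_int j) else \<infinity>) \<le> Inf {ereal (real_of_int j) | j. Q j \<omega>}"
      proof (rule Inf_greatest)
        fix y assume "y \<in> {ereal (real_of_int j) | j. Q j \<omega>}"
        then obtain j where "Q j \<omega>" "y = ereal (real_of_int j)" by blast
        thus "(INF j. if Q j \<omega> then ereal (real_of_int j) else \<infinity>) \<le> y"
          using INF_lower[of j UNIV "\<lambda>j. if Q j \<omega> then ereal (real_of_int j) else \<infinity>"] by simp
      qed
    qed
    finally show ?thesis .
  qed
  moreover have "(\<lambda>\<omega>. INF j. if Q j \<omega> then ereal (real_of_int j) else \<infinity>) \<in> borel_measurable M" by measurable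
  ultimately show ?thesis by (simp cong: measurable_cong)
qed

lemma J_minus_measurable:
  assumes "\<Psi> \<in> sets borel" "1 \<le> n"
  shows "J_minus A Z \<Psi> n \<in> borel_measurable M"
proof -
  have [measurable]: "\<Psi> \<in> sets borel" by fact
  define Q where "Q j \<omega> \<longleftrightarrow> j < 0 \<and> (1 / real n) *\<^sub>R block_sum A Z n j \<omega> \<notin> \<Psi>" for j \<omega>
  have [measurable]: "Measurable.pred M (Q j)" for j unfolding Q_def by measurable
  have "J_minus A Z \<Psi> n \<omega> = (SUP j. if Q j \<omega> then ereal (real_of_int j) else - \<infinity>)" for \<omega>
  proof -
    have "J_minus A Z \<Psi> n \<omega> = Sup {ereal (real_of_int j) | j. Q j \<omega>}"
      unfolding J_minus_def Q_def using assms(2) by (simp add: mem_scaleR_image_iff)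
    also have "\<dots> = (SUP j. if Q j \<omega> then ereal (real_of_int j) else - \<infinity>)"
    proof (rule antisym)
      show "(SUP j. if Q j \<omega> then ereal (real_of_int j) else - \<infinity>) \<le> Sup {ereal (real_of_int j) | j. Q j \<omega>}"
        by (rule SUP_least) (auto intro!: Sup_upper)
      show "Sup {ereal (real_of_int j) | j. Q j \<omega>} \<le> (SUP j. if Q j \<omega> then ereal (real_of_int j) else - \<infinity>)"
      proof (rule Sup_least)
        fix y assume "y \<in> {ereal (real_of_int j) | j. Q j \<omega>}"
        then obtain j where "Q j \<omega>" "y = ereal (real_of_int j)" by blast
        thus "y \<le> (SUP j. if Q j \<omega> then ereal (real_of_int j) else - \<infinity>)"
          using SUP_upper[of j UNIV "\<lambda>j. if Q j \<omega> then ereal (real_of_int j) else - \<infinity>"] by simp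
      qed
    qed
    finally show ?thesis .
  qed
  moreover have "(\<lambda>\<omega>. SUP j. if Q j \<omega> then ereal (real_of_int j) else - \<infinity>) \<in> borel_measurable M" by measurable
  ultimately show ?thesis by (simp cong: measurable_cong)
qed

lemma exits_measurable:
  assumes "\<Psi> \<in> sets borel" "1 \<le> n" and f: "continuous_on UNIV (f :: ereal \<times> ereal \<Rightarrow> real)"
  shows "(\<lambda>\<omega>. f (exits \<Psi> n \<omega>)) \<in> borel_measurable M"
proof -
  have [measurable]: "J_plus A Z \<Psi> n \<in> borel_measurable M" "J_minus A Z \<Psi> n \<in> borel_measurable M"
    using J_plus_measurable J_minus_measurable assms by auto
  have [measurable]: "f \<in> borel_measurable borel" by (rule borel_measurable_continuous_onI[OF f])
  have "exits \<Psi> n \<in> borel_measurable M" unfolding exits_def by measurable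
  thus ?thesis by measurable
qed

section \<open>The number of big jumps\<close>

lemma prob_two_big_le:
  assumes q: "\<And>m. \<P>(\<omega> in M. big n \<epsilon> m \<omega>) \<le> q" and "m \<noteq> m'"
  shows "\<P>(\<omega> in M. big n \<epsilon> m \<omega> \<and> big n \<epsilon> m' \<omega>) \<le> q\<^sup>2"
proof -
  define B where "B i = {z::real^'d. \<epsilon> * real n < D n i * norm z}" for i
  have Bm: "B i \<in> sets borel" for i unfolding B_def by measurable
  have "prob (\<Inter>i\<in>{m, m'}. Z i -` B i \<inter> space M) = (\<Prod>i\<in>{m, m'}. prob (Z i -` B i \<inter> space M))"
    using Bm by (intro indep_varsD[OF Z_indep]) auto
  also have "\<dots> = prob (Z m -` B m \<inter> space M) * prob (Z m' -` B m' \<inter> space M)" using assms(2) by simp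
  also have "\<dots> \<le> q * q"
  proof -
    have "Z i -` B i \<inter> space M = {\<omega>\<in>space M. big n \<epsilon> i \<omega>}" for i by (auto simp: B_def)
    moreover have "0 \<le> q" using order_trans[OF measure_nonneg q] .
    ultimately show ?thesis using q by (intro mult_mono) auto
  qed
  also have "(\<Inter>i\<in>{m, m'}. Z i -` B i \<inter> space M) = {\<omega>\<in>space M. big n \<epsilon> m \<omega> \<and> big n \<epsilon> m' \<omega>}"
    by (auto simp: B_def)
  finally show ?thesis by (simp add: power2_eq_square)
qed

definition big_count :: "nat \<Rightarrow> real \<Rightarrow> 'a \<Rightarrow> real" where
  "big_count n \<epsilon> \<omega> = (\<Sum>m\<in>window n. of_bool (big n \<epsilon> m \<omega>))"

lemma finite_window [simp]: "finite (window n)" by (simp add: window_def)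

lemma card_window: "real (card (window n)) = 6 * real n + 1" by (simp add: window_def)

lemma big_count_eq_card: "big_count n \<epsilon> \<omega> = real (card {m\<in>window n. big n \<epsilon> m \<omega>})"
  unfolding big_count_def by (simp add: of_bool_def sum.If_cases Int_def)

lemma big_count_measurable [measurable]: "big_count n \<epsilon> \<in> borel_measurable M"
  unfolding big_count_def by measurable

lemma integrable_big_count: "integrable M (big_count n \<epsilon>)"
  unfolding big_count_def by (intro Bochner_Integration.integrable_sum integrable_of_bool) measurable

lemma expectation_big_count_le:
  assumes "\<And>m. \<P>(\<omega> in M. big n \<epsilon> m \<omega>) \<le> q"
  shows "expectation (big_count n \<epsilon>) \<le> (6 * real n + 1) * q"
proof -
  have "expectation (big_count n \<epsilon>) = (\<Sum>m\<in>window n. \<P>(\<omega> in M. big n \<epsilon> m \<omega>))"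
    unfolding big_count_def
    by (subst Bochner_Integration.integral_sum) (auto intro!: integrable_of_bool sum.cong expectation_of_bool)
  also have "\<dots> \<le> (\<Sum>m\<in>window n. q)" by (intro sum_mono assms)
  finally show ?thesis by (simp add: card_window)
qed

text \<open>Indicators are idempotent, so the diagonal of the square returns the count, and N^2 - N
  counts ordered pairs of distinct big jumps. It controls both the event of two big jumps and the
  size of the idealised sum there.\<close>

lemma big_count_pairs:
  "(big_count n \<epsilon> \<omega>)\<^sup>2 - big_count n \<epsilon> \<omega>
    = (\<Sum>m\<in>window n. \<Sum>m'\<in>window n - {m}. of_bool (big n \<epsilon> m \<omega> \<and> big n \<epsilon> m' \<omega>))"
proof -
  have "(big_count n \<epsilon> \<omega>)\<^sup>2 = (\<Sum>m\<in>window n. \<Sum>m'\<in>window n. of_bool (big n \<epsilon> m \<omega> \<and> big n \<epsilon> m' \<omega>))"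
    unfolding big_count_def power2_eq_square sum_product by (simp add: of_bool_conj)
  also have "\<dots> = (\<Sum>m\<in>window n. of_bool (big n \<epsilon> m \<omega>) + (\<Sum>m'\<in>window n - {m}. of_bool (big n \<epsilon> m \<omega> \<and> big n \<epsilon> m' \<omega>)))"
    by (intro sum.cong refl, subst sum.remove) auto
  finally show ?thesis by (simp add: sum.distrib big_count_def)
qed

lemma integrable_big_count_pairs: "integrable M (\<lambda>\<omega>. (big_count n \<epsilon> \<omega>)\<^sup>2 - big_count n \<epsilon> \<omega>)"
  unfolding big_count_pairs by (intro Bochner_Integration.integrable_sum integrable_of_bool) measurable

lemma expectation_big_count_pairs_le:
  assumes "\<And>m. \<P>(\<omega> in M. big n \<epsilon> m \<omega>) \<le> q"
  shows "expectation (\<lambda>\<omega>. (big_count n \<epsilon> \<omega>)\<^sup>2 - big_count n \<epsilon> \<omega>) \<le> (6 * real n + 1)\<^sup>2 * q\<^sup>2"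
proof -
  have "expectation (\<lambda>\<omega>. (big_count n \<epsilon> \<omega>)\<^sup>2 - big_count n \<epsilon> \<omega>)
      = (\<Sum>m\<in>window n. expectation (\<lambda>\<omega>. \<Sum>m'\<in>window n - {m}. of_bool (big n \<epsilon> m \<omega> \<and> big n \<epsilon> m' \<omega>)))"
    unfolding big_count_pairs
    by (rule Bochner_Integration.integral_sum) (intro Bochner_Integration.integrable_sum integrable_of_bool, measurable)
  also have "\<dots> = (\<Sum>m\<in>window n. \<Sum>m'\<in>window n - {m}. \<P>(\<omega> in M. big n \<epsilon> m \<omega> \<and> big n \<epsilon> m' \<omega>))"
    by (intro sum.cong refl, subst Bochner_Integration.integral_sum)
       (auto intro!: integrable_of_bool sum.cong expectation_of_bool)
  also have "\<dots> \<le> (\<Sum>m\<in>window n. \<Sum>m'\<in>window n - {m}. q\<^sup>2)"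
    by (intro sum_mono prob_two_big_le assms) auto
  also have "\<dots> \<le> (\<Sum>m\<in>window n. \<Sum>m'\<in>window n. q\<^sup>2)" by (intro sum_mono sum_mono2) auto
  also have "\<dots> = (6 * real n + 1)\<^sup>2 * q\<^sup>2" by (simp add: card_window power2_eq_square)
  finally show ?thesis .
qed

lemma single_jump_value_measurable [measurable]:
  assumes [measurable]: "\<Gamma> \<in> sets borel" "\<Psi> \<in> sets borel"
  shows "single_jump_value \<Gamma> \<Psi> f n m \<in> borel_measurable M"
  unfolding single_jump_value_def by measurable

lemma single_jump_value_bound: "(\<And>p. \<bar>f p\<bar> \<le> C) \<Longrightarrow> \<bar>single_jump_value \<Gamma> \<Psi> f n m \<omega>\<bar> \<le> C"
  using order_trans[OF abs_ge_zero, of _ C] by (auto simp: single_jump_value_def)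

text \<open>\<Gamma> splits according to membership in \<Psi>, and identical distribution replaces m
  by 0 in the probabilities. The index survives only as the argument of f, ready for a Riemann
  sum.\<close>

lemma expectation_single_jump_value:
  assumes [measurable]: "\<Gamma> \<in> sets borel" "\<Psi> \<in> sets borel"
  shows "expectation (single_jump_value \<Gamma> \<Psi> f n m)
    = f (ereal (real_of_int m / real n), ereal (1 - real_of_int m / real n))
        * \<P>(\<omega> in M. limit_jump n 0 \<omega> \<in> \<Gamma> \<inter> \<Psi>)
      + f (0, 0) * (\<P>(\<omega> in M. limit_jump n 0 \<omega> \<in> \<Gamma>) - \<P>(\<omega> in M. limit_jump n 0 \<omega> \<in> \<Gamma> \<inter> \<Psi>))"
proof -
  let ?F = "f (ereal (real_of_int m / real n), ereal (1 - real_of_int m / real n))"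
  have "single_jump_value \<Gamma> \<Psi> f n m = (\<lambda>\<omega>. ?F * of_bool (limit_jump n m \<omega> \<in> \<Gamma> \<inter> \<Psi>)
      + f (0, 0) * (of_bool (limit_jump n m \<omega> \<in> \<Gamma>) - of_bool (limit_jump n m \<omega> \<in> \<Gamma> \<inter> \<Psi>)))"
    by (auto simp: single_jump_value_def)
  hence "expectation (single_jump_value \<Gamma> \<Psi> f n m)
      = ?F * expectation (\<lambda>\<omega>. of_bool (limit_jump n m \<omega> \<in> \<Gamma> \<inter> \<Psi>))
      + f (0, 0) * (expectation (\<lambda>\<omega>. of_bool (limit_jump n m \<omega> \<in> \<Gamma>))
          - expectation (\<lambda>\<omega>. of_bool (limit_jump n m \<omega> \<in> \<Gamma> \<inter> \<Psi>)))"
    using integrable_of_bool[of "\<lambda>\<omega>. limit_jump n m \<omega> \<in> \<Gamma> \<inter> \<Psi>"] integrable_of_bool[of "\<lambda>\<omega>. limit_jump n m \<omega> \<in> \<Gamma>"]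
    by simp
  also have "\<dots> = ?F * \<P>(\<omega> in M. limit_jump n m \<omega> \<in> \<Gamma> \<inter> \<Psi>)
      + f (0, 0) * (\<P>(\<omega> in M. limit_jump n m \<omega> \<in> \<Gamma>) - \<P>(\<omega> in M. limit_jump n m \<omega> \<in> \<Gamma> \<inter> \<Psi>))"
    by (subst (1 2 3) expectation_of_bool) auto
  also have "\<P>(\<omega> in M. limit_jump n m \<omega> \<in> \<Gamma> \<inter> \<Psi>) = \<P>(\<omega> in M. limit_jump n 0 \<omega> \<in> \<Gamma> \<inter> \<Psi>)"
    by (rule prob_limit_jump) measurable
  also have "\<P>(\<omega> in M. limit_jump n m \<omega> \<in> \<Gamma>) = \<P>(\<omega> in M. limit_jump n 0 \<omega> \<in> \<Gamma>)"
    by (rule prob_limit_jump) measurable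
  finally show ?thesis .
qed

text \<open>The deterministic comparison is applied off the union \<open>E\<close> of the
  exceptional events when at most one jump is big. Elsewhere crude bounds are used, and the
  resulting pointwise inequality is integrated; each summand on the right is the cost of one
  exceptional event, the last one that of two big jumps.\<close>

lemma exits_expectation_bound:
  fixes f :: "ereal \<times> ereal \<Rightarrow> real"
  assumes n: "1 \<le> n" and l: "n \<le> l" and d: "0 < \<delta>" "6 * \<delta> \<le> \<delta>\<^sub>0" and eps: "\<epsilon> \<le> \<delta>\<^sub>0"
    and Gm [measurable]: "\<Gamma> \<in> sets borel" and Pm [measurable]: "\<Psi> \<in> sets borel"
    and G: "\<Gamma> \<subseteq> {y. \<delta>\<^sub>0 < norm y}" and P: "\<Psi> \<subseteq> {y. \<delta>\<^sub>0 < norm y}"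
    and f: "continuous_on UNIV f" and C: "\<And>p. \<bar>f p\<bar> \<le> C"
    and osc: "\<And>m x y. m \<in> {0..int n - 1} \<Longrightarrow> \<bar>x - real_of_int m / real n\<bar> \<le> (real h + 1) / real n \<Longrightarrow>
        \<bar>y - (1 - real_of_int m / real n)\<bar> \<le> (real h + 1) / real n \<Longrightarrow>
        \<bar>f (ereal x, ereal y) - f (ereal (real_of_int m / real n), ereal (1 - real_of_int m / real n))\<bar> \<le> \<theta>"
    and osc0: "\<bar>f (0, ereal (1 / real n)) - f (0, 0)\<bar> \<le> \<theta>"
    and q: "\<And>m. \<P>(\<omega> in M. big n \<epsilon> m \<omega>) \<le> q"
    and p0: "\<P>(\<omega> in M. ennreal (\<delta> * real n) < remainder n l \<omega>) \<le> p0"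
    and p1: "\<And>j. \<bar>j\<bar> \<le> int n \<Longrightarrow>
      \<P>(\<omega> in M. \<delta> * real n < norm (trunc_sum (Fw n l) n \<epsilon> j \<omega>)) \<le> p1"
    and p2: "(\<Sum>m\<in>Fw n l - window n. \<P>(\<omega> in M. big n \<epsilon> m \<omega>)) \<le> p2"
    and p3: "\<And>m. \<P>(\<omega> in M. \<delta> * real n < \<tau> h * norm (Z m \<omega>)) \<le> p3"
    and p4: "\<And>m. \<P>(\<omega> in M. limit_jump n m \<omega> \<in> near_boundary \<delta>\<^sub>0 (3 * \<delta>) \<Gamma> \<union> near_boundary \<delta>\<^sub>0 (3 * \<delta>) \<Psi>) \<le> p4"
  shows "\<bar>expectation (\<lambda>\<omega>. f (exits \<Psi> n \<omega>) * of_bool (hits \<Gamma> n \<omega>))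
      - (\<Sum>m\<in>{0..int n - 1}. expectation (single_jump_value \<Gamma> \<Psi> f n m))\<bar>
    \<le> \<theta> * ((6 * real n + 1) * q) + 3 * C * (p0 + (2 * real n + 1) * p1 + p2 + (6 * real n + 1) * p3
        + (4 * real h + 3) * q + real n * p4 + (6 * real n + 1)\<^sup>2 * q\<^sup>2)"
proof -
  define ed where "ed = {- int h..int h} \<union> {int n - 1 - int h..int n + int h}"
  define NB where "NB = near_boundary \<delta>\<^sub>0 (3 * \<delta>) \<Gamma> \<union> near_boundary \<delta>\<^sub>0 (3 * \<delta>) \<Psi>"
  have NBm [measurable]: "NB \<in> sets borel" unfolding NB_def by (intro sets.Un borel_closed closed_near_boundary)
  define E0 where "E0 = {\<omega>\<in>space M. ennreal (\<delta> * real n) < remainder n l \<omega>}"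
  define E1 where "E1 j = {\<omega>\<in>space M. \<delta> * real n < norm (trunc_sum (Fw n l) n \<epsilon> j \<omega>)}" for j
  define Eb where "Eb m = {\<omega>\<in>space M. big n \<epsilon> m \<omega>}" for m
  define E3 where "E3 m = {\<omega>\<in>space M. \<delta> * real n < \<tau> h * norm (Z m \<omega>)}" for m
  define E4 where "E4 m = {\<omega>\<in>space M. limit_jump n m \<omega> \<in> NB}" for m
  have ev [measurable]: "E0 \<in> events" "E1 j \<in> events" "Eb m \<in> events" "E3 m \<in> events" "E4 m \<in> events" for j m
    unfolding E0_def E1_def Eb_def E3_def E4_def by measurable
  define U1 where "U1 = (\<Union>j\<in>{- int n..int n}. E1 j)"
  define U2 where "U2 = (\<Union>m\<in>Fw n l - window n. Eb m)"
  define U3 where "U3 = (\<Union>m\<in>window n. E3 m)"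
  define U4 where "U4 = (\<Union>m\<in>ed. Eb m)"
  define U5 where "U5 = (\<Union>m\<in>{0..int n - 1}. E4 m)"
  have fin_ed: "finite ed" by (simp add: ed_def)
  have evU [measurable]: "U1 \<in> events" "U2 \<in> events" "U3 \<in> events" "U4 \<in> events" "U5 \<in> events"
    unfolding U1_def U2_def U3_def U4_def U5_def using ev fin_ed by (auto intro!: sets.finite_UN)
  define E where "E = E0 \<union> U1 \<union> U2 \<union> U3 \<union> U4 \<union> U5"
  have evE [measurable]: "E \<in> events" unfolding E_def using ev evU by auto
  have UN: "prob (\<Union>i\<in>I. H i) \<le> (\<Sum>i\<in>I. prob (H i))" if "finite I" "\<And>i. H i \<in> events" for I :: "int set" and H
    using that by (intro finite_measure_subadditive_finite) auto
  have probE: "prob E \<le> p0 + (2 * real n + 1) * p1 + p2 + (6 * real n + 1) * p3 + (4 * real h + 3) * q + real n * p4"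
  proof -
    have q0: "0 \<le> q" using order_trans[OF measure_nonneg q] .
    have "prob U1 \<le> (\<Sum>j\<in>{- int n..int n}. prob (E1 j))" unfolding U1_def by (rule UN) (auto simp: ev)
    also have "\<dots> \<le> (\<Sum>j\<in>{- int n..int n}. p1)" using p1 by (intro sum_mono) (auto simp: E1_def)
    finally have 1: "prob U1 \<le> (2 * real n + 1) * p1" by simp
    have "prob U2 \<le> (\<Sum>m\<in>Fw n l - window n. prob (Eb m))" unfolding U2_def by (rule UN) (auto simp: ev)
    hence 2: "prob U2 \<le> p2" using p2 by (simp add: Eb_def)
    have "prob U3 \<le> (\<Sum>m\<in>window n. prob (E3 m))" unfolding U3_def by (rule UN) (auto simp: ev)
    also have "\<dots> \<le> (\<Sum>m\<in>window n. p3)" using p3 by (intro sum_mono) (auto simp: E3_def)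
    finally have 3: "prob U3 \<le> (6 * real n + 1) * p3" by (simp add: card_window)
    have "prob U4 \<le> (\<Sum>m\<in>ed. prob (Eb m))" unfolding U4_def by (rule UN) (auto simp: ev fin_ed)
    also have "\<dots> \<le> (\<Sum>m\<in>ed. q)" using q by (intro sum_mono) (auto simp: Eb_def)
    also have "\<dots> = real (card ed) * q" by simp
    also have "\<dots> \<le> (4 * real h + 3) * q"
    proof (intro mult_right_mono q0)
      have "card ed \<le> card {- int h..int h} + card {int n - 1 - int h..int n + int h}"
        unfolding ed_def by (rule card_Un_le)
      also have "\<dots> = 4 * h + 3" by simp
      finally show "real (card ed) \<le> 4 * real h + 3" by linarith
    qed
    finally have 4: "prob U4 \<le> (4 * real h + 3) * q" .
    have "prob U5 \<le> (\<Sum>m\<in>{0..int n - 1}. prob (E4 m))" unfolding U5_def by (rule UN) (auto simp: ev)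
    also have "\<dots> \<le> (\<Sum>m\<in>{0..int n - 1}. p4)" using p4 by (intro sum_mono) (auto simp: E4_def NB_def)
    finally have 5: "prob U5 \<le> real n * p4" by simp
    have Un: "prob (H \<union> H') \<le> prob H + prob H'" if "H \<in> events" "H' \<in> events" for H H'
      using measure_Un_le[OF that] .
    have "prob E \<le> prob E0 + prob U1 + prob U2 + prob U3 + prob U4 + prob U5"
      unfolding E_def using ev evU by (intro order_trans[OF Un] add_mono order_refl) auto
    thus ?thesis using 1 2 3 4 5 p0 by (simp add: E0_def)
  qed
  define X where "X \<omega> = f (exits \<Psi> n \<omega>) * of_bool (hits \<Gamma> n \<omega>)" for \<omega>
  define W where "W \<omega> = (\<Sum>m\<in>{0..int n - 1}. single_jump_value \<Gamma> \<Psi> f n m \<omega>)" for \<omega>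
  define N where "N = big_count n \<epsilon>"
  have C0: "0 \<le> C" using order_trans[OF abs_ge_zero C] .
  have th0: "0 \<le> \<theta>" using osc0 by linarith
  have Xm [measurable]: "X \<in> borel_measurable M"
  proof -
    have [measurable]: "(\<lambda>\<omega>. f (exits \<Psi> n \<omega>)) \<in> borel_measurable M" by (rule exits_measurable[OF Pm n f])
    have "X = (\<lambda>\<omega>. f (exits \<Psi> n \<omega>) * of_bool ((1 / real n) *\<^sub>R block_sum A Z n 0 \<omega> \<in> \<Gamma>))"
      using n by (auto simp: X_def mem_scaleR_image_iff)
    thus ?thesis by simp
  qed
  have Wm [measurable]: "W \<in> borel_measurable M" unfolding W_def by measurable
  have Xb: "\<bar>X \<omega>\<bar> \<le> C" for \<omega> using C C0 by (auto simp: X_def)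
  have Wb: "\<bar>W \<omega>\<bar> \<le> C * N \<omega>" for \<omega>
  proof -
    have F0: "single_jump_value \<Gamma> \<Psi> f n m \<omega> = 0" if "m \<in> window n" "\<not> big n \<epsilon> m \<omega>" for m
    proof -
      have "limit_jump n m \<omega> \<notin> \<Gamma>" using norm_limit_jump_le[OF that n] eps G by auto
      thus ?thesis by (simp add: single_jump_value_def)
    qed
    have "\<bar>W \<omega>\<bar> \<le> (\<Sum>m\<in>{0..int n - 1}. \<bar>single_jump_value \<Gamma> \<Psi> f n m \<omega>\<bar>)" unfolding W_def by (rule sum_abs)
    also have "\<dots> \<le> (\<Sum>m\<in>window n. \<bar>single_jump_value \<Gamma> \<Psi> f n m \<omega>\<bar>)"
      by (intro sum_mono2) (auto simp: window_def)
    also have "\<dots> \<le> (\<Sum>m\<in>window n. C * of_bool (big n \<epsilon> m \<omega>))"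
    proof (rule sum_mono)
      fix m assume "m \<in> window n"
      thus "\<bar>single_jump_value \<Gamma> \<Psi> f n m \<omega>\<bar> \<le> C * of_bool (big n \<epsilon> m \<omega>)"
        using F0[of m] single_jump_value_bound[of f C, OF C] by (cases "big n \<epsilon> m \<omega>") auto
    qed
    finally show ?thesis unfolding N_def big_count_def sum_distrib_left .
  qed
  have intN: "integrable M N" "integrable M (\<lambda>\<omega>. (N \<omega>)\<^sup>2 - N \<omega>)"
    using integrable_big_count integrable_big_count_pairs by (simp_all add: N_def)
  have intX: "integrable M X" by (rule integrable_const_bound[of _ C]) (auto simp: Xb)
  have intW: "integrable M W"
    by (rule Bochner_Integration.integrable_bound[of M "\<lambda>\<omega>. C * N \<omega>"])
       (use intN(1) Wb order_trans[OF Wb abs_ge_self] in auto)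
  \<comment> \<open>The idealised sum \<open>W\<close> is bounded only by C times the count N, not
    by C. The inequality N \<le> 1 + (N^2 - N), which is (N - 1)^2 \<ge> 0, lets the pair count
    absorb this on \<open>E\<close> as well.\<close>
  have pointwise: "\<bar>X \<omega> - W \<omega>\<bar> \<le> \<theta> * N \<omega> + 3 * C * (indicat_real E \<omega> + ((N \<omega>)\<^sup>2 - N \<omega>))"
    if w: "\<omega> \<in> space M" for \<omega>
  proof -
    define c where "c = card {m\<in>window n. big n \<epsilon> m \<omega>}"
    have Nc: "N \<omega> = real c" by (simp add: N_def big_count_eq_card c_def)
    have N1: "N \<omega> \<le> 1 + ((N \<omega>)\<^sup>2 - N \<omega>)"
      using zero_le_power2[of "N \<omega> - 1"] by (simp add: power2_eq_square algebra_simps)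
    have N2: "0 \<le> (N \<omega>)\<^sup>2 - N \<omega>" unfolding Nc power2_eq_square by (cases c) (auto simp: algebra_simps)
    have triv: "\<bar>X \<omega> - W \<omega>\<bar> \<le> C * (2 + ((N \<omega>)\<^sup>2 - N \<omega>))"
    proof -
      have "\<bar>X \<omega> - W \<omega>\<bar> \<le> C + C * N \<omega>" using Xb[of \<omega>] Wb[of \<omega>] by linarith
      also have "\<dots> \<le> C + C * (1 + ((N \<omega>)\<^sup>2 - N \<omega>))" using N1 C0 by (intro add_left_mono mult_left_mono) auto
      finally show ?thesis by (simp add: algebra_simps)
    qed
    have thN: "0 \<le> \<theta> * N \<omega>" using th0 by (simp add: Nc)
    consider (E) "\<omega> \<in> E" | (pair) "2 \<le> c" | (good) "\<omega> \<notin> E" "c \<le> 1" by linarith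
    thus ?thesis
    proof cases
      case E
      have "C * (2 + ((N \<omega>)\<^sup>2 - N \<omega>)) \<le> 3 * C * (1 + ((N \<omega>)\<^sup>2 - N \<omega>))"
        using mult_left_mono[of "2 + ((N \<omega>)\<^sup>2 - N \<omega>)" "3 * (1 + ((N \<omega>)\<^sup>2 - N \<omega>))" C] N2 C0 by (simp add: mult_ac)
      thus ?thesis using triv thN E by simp
    next
      case pair
      have "1 \<le> (N \<omega>)\<^sup>2 - N \<omega>"
      proof -
        have "2 * real c \<le> real c * real c" using pair by (intro mult_right_mono) auto
        thus ?thesis unfolding Nc power2_eq_square using pair by linarith
      qed
      hence "C * (2 + ((N \<omega>)\<^sup>2 - N \<omega>)) \<le> 3 * C * ((N \<omega>)\<^sup>2 - N \<omega>)"
        using mult_left_mono[of "2 + ((N \<omega>)\<^sup>2 - N \<omega>)" "3 * ((N \<omega>)\<^sup>2 - N \<omega>)" C] C0 by (simp add: mult_ac)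
      moreover have "3 * C * ((N \<omega>)\<^sup>2 - N \<omega>) \<le> 3 * C * (indicat_real E \<omega> + ((N \<omega>)\<^sup>2 - N \<omega>))"
        using C0 by (intro mult_left_mono) auto
      ultimately show ?thesis using triv thN by linarith
    next
      case good
      have "\<bar>X \<omega> - W \<omega>\<bar> \<le> \<theta> * real c"
        unfolding X_def W_def c_def
      proof (rule exits_comparison[OF n l d eps G P _ _ _ _ _ _ _ osc osc0])
        show "remainder n l \<omega> \<le> ennreal (\<delta> * real n)"
          using good(1) w by (auto simp: E_def E0_def)
        show "norm (trunc_sum (Fw n l) n \<epsilon> j \<omega>) \<le> \<delta> * real n" if "\<bar>j\<bar> \<le> int n" for j
        proof -
          have "j \<in> {- int n..int n}" using that by auto
          moreover have "\<omega> \<notin> U1" using good(1) by (simp add: E_def)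
          ultimately have "\<omega> \<notin> E1 j" unfolding U1_def by blast
          thus ?thesis using w by (simp add: E1_def not_less)
        qed
        show "\<not> big n \<epsilon> m \<omega>" if "m \<in> Fw n l - window n" for m
          using good(1) w that by (auto simp: E_def U2_def Eb_def)
        show "\<tau> h * norm (Z m \<omega>) \<le> \<delta> * real n" if "m \<in> window n" for m
          using good(1) w that by (auto simp: E_def U3_def E3_def not_less)
        show "\<not> big n \<epsilon> m \<omega>" if "m \<in> {- int h..int h} \<union> {int n - 1 - int h..int n + int h}" for m
          using good(1) w that unfolding ed_def[symmetric] by (auto simp: E_def U4_def Eb_def)
        show "limit_jump n m \<omega> \<notin> near_boundary \<delta>\<^sub>0 (3 * \<delta>) \<Gamma> \<union> near_boundary \<delta>\<^sub>0 (3 * \<delta>) \<Psi>"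
          if "m \<in> {0..int n - 1}" for m
          using good(1) w that unfolding NB_def[symmetric] by (auto simp: E_def U5_def E4_def)
        show "m = m'" if "m \<in> window n" "m' \<in> window n" "big n \<epsilon> m \<omega>" "big n \<epsilon> m' \<omega>" for m m'
        proof -
          have "m \<in> {m\<in>window n. big n \<epsilon> m \<omega>}" "m' \<in> {m\<in>window n. big n \<epsilon> m \<omega>}" using that by auto
          thus ?thesis using good(2) card_le_Suc0_iff_eq[of "{m\<in>window n. big n \<epsilon> m \<omega>}"] unfolding c_def by auto
        qed
      qed auto
      moreover have "0 \<le> 3 * C * (indicat_real E \<omega> + ((N \<omega>)\<^sup>2 - N \<omega>))"
        using C0 N2 by (intro mult_nonneg_nonneg) auto
      ultimately show ?thesis by (simp add: Nc)
    qed
  qed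
  have "\<bar>expectation X - expectation W\<bar> = \<bar>expectation (\<lambda>\<omega>. X \<omega> - W \<omega>)\<bar>" using intX intW by simp
  also have "\<dots> \<le> expectation (\<lambda>\<omega>. \<bar>X \<omega> - W \<omega>\<bar>)" by (rule integral_abs_bound)
  also have "\<dots> \<le> expectation (\<lambda>\<omega>. \<theta> * N \<omega> + 3 * C * (indicat_real E \<omega> + ((N \<omega>)\<^sup>2 - N \<omega>)))"
  proof (rule integral_mono_AE)
    show "integrable M (\<lambda>\<omega>. \<bar>X \<omega> - W \<omega>\<bar>)" using intX intW by simp
    show "integrable M (\<lambda>\<omega>. \<theta> * N \<omega> + 3 * C * (indicat_real E \<omega> + ((N \<omega>)\<^sup>2 - N \<omega>)))"
      by (intro Bochner_Integration.integrable_add integrable_mult_right intN) (simp add: integrable_real_indicator emeasure_eq_measure)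
  qed (use pointwise in auto)
  also have "\<dots> = \<theta> * expectation N + 3 * C * (prob E + expectation (\<lambda>\<omega>. (N \<omega>)\<^sup>2 - N \<omega>))"
  proof -
    have "integrable M (indicat_real E)" by (simp add: integrable_real_indicator emeasure_eq_measure)
    thus ?thesis using intN by (subst Bochner_Integration.integral_add) auto
  qed
  also have "\<dots> \<le> \<theta> * ((6 * real n + 1) * q) + 3 * C * ((p0 + (2 * real n + 1) * p1 + p2 + (6 * real n + 1) * p3
        + (4 * real h + 3) * q + real n * p4) + (6 * real n + 1)\<^sup>2 * q\<^sup>2)"
    using probE expectation_big_count_le[OF q] expectation_big_count_pairs_le[OF q] th0 C0
    unfolding N_def by (intro add_mono mult_left_mono) auto
  finally have "\<bar>expectation X - expectation W\<bar> \<le> \<dots>" .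
  moreover have "expectation W = (\<Sum>m\<in>{0..int n - 1}. expectation (single_jump_value \<Gamma> \<Psi> f n m))"
    unfolding W_def
    by (rule Bochner_Integration.integral_sum)
       (rule integrable_const_bound[of _ C], auto intro!: single_jump_value_bound C)
  ultimately show ?thesis by (simp add: X_def[abs_def])
qed

section \<open>The limit law\<close>

text \<open>The order of the choices matters: the boundary fixes \<delta>, then \<delta> and the
  lower tail exponent fix \<epsilon>, and \<epsilon> fixes the constant \<open>L\<close> in the
  bound for big jumps. Only then are the oscillation and the edge width chosen, since they must beat
  \<open>L\<close>. Four contributions of \<theta> / 4 make up the bound.\<close>

lemma exits_asymptotics:
  fixes f :: "ereal \<times> ereal \<Rightarrow> real"
  assumes inv: "invertible \<A>"
    and Gm [measurable]: "\<Gamma> \<in> sets borel" and Pm [measurable]: "\<Psi> \<in> sets borel"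
    and d0: "0 < \<delta>\<^sub>0" and G: "\<Gamma> \<subseteq> {y. \<delta>\<^sub>0 < norm y}" and P: "\<Psi> \<subseteq> {y. \<delta>\<^sub>0 < norm y}"
    and Gn: "emeasure \<nu> (frontier (embE ` mat_preimage \<A> \<Gamma>)) = 0"
    and Pn: "emeasure \<nu> (frontier (embE ` mat_preimage \<A> \<Psi>)) = 0"
    and f: "continuous_on UNIV f" and C: "\<And>p. \<bar>f p\<bar> \<le> C" and C0: "0 < C" and th: "0 < \<theta>"
  shows "\<forall>\<^sub>F n in sequentially.
    \<bar>expectation (\<lambda>\<omega>. f (exits \<Psi> n \<omega>) * of_bool (hits \<Gamma> n \<omega>))
      - (\<Sum>m\<in>{0..int n - 1}. expectation (single_jump_value \<Gamma> \<Psi> f n m))\<bar>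
    \<le> \<theta> * (real n * tail (real n))"
proof -
  have a0: "0 < a" using a_ge_1 by simp
  define e where "e = expectation (\<lambda>\<omega>. norm (Z 0 \<omega>))"
  have e0: "0 \<le> e" by (simp add: e_def)
  \<comment> \<open>Two boundary layers, each of cost at most 3C times \<open>\<theta>1\<close>, add
    up to \<theta> / 4.\<close>
  define \<theta>1 where "\<theta>1 = \<theta> / (24 * C)"
  have th1: "0 < \<theta>1" using th C0 by (simp add: \<theta>1_def)
  obtain rG where rG: "0 < rG" "\<forall>\<^sub>F n in sequentially.
      \<P>(\<omega> in M. limit_jump n 0 \<omega> \<in> near_boundary \<delta>\<^sub>0 rG \<Gamma>) \<le> \<theta>1 * tail (real n)"
    using prob_near_boundary[OF inv Gn d0 th1] by blast
  obtain rP where rP: "0 < rP" "\<forall>\<^sub>F n in sequentially.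
      \<P>(\<omega> in M. limit_jump n 0 \<omega> \<in> near_boundary \<delta>\<^sub>0 rP \<Psi>) \<le> \<theta>1 * tail (real n)"
    using prob_near_boundary[OF inv Pn d0 th1] by blast
  define \<delta> where "\<delta> = min (\<delta>\<^sub>0 / 6) (min (rG / 3) (rP / 3))"
  have d: "0 < \<delta>" "6 * \<delta> \<le> \<delta>\<^sub>0" "3 * \<delta> \<le> rG" "3 * \<delta> \<le> rP"
    using d0 rG(1) rP(1) by (auto simp: \<delta>_def min_def)
  obtain c \<gamma> where c: "0 < c" "0 < \<gamma>" "\<forall>\<^sub>F u in at_top. c * u powr (- \<gamma>) \<le> tail u"
    using tail_polynomial_lower by blast
  have g1: "0 < \<gamma> + 1" using c(2) by simp
  \<comment> \<open>The exponent \<gamma> + 1 leaves a factor 1 / n beyond \<open>tail n\<close>,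
    which offsets most of the union over the 2n + 1 starts: the total is of order
    \<open>tail n\<close>, hence o(\<open>n * tail n\<close>).\<close>
  obtain \<epsilon> where eps: "0 < \<epsilon>" "\<epsilon> \<le> \<delta>\<^sub>0"
    "\<forall>\<^sub>F n in sequentially. \<forall>j F. \<bar>j\<bar> \<le> int n \<and> finite F \<longrightarrow>
      \<P>(\<omega> in M. \<delta> * real n < norm (trunc_sum F n \<epsilon> j \<omega>))
        \<le> 2 * real CARD('d) * exp 1 * real n powr (- (\<gamma> + 1))"
    using truncated_sum_deviation[OF d(1) g1 d0] by blast
  define H where "H = 2 * real CARD('d) * exp 1 / c"
  have H0: "0 \<le> H" using c(1) by (simp add: H_def)
  obtain K where K: "0 < K" "\<forall>\<^sub>F u in at_top. \<forall>c. 0 \<le> c \<and> c \<le> a \<longrightarrow>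
     \<P>(\<omega> in M. \<epsilon> * u < c * norm (Z 0 \<omega>)) \<le> K * c * tail u"
    using tail_weighted[OF a0 eps(1)] by blast
  obtain K' where K': "0 < K'" "\<forall>\<^sub>F u in at_top. \<forall>c. 0 \<le> c \<and> c \<le> a \<longrightarrow>
     \<P>(\<omega> in M. \<delta> * u < c * norm (Z 0 \<omega>)) \<le> K' * c * tail u"
    using tail_weighted[OF a0 d(1)] by blast
  define L where "L = K * a"
  have L0: "0 < L" using K(1) a0 by (simp add: L_def)
  \<comment> \<open>The expected number of big jumps in the window is at most 7n * L * tail n, so
    this oscillation costs \<theta> / 4.\<close>
  define \<theta>0 where "\<theta>0 = \<theta> / (28 * L)"
  have th0: "0 < \<theta>0" using th L0 by (simp add: \<theta>0_def)
  obtain \<rho> where rho: "0 < \<rho>" "\<And>x y u v. u \<in> {0..1} \<Longrightarrow> v \<in> {0..1} \<Longrightarrow> \<bar>x - u\<bar> \<le> \<rho> \<Longrightarrow> \<bar>y - v\<bar> \<le> \<rho> \<Longrightarrow>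
    \<bar>f (ereal x, ereal y) - f (ereal u, ereal v)\<bar> \<le> \<theta>0"
    using ereal_pair_oscillation[OF f th0] by blast
  \<comment> \<open>About 4\<eta>n edge indices, each big with probability at most L * tail n and
    weighted by 3C, cost \<theta> / 4. The half of \<rho> leaves room for the extra 1 / n in the
    location of the exits.\<close>
  define \<eta> where "\<eta> = min (\<theta> / (48 * C * L)) (\<rho> / 2)"
  have eta: "0 < \<eta>" "\<eta> \<le> \<theta> / (48 * C * L)" "2 * \<eta> \<le> \<rho>"
    using th C0 L0 rho(1) by (auto simp: \<eta>_def)
  \<comment> \<open>An edge width proportional to n: the discarded fraction is controlled by \<eta>,
    while the width itself grows, so that \<open>\<tau> (h n)\<close> tends to 0.\<close>
  define h where "h n = nat \<lfloor>\<eta> * real n\<rfloor>" for n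
  have h_le: "real (h n) \<le> \<eta> * real n" for n using eta(1) by (simp add: h_def)
  have h_top: "filterlim h at_top sequentially"
    unfolding filterlim_at_top
  proof
    fix B :: nat
    show "\<forall>\<^sub>F n in sequentially. B \<le> h n"
      using eventually_ge_at_top[of "nat \<lceil>real B / \<eta>\<rceil>"]
    proof eventually_elim
      case (elim n)
      hence "real B / \<eta> \<le> real n" by linarith
      hence "real B \<le> \<eta> * real n" using eta(1) by (simp add: field_simps)
      thus ?case unfolding h_def by (rule le_nat_floor)
    qed
  qed
  \<comment> \<open>Collects the errors that vanish after division by \<open>n * tail n\<close>:
    remainder, truncated sums, far indices, weight errors, the constant in the number of edge
    indices, and pairs of big jumps.\<close>
  define r where "r n = 1 / real n + 3 * H * (1 / real n) + 3 * K * \<tau> n + 7 * K' * \<tau> (h n)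
      + 3 * L * (1 / real n) + 49 * L\<^sup>2 * (real n * tail (real n))" for n
  have r_lim: "(\<lambda>n. 3 * C * r n) \<longlonglongrightarrow> 3 * C * (0 + 3 * H * 0 + 3 * K * 0 + 7 * K' * 0 + 3 * L * 0 + 49 * L\<^sup>2 * 0)"
    unfolding r_def
    by (intro tendsto_mult tendsto_add tendsto_const lim_1_over_n tau_tendsto_0 filterlim_compose[OF tau_tendsto_0 h_top]
        filterlim_compose[OF mult_tail_tendsto_0 filterlim_real_sequentially])
  hence ev_r: "\<forall>\<^sub>F n in sequentially. 3 * C * r n < \<theta> / 4" using th by (intro order_tendstoD(2)[OF r_lim]) auto
  note real_ev = eventually_compose_filterlim[OF _ filterlim_real_sequentially]
  have ev_eta: "\<forall>\<^sub>F n in sequentially. 1 / real n < \<eta>"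
    using lim_1_over_n eta(1) by (rule order_tendstoD(2))
  show ?thesis
    using rG(2) rP(2) real_ev[OF c(3)] eps(3) real_ev[OF K(2)] real_ev[OF K'(2)] real_ev[OF tail_pos]
      ev_r ev_eta eventually_ge_at_top[of 1]
  proof eventually_elim
    case (elim n)
    have n: "1 \<le> n" and npos: "0 < real n" using elim(10) by auto
    define t where "t = tail (real n)"
    have t0: "0 < t" using elim(7) by (simp add: t_def)
    \<comment> \<open>For fixed n the first moment bound tends to 0 as l grows, so l can be taken
      large enough to bring it below \<open>tail n\<close>. All other estimates are uniform in
      l.\<close>
    obtain l where l: "n \<le> l" "3 * real n * \<tau> l * e / (\<delta> * real n) \<le> t"
    proof -
      have "(\<lambda>l. 3 * real n * \<tau> l * e / (\<delta> * real n)) \<longlonglongrightarrow> 3 * real n * 0 * e / (\<delta> * real n)"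
        using d(1) npos by (intro tendsto_divide tendsto_mult tendsto_const tau_tendsto_0) auto
      hence "\<forall>\<^sub>F l in sequentially. 3 * real n * \<tau> l * e / (\<delta> * real n) < t"
        using t0 by (intro order_tendstoD(2)) auto
      hence "\<forall>\<^sub>F l in sequentially. n \<le> l \<and> 3 * real n * \<tau> l * e / (\<delta> * real n) < t"
        using eventually_ge_at_top[of n] by eventually_elim auto
      then obtain l where "n \<le> l" "3 * real n * \<tau> l * e / (\<delta> * real n) < t"
        using eventually_happens'[OF sequentially_bot] by blast
      thus ?thesis by (intro that[of l]) auto
    qed
    have shift: "\<P>(\<omega> in M. v * real n < b * norm (Z m \<omega>)) = \<P>(\<omega> in M. v * real n < b * norm (Z 0 \<omega>))" for v b m
      using prob_Z[of "{z. v * real n < b * norm z}" m] by simp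
    have bigD: "\<P>(\<omega> in M. big n \<epsilon> m \<omega>) \<le> K * D n m * t" for m
      unfolding shift[of \<epsilon> "D n m" m] t_def using elim(5) D_nonneg D_le by blast
    have q: "\<P>(\<omega> in M. big n \<epsilon> m \<omega>) \<le> L * t" for m
    proof -
      have "K * D n m * t \<le> K * a * t" using K(1) t0 D_le by (intro mult_right_mono mult_left_mono) auto
      thus ?thesis using bigD[of m] by (simp add: L_def)
    qed
    have p0: "\<P>(\<omega> in M. ennreal (\<delta> * real n) < remainder n l \<omega>) \<le> t"
      using prob_remainder_le[of "\<delta> * real n" n l] d(1) npos l(2) by (simp add: e_def)
    have p1: "\<P>(\<omega> in M. \<delta> * real n < norm (trunc_sum (Fw n l) n \<epsilon> j \<omega>)) \<le> H * (t / real n)"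
      if "\<bar>j\<bar> \<le> int n" for j
    proof -
      have "\<P>(\<omega> in M. \<delta> * real n < norm (trunc_sum (Fw n l) n \<epsilon> j \<omega>))
          \<le> 2 * real CARD('d) * exp 1 * real n powr (- (\<gamma> + 1))" using elim(4) that by simp
      also have "\<dots> = H * (c * real n powr (- \<gamma>) / real n)"
      proof -
        have "real n powr (- (\<gamma> + 1)) = real n powr (- \<gamma>) / real n"
          using npos by (simp add: powr_diff powr_minus field_simps)
        thus ?thesis using c(1) by (simp add: H_def)
      qed
      also have "\<dots> \<le> H * (t / real n)"
        using elim(3) H0 npos by (intro mult_left_mono divide_right_mono) (auto simp: t_def)
      finally show ?thesis .
    qed
    have p2: "(\<Sum>m\<in>Fw n l - window n. \<P>(\<omega> in M. big n \<epsilon> m \<omega>)) \<le> K * (3 * real n * \<tau> n) * t"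
    proof -
      have "(\<Sum>m\<in>Fw n l - window n. \<P>(\<omega> in M. big n \<epsilon> m \<omega>)) \<le> (\<Sum>m\<in>Fw n l - window n. K * D n m * t)"
        by (intro sum_mono bigD)
      also have "\<dots> = K * (\<Sum>m\<in>Fw n l - window n. D n m) * t" by (simp add: sum_distrib_left sum_distrib_right)
      also have "\<dots> \<le> K * (3 * real n * \<tau> n) * t"
        using K(1) t0 by (intro mult_right_mono mult_left_mono sum_D_far) (auto simp: window_def)
      finally show ?thesis .
    qed
    have p3: "\<P>(\<omega> in M. \<delta> * real n < \<tau> (h n) * norm (Z m \<omega>)) \<le> K' * \<tau> (h n) * t" for m
      unfolding shift[of \<delta> "\<tau> (h n)" m] t_def using elim(6) tau_nonneg tau_le by blast
    have p4: "\<P>(\<omega> in M. limit_jump n m \<omega> \<in> near_boundary \<delta>\<^sub>0 (3 * \<delta>) \<Gamma> \<union> near_boundary \<delta>\<^sub>0 (3 * \<delta>) \<Psi>) \<le> 2 * \<theta>1 * t" for m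
    proof -
      have [measurable]: "near_boundary \<delta>\<^sub>0 s S \<in> sets borel" for s S by (intro borel_closed closed_near_boundary)
      have mono: "near_boundary \<delta>\<^sub>0 s S \<subseteq> near_boundary \<delta>\<^sub>0 s' S" if "s \<le> s'" for s s' S
        using that by (force simp: near_boundary_def)
      have "\<P>(\<omega> in M. limit_jump n m \<omega> \<in> near_boundary \<delta>\<^sub>0 (3 * \<delta>) \<Gamma> \<union> near_boundary \<delta>\<^sub>0 (3 * \<delta>) \<Psi>)
          = \<P>(\<omega> in M. limit_jump n 0 \<omega> \<in> near_boundary \<delta>\<^sub>0 (3 * \<delta>) \<Gamma> \<union> near_boundary \<delta>\<^sub>0 (3 * \<delta>) \<Psi>)"
        by (rule prob_limit_jump) measurable
      also have "\<dots> \<le> prob ({\<omega>\<in>space M. limit_jump n 0 \<omega> \<in> near_boundary \<delta>\<^sub>0 rG \<Gamma>}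
          \<union> {\<omega>\<in>space M. limit_jump n 0 \<omega> \<in> near_boundary \<delta>\<^sub>0 rP \<Psi>})"
        using mono[OF d(3), of \<Gamma>] mono[OF d(4), of \<Psi>] by (intro finite_measure_mono) auto
      also have "\<dots> \<le> \<P>(\<omega> in M. limit_jump n 0 \<omega> \<in> near_boundary \<delta>\<^sub>0 rG \<Gamma>)
          + \<P>(\<omega> in M. limit_jump n 0 \<omega> \<in> near_boundary \<delta>\<^sub>0 rP \<Psi>)"
        by (intro measure_Un_le) measurable
      also have "\<dots> \<le> 2 * \<theta>1 * t" using elim(1,2) by (simp add: t_def)
      finally show ?thesis .
    qed
    have hn: "(real (h n) + 1) / real n \<le> \<rho>"
    proof -
      have "(real (h n) + 1) / real n = real (h n) / real n + 1 / real n" by (simp add: add_divide_distrib)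
      also have "real (h n) / real n \<le> \<eta>" using h_le[of n] npos by (simp add: field_simps)
      finally show ?thesis using elim(9) eta(3) by linarith
    qed
    have osc: "\<bar>f (ereal x, ereal y) - f (ereal (real_of_int m / real n), ereal (1 - real_of_int m / real n))\<bar> \<le> \<theta>0"
      if "m \<in> {0..int n - 1}" "\<bar>x - real_of_int m / real n\<bar> \<le> (real (h n) + 1) / real n"
        "\<bar>y - (1 - real_of_int m / real n)\<bar> \<le> (real (h n) + 1) / real n" for m x y
    proof (rule rho(2))
      have "real_of_int m / real n \<in> {0..1}" using that(1) npos by (auto simp: divide_le_eq)
      thus "real_of_int m / real n \<in> {0..1}" "1 - real_of_int m / real n \<in> {0..1}" by auto
    qed (use that hn in linarith)+
    have osc0: "\<bar>f (0, ereal (1 / real n)) - f (0, 0)\<bar> \<le> \<theta>0"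
      using rho(2)[of 0 0 0 "1 / real n"] elim(9) eta npos by (simp add: zero_ereal_def)
    define X where "X = \<bar>expectation (\<lambda>\<omega>. f (exits \<Psi> n \<omega>) * of_bool (hits \<Gamma> n \<omega>))
      - (\<Sum>m\<in>{0..int n - 1}. expectation (single_jump_value \<Gamma> \<Psi> f n m))\<bar>"
    have "X \<le> \<theta>0 * ((6 * real n + 1) * (L * t)) + 3 * C * (t + (2 * real n + 1) * (H * (t / real n)) + K * (3 * real n * \<tau> n) * t
        + (6 * real n + 1) * (K' * \<tau> (h n) * t)
        + (4 * real (h n) + 3) * (L * t) + real n * (2 * \<theta>1 * t) + (6 * real n + 1)\<^sup>2 * (L * t)\<^sup>2)"
      unfolding X_def by (rule exits_expectation_bound[OF n l(1) d(1,2) eps(2) Gm Pm G P f C osc osc0 q p0 p1 p2 p3 p4])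
    also have "\<dots> \<le> \<theta>0 * ((7 * real n) * (L * t)) + 3 * C * (t + (3 * real n) * (H * (t / real n)) + K * (3 * real n * \<tau> n) * t
        + (7 * real n) * (K' * \<tau> (h n) * t)
        + (4 * (\<eta> * real n) + 3) * (L * t) + real n * (2 * \<theta>1 * t) + (7 * real n)\<^sup>2 * (L * t)\<^sup>2)"
      using n npos th0 L0 t0 C0 H0 K(1) K'(1) tau_nonneg[of "h n"] h_le[of n]
      by (intro add_mono mult_left_mono mult_right_mono order_refl power_mono) auto
    also have "\<dots> = (real n * t) * (\<theta>0 * 7 * L + 3 * C * (4 * \<eta> * L) + 3 * C * (2 * \<theta>1) + 3 * C * r n)"
      using npos by (simp add: r_def t_def power2_eq_square field_simps)
    also have "\<dots> \<le> (real n * t) * (\<theta> / 4 + \<theta> / 4 + \<theta> / 4 + \<theta> / 4)"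
    proof (intro mult_left_mono add_mono)
      show "\<theta>0 * 7 * L \<le> \<theta> / 4" using L0 by (simp add: \<theta>0_def)
      have "3 * C * (4 * \<eta> * L) = (12 * C * L) * \<eta>" by simp
      also have "\<dots> \<le> (12 * C * L) * (\<theta> / (48 * C * L))" using eta(2) C0 L0 by (intro mult_left_mono) auto
      also have "\<dots> = \<theta> / 4" using C0 L0 by simp
      finally show "3 * C * (4 * \<eta> * L) \<le> \<theta> / 4" .
      show "3 * C * (2 * \<theta>1) \<le> \<theta> / 4" using C0 by (simp add: \<theta>1_def)
      show "3 * C * r n \<le> \<theta> / 4" using elim(8) by simp
    qed (use npos t0 in auto)
    also have "\<dots> = \<theta> * (real n * t)" by simp
    finally show ?case by (simp add: X_def t_def)
  qed
qed

text \<open>The idealised expectation is a left-endpoint Riemann sum times the probability of a jump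
  into both sets, plus n times f(0, 0) times that of a jump into \<Gamma> alone. The intersection
  has a null boundary because its frontier lies in the union of the two frontiers.\<close>

lemma exits_limit:
  fixes f :: "ereal \<times> ereal \<Rightarrow> real"
  assumes inv: "invertible \<A>"
    and Gm: "\<Gamma> \<in> sets borel" and Pm: "\<Psi> \<in> sets borel"
    and d0: "0 < \<delta>\<^sub>0" and G: "\<Gamma> \<subseteq> {y. \<delta>\<^sub>0 < norm y}" and P: "\<Psi> \<subseteq> {y. \<delta>\<^sub>0 < norm y}"
    and Gn: "emeasure \<nu> (frontier (embE ` mat_preimage \<A> \<Gamma>)) = 0"
    and Pn: "emeasure \<nu> (frontier (embE ` mat_preimage \<A> \<Psi>)) = 0"
    and f: "continuous_on UNIV f" and C: "\<And>p. \<bar>f p\<bar> \<le> C" and C0: "0 < C"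
  shows "(\<lambda>n. expectation (\<lambda>\<omega>. f (exits \<Psi> n \<omega>) * of_bool (hits \<Gamma> n \<omega>))
      / (real n * tail (real n)))
    \<longlonglongrightarrow> tm (mat_preimage \<A> (\<Gamma> \<inter> \<Psi>)) * integral {0..1} (\<lambda>u. f (ereal u, ereal (1 - u)))
      + f (0, 0) * (tm (mat_preimage \<A> \<Gamma>) - tm (mat_preimage \<A> (\<Gamma> \<inter> \<Psi>)))"
proof -
  define g where "g u = f (ereal u, ereal (1 - u))" for u
  have g: "continuous_on UNIV g" unfolding g_def
    by (rule continuous_on_compose2[OF f]) (auto intro!: continuous_on_Pair continuous_on_ereal continuous_intros)
  define pG where "pG n = \<P>(\<omega> in M. limit_jump n 0 \<omega> \<in> \<Gamma>)" for n
  define pI where "pI n = \<P>(\<omega> in M. limit_jump n 0 \<omega> \<in> \<Gamma> \<inter> \<Psi>)" for n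
  have limG: "(\<lambda>n. pG n / tail (real n)) \<longlonglongrightarrow> tm (mat_preimage \<A> \<Gamma>)"
    unfolding pG_def using Gm G d0 tm_frontier[OF Gn] by (rule prob_limit_jump_tendsto)
  have limI: "(\<lambda>n. pI n / tail (real n)) \<longlonglongrightarrow> tm (mat_preimage \<A> (\<Gamma> \<inter> \<Psi>))"
    unfolding pI_def
  proof (rule prob_limit_jump_tendsto)
    have "embE ` frontier (mat_preimage \<A> (\<Gamma> \<inter> \<Psi>))
        \<subseteq> frontier (embE ` mat_preimage \<A> \<Gamma>) \<union> frontier (embE ` mat_preimage \<A> \<Psi>)"
    proof -
      have "mat_preimage \<A> (\<Gamma> \<inter> \<Psi>) = mat_preimage \<A> \<Gamma> \<inter> mat_preimage \<A> \<Psi>" by (auto simp: mat_preimage_def)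
      hence "frontier (mat_preimage \<A> (\<Gamma> \<inter> \<Psi>)) \<subseteq> frontier (mat_preimage \<A> \<Gamma>) \<union> frontier (mat_preimage \<A> \<Psi>)"
        using frontier_Int_subset by simp
      thus ?thesis using embE_frontier_subset[of "mat_preimage \<A> \<Gamma>"] embE_frontier_subset[of "mat_preimage \<A> \<Psi>"] by blast
    qed
    hence "emeasure \<nu> (embE ` frontier (mat_preimage \<A> (\<Gamma> \<inter> \<Psi>)))
        \<le> emeasure \<nu> (frontier (embE ` mat_preimage \<A> \<Gamma>) \<union> frontier (embE ` mat_preimage \<A> \<Psi>))"
      by (intro emeasure_mono) (auto simp: sets_nu)
    also have "\<dots> \<le> emeasure \<nu> (frontier (embE ` mat_preimage \<A> \<Gamma>)) + emeasure \<nu> (frontier (embE ` mat_preimage \<A> \<Psi>))"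
      by (intro emeasure_subadditive) (auto simp: sets_nu)
    finally show "tm (frontier (mat_preimage \<A> (\<Gamma> \<inter> \<Psi>))) = 0" using Gn Pn by (simp add: tm_def measure_def)
  qed (use Gm Pm G d0 in auto)
  have main: "(\<Sum>m\<in>{0..int n - 1}. expectation (single_jump_value \<Gamma> \<Psi> f n m))
      = (\<Sum>k<n. g (real k / real n)) * pI n + real n * (f (0, 0) * (pG n - pI n))" for n
  proof -
    have "(\<Sum>m\<in>{0..int n - 1}. expectation (single_jump_value \<Gamma> \<Psi> f n m))
        = (\<Sum>m\<in>int ` {..<n}. expectation (single_jump_value \<Gamma> \<Psi> f n m))"
    proof (rule sum.cong)
      show "{0..int n - 1} = int ` {..<n}" by (auto simp: image_iff intro!: bexI[of _ "nat _"])
    qed simp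
    also have "\<dots> = (\<Sum>k<n. expectation (single_jump_value \<Gamma> \<Psi> f n (int k)))"
      by (subst sum.reindex) auto
    also have "\<dots> = (\<Sum>k<n. g (real k / real n) * pI n + f (0, 0) * (pG n - pI n))"
      by (simp add: expectation_single_jump_value[OF Gm Pm] g_def pG_def pI_def)
    finally show ?thesis by (simp add: sum.distrib sum_distrib_right)
  qed
  define Mn where "Mn n = (\<Sum>m\<in>{0..int n - 1}. expectation (single_jump_value \<Gamma> \<Psi> f n m))" for n
  define Xn where "Xn n = expectation (\<lambda>\<omega>. f (exits \<Psi> n \<omega>) * of_bool (hits \<Gamma> n \<omega>))" for n
  define Lm where "Lm = integral {0..1} g * tm (mat_preimage \<A> (\<Gamma> \<inter> \<Psi>))
      + f (0, 0) * (tm (mat_preimage \<A> \<Gamma>) - tm (mat_preimage \<A> (\<Gamma> \<inter> \<Psi>)))"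
  have "(\<lambda>n. (\<Sum>k<n. g (real k / real n)) / real n * (pI n / tail (real n))
      + f (0, 0) * (pG n / tail (real n) - pI n / tail (real n))) \<longlonglongrightarrow> Lm"
    unfolding Lm_def
    by (intro tendsto_add tendsto_mult tendsto_diff tendsto_const limG limI riemann_sum_tendsto continuous_on_subset[OF g]) auto
  moreover have "\<forall>\<^sub>F n in sequentially. (\<Sum>k<n. g (real k / real n)) / real n * (pI n / tail (real n))
      + f (0, 0) * (pG n / tail (real n) - pI n / tail (real n)) = Mn n / (real n * tail (real n))"
    using eventually_ge_at_top[of 1]
  proof eventually_elim
    case (elim n)
    thus ?case unfolding Mn_def main by (simp add: add_divide_distrib diff_divide_distrib right_diff_distrib)
  qed
  ultimately have limM: "(\<lambda>n. Mn n / (real n * tail (real n))) \<longlonglongrightarrow> Lm" by (rule Lim_transform_eventually)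
  have "(\<lambda>n. Xn n / (real n * tail (real n)) - Mn n / (real n * tail (real n))) \<longlonglongrightarrow> 0"
  proof (rule tendstoI)
    fix e :: real assume e: "0 < e"
    have "\<forall>\<^sub>F n in sequentially. \<bar>Xn n - Mn n\<bar> \<le> e / 2 * (real n * tail (real n))"
      unfolding Xn_def Mn_def
      by (rule exits_asymptotics[OF inv Gm Pm d0 G P Gn Pn f C C0]) (use e in simp)
    thus "\<forall>\<^sub>F n in sequentially. dist (Xn n / (real n * tail (real n)) - Mn n / (real n * tail (real n))) 0 < e"
      using eventually_compose_filterlim[OF tail_pos filterlim_real_sequentially] eventually_ge_at_top[of 1]
    proof eventually_elim
      case (elim n)
      define s where "s = real n * tail (real n)"
      have s: "0 < s" using elim by (simp add: s_def)
      have "dist (Xn n / s - Mn n / s) 0 = \<bar>Xn n - Mn n\<bar> / s"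
        using s by (simp add: dist_real_def abs_divide flip: diff_divide_distrib)
      also have "\<dots> \<le> e / 2" using elim(1) s by (simp add: s_def[symmetric] divide_le_eq)
      finally show ?case using e by (simp add: s_def)
    qed
  qed
  from tendsto_add[OF this limM] have "(\<lambda>n. Xn n / (real n * tail (real n))) \<longlonglongrightarrow> Lm" by simp
  thus ?thesis by (simp add: Xn_def Lm_def g_def[abs_def] mult.commute)
qed

text \<open>Conditional expectations are quotients of two limits of the preceding kind, the
  denominator being the case f = 1; the normalisation \<open>n * tail n\<close> cancels.
  Admissibility of \<Gamma> makes the limiting denominator positive.\<close>

lemma exits_cond_weak_conv:
  assumes inv: "invertible \<A>"
    and adG: "admissible_failure_set \<nu> \<A> \<Gamma>" and adP: "admissible_failure_set \<nu> \<A> \<Psi>"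
  shows "cond_weak_conv M (exits \<Psi>)
      (\<lambda>n. {\<omega>\<in>space M. hits \<Gamma> n \<omega>})
      (mixture_law_expect (tm (mat_preimage \<A> (\<Psi> \<inter> \<Gamma>)) / tm (mat_preimage \<A> \<Gamma>)))"
    and "0 < tm (mat_preimage \<A> \<Gamma>)"
proof -
  obtain \<delta>1 \<delta>2 where del: "0 < \<delta>1" "\<Gamma> \<subseteq> {y. \<delta>1 < norm y}" "0 < \<delta>2" "\<Psi> \<subseteq> {y. \<delta>2 < norm y}"
    using adG adP unfolding admissible_failure_set_def by blast
  define \<delta>\<^sub>0 where "\<delta>\<^sub>0 = min \<delta>1 \<delta>2"
  have d0: "0 < \<delta>\<^sub>0" "\<Gamma> \<subseteq> {y. \<delta>\<^sub>0 < norm y}" "\<Psi> \<subseteq> {y. \<delta>\<^sub>0 < norm y}" using del by (auto simp: \<delta>\<^sub>0_def)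
  have Gm: "\<Gamma> \<in> sets borel" and Pm: "\<Psi> \<in> sets borel"
    and Gn: "emeasure \<nu> (frontier (embE ` mat_preimage \<A> \<Gamma>)) = 0"
    and Pn: "emeasure \<nu> (frontier (embE ` mat_preimage \<A> \<Psi>)) = 0"
    and Gpos: "0 < emeasure \<nu> (embE ` mat_preimage \<A> \<Gamma>)"
    using adG adP unfolding admissible_failure_set_def by auto
  have "emeasure \<nu> (embE ` mat_preimage \<A> \<Gamma>) < \<infinity>"
    using zero_notin_closure_mat_preimage[OF d0(1,2)] closure_subset
    by (intro nu_embE_finite[of "closure (mat_preimage \<A> \<Gamma>)"]) auto
  thus tpos: "0 < tm (mat_preimage \<A> \<Gamma>)"
    unfolding tm_def measure_def using Gpos by (simp add: enn2real_positive_iff)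
  define B where "B n = {\<omega>\<in>space M. hits \<Gamma> n \<omega>}" for n
  define s where "s n = real n * tail (real n)" for n
  have Bm: "\<forall>\<^sub>F n in sequentially. B n \<in> events"
    using eventually_ge_at_top[of 1]
  proof eventually_elim
    case (elim n)
    hence "B n = {\<omega>\<in>space M. (1 / real n) *\<^sub>R block_sum A Z n 0 \<omega> \<in> \<Gamma>}" by (auto simp: B_def mem_scaleR_image_iff)
    thus ?case using Gm by simp
  qed
  have X: "expectation (\<lambda>\<omega>. f (exits \<Psi> n \<omega>) * of_bool (hits \<Gamma> n \<omega>))
      = expectation (\<lambda>\<omega>. f (exits \<Psi> n \<omega>) * indicator (B n) \<omega>)" for n and f :: "ereal \<times> ereal \<Rightarrow> real"
    by (intro Bochner_Integration.integral_cong) (auto simp: B_def indicator_def)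
  have lim1: "(\<lambda>n. prob (B n) / s n) \<longlonglongrightarrow> tm (mat_preimage \<A> \<Gamma>)"
  proof -
    have "(\<lambda>n. expectation (\<lambda>\<omega>. 1 * of_bool (hits \<Gamma> n \<omega>)) / (real n * tail (real n)))
        \<longlonglongrightarrow> tm (mat_preimage \<A> (\<Gamma> \<inter> \<Psi>)) * integral {0..1::real} (\<lambda>u. 1)
          + 1 * (tm (mat_preimage \<A> \<Gamma>) - tm (mat_preimage \<A> (\<Gamma> \<inter> \<Psi>)))"
      by (rule exits_limit[OF inv Gm Pm d0 Gn Pn, of "\<lambda>_. 1" 1]) auto
    moreover have "tm (mat_preimage \<A> (\<Gamma> \<inter> \<Psi>)) * integral {0..1::real} (\<lambda>u. 1)
          + 1 * (tm (mat_preimage \<A> \<Gamma>) - tm (mat_preimage \<A> (\<Gamma> \<inter> \<Psi>))) = tm (mat_preimage \<A> \<Gamma>)" by simp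
    ultimately have "(\<lambda>n. expectation (\<lambda>\<omega>. 1 * indicator (B n) \<omega>) / s n) \<longlonglongrightarrow> tm (mat_preimage \<A> \<Gamma>)"
      unfolding X[of "\<lambda>_. 1"] s_def by (simp only:)
    moreover have "\<forall>\<^sub>F n in sequentially. expectation (\<lambda>\<omega>. 1 * indicator (B n) \<omega>) / s n = prob (B n) / s n"
    proof -
      have "B n \<inter> space M = B n" for n by (auto simp: B_def)
      from Bm show ?thesis by eventually_elim (simp add: \<open>\<And>n. B n \<inter> space M = B n\<close>)
    qed
    ultimately show ?thesis by (rule Lim_transform_eventually)
  qed
  show "cond_weak_conv M (exits \<Psi>) (\<lambda>n. {\<omega>\<in>space M. hits \<Gamma> n \<omega>})
      (mixture_law_expect (tm (mat_preimage \<A> (\<Psi> \<inter> \<Gamma>)) / tm (mat_preimage \<A> \<Gamma>)))"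
    unfolding cond_weak_conv_def B_def[symmetric]
  proof (intro allI impI, elim conjE)
    fix f :: "ereal \<times> ereal \<Rightarrow> real" assume f: "continuous_on UNIV f" "bounded (range f)"
    obtain C0 where "\<And>p. \<bar>f p\<bar> \<le> C0" using f(2) by (auto simp: bounded_iff)
    \<comment> \<open>A strictly positive bound, as required for dividing by it in the choice of
      constants; f itself may be 0.\<close>
    hence C: "\<bar>f p\<bar> \<le> max 1 C0" for p by (meson max.coboundedI2)
    define I where "I = integral {0..1} (\<lambda>u. f (ereal u, ereal (1 - u)))"
    define \<Gamma>' \<Psi>' where "\<Gamma>' = tm (mat_preimage \<A> \<Gamma>)" and "\<Psi>' = tm (mat_preimage \<A> (\<Psi> \<inter> \<Gamma>))"
    have g: "continuous_on UNIV (\<lambda>u::real. f (ereal u, ereal (1 - u)))"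
      by (rule continuous_on_compose2[OF f(1)]) (auto intro!: continuous_on_Pair continuous_on_ereal continuous_intros)
    have "(\<lambda>n. expectation (\<lambda>\<omega>. f (exits \<Psi> n \<omega>) * indicator (B n) \<omega>) / s n) \<longlonglongrightarrow> \<Psi>' * I + f (0, 0) * (\<Gamma>' - \<Psi>')"
      using exits_limit[OF inv Gm Pm d0 Gn Pn f(1) C]
      unfolding X s_def I_def \<Gamma>'_def \<Psi>'_def by (simp add: Int_commute)
    from tendsto_divide[OF this lim1] tpos
    have lim: "(\<lambda>n. (expectation (\<lambda>\<omega>. f (exits \<Psi> n \<omega>) * indicator (B n) \<omega>) / s n) / (prob (B n) / s n))
        \<longlonglongrightarrow> (\<Psi>' * I + f (0, 0) * (\<Gamma>' - \<Psi>')) / \<Gamma>'" by (simp add: \<Gamma>'_def)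
    have "\<forall>\<^sub>F n in sequentially. (expectation (\<lambda>\<omega>. f (exits \<Psi> n \<omega>) * indicator (B n) \<omega>) / s n) / (prob (B n) / s n)
        = expectation (\<lambda>\<omega>. f (exits \<Psi> n \<omega>) * indicator (B n) \<omega>) / prob (B n)"
      using eventually_compose_filterlim[OF tail_pos filterlim_real_sequentially] eventually_ge_at_top[of 1]
      by eventually_elim (simp add: s_def)
    from Lim_transform_eventually[OF lim this]
    have "(\<lambda>n. expectation (\<lambda>\<omega>. f (exits \<Psi> n \<omega>) * indicator (B n) \<omega>) / prob (B n))
        \<longlonglongrightarrow> (\<Psi>' * I + f (0, 0) * (\<Gamma>' - \<Psi>')) / \<Gamma>'" .
    moreover have "(\<Psi>' * I + f (0, 0) * (\<Gamma>' - \<Psi>')) / \<Gamma>' = mixture_law_expect (\<Psi>' / \<Gamma>') f"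
      using tpos unfolding mixture_law_expect_def integral_uniform_unit_interval[OF g] I_def[symmetric] \<Gamma>'_def[symmetric]
      by (simp add: field_simps)
    ultimately show "(\<lambda>n. expectation (\<lambda>\<omega>. f (exits \<Psi> n \<omega>) * indicator (B n) \<omega>) / prob (B n))
        \<longlonglongrightarrow> mixture_law_expect (tm (mat_preimage \<A> (\<Psi> \<inter> \<Gamma>)) / tm (mat_preimage \<A> \<Gamma>)) f"
      by (simp add: \<Gamma>'_def \<Psi>'_def)
  qed
qed

end

theorem theorem2p4:
  fixes M :: "'a measure"
    and Z :: "int \<Rightarrow> 'a \<Rightarrow> real^'d"
    and A :: "int \<Rightarrow> real^'d^'d"
    and \<alpha> :: real
    and \<nu> :: "(ereal^'d) measure"
    and \<Gamma> \<Psi> :: "(real^'d) set"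
  assumes "prob_space M"
    and "\<And>i. Z i \<in> borel_measurable M"
    and "prob_space.indep_vars M (\<lambda>_. borel) Z UNIV"
    and "\<And>i. distr M borel (Z i) = distr M borel (Z 0)"
    and "integrable M (Z 0)" and "(\<integral>\<omega>. Z 0 \<omega> \<partial>M) = 0"
    and "1 < \<alpha>"
    and "regularly_varying M (Z 0) \<alpha> \<nu>"
    and "(\<lambda>i. onorm ((*v) (A i))) summable_on UNIV"
    and "invertible (\<Sum>\<^sub>\<infinity>i. A i)"
    and "admissible_failure_set \<nu> (\<Sum>\<^sub>\<infinity>i. A i) \<Gamma>"
    and "admissible_failure_set \<nu> (\<Sum>\<^sub>\<infinity>i. A i) \<Psi>"
  shows "cond_weak_conv M
           (\<lambda>n \<omega>. (J_plus A Z \<Psi> n \<omega> / ereal (real n), - J_minus A Z \<Psi> n \<omega> / ereal (real n)))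
           (\<lambda>n. {\<omega>\<in>space M. block_sum A Z n 0 \<omega> \<in> (\<lambda>y. real n *\<^sub>R y) ` \<Gamma>})
           (mixture_law_expect
              (measure \<nu> (embE ` mat_preimage (\<Sum>\<^sub>\<infinity>i. A i) (\<Psi> \<inter> \<Gamma>))
               / measure \<nu> (embE ` mat_preimage (\<Sum>\<^sub>\<infinity>i. A i) \<Gamma>)))
       \<and> cond_weak_conv M
           (\<lambda>n \<omega>. (J_plus A Z \<Gamma> n \<omega> / ereal (real n), - J_minus A Z \<Gamma> n \<omega> / ereal (real n)))
           (\<lambda>n. {\<omega>\<in>space M. block_sum A Z n 0 \<omega> \<in> (\<lambda>y. real n *\<^sub>R y) ` \<Gamma>})
           (mixture_law_expect 1)"
proof -
  interpret prob_space M by fact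
  interpret heavy_tail_process M Z \<alpha> \<nu> A
    by unfold_locales (use assms in auto)
  note inv = assms(10)[folded \<A>_def] and adG = assms(11)[folded \<A>_def] and adP = assms(12)[folded \<A>_def]
  have e: "exits H = (\<lambda>n \<omega>. (J_plus A Z H n \<omega> / ereal (real n), - J_minus A Z H n \<omega> / ereal (real n)))" for H
    by (intro ext) (simp add: exits_def)
  \<comment> \<open>For equal failure sets the mixing weight is a number divided by itself.
    Positivity of the denominator matters, since division by 0 would give 0.\<close>
  have "tm (mat_preimage \<A> (\<Gamma> \<inter> \<Gamma>)) / tm (mat_preimage \<A> \<Gamma>) = 1"
    using exits_cond_weak_conv(2)[OF inv adG adG] by simp
  thus ?thesis
    using exits_cond_weak_conv(1)[OF inv adG adP] exits_cond_weak_conv(1)[OF inv adG adG]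
    unfolding e tm_def \<A>_def by simp
qed

end
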